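(* Let $X$ be a connected $2$-dimensional manifold (possibly with boundary) and let $\Delta$ be a foliation on $X$ belonging to class $\mathcal{F}$. Suppose that the family $\Sigma$ of all special leaves of $\Delta$ is locally finite, and let $Q$ be a connected component of $X\setminus(\Sigma\cup\partial X)$. Then: (1) $Q$ (with the foliation by the leaves of $\Delta$ contained in it) is foliated homeomorphic either with the standard cylinder $C$, or with the standard Möbius band $M$, or with the open model strip $\mathbb{R}\times(-1,1)$ foliated by the lines $\mathbb{R}\times\{t\}$. Moreover, in the first two cases $Q=X$. (2) Suppose $Q$ is foliated homeomorphic with the open model strip. Fix any foliated homeomorphism $\phi:\mathbb{R}\times(-1,1)\to Q$ and put $Q_-=\phi(\mathbb{R}\times(-1,0])$ and $Q_+=\phi(\mathbb{R}\times[0,1))$. Then the closures $\overline{Q_-}$ and $\overline{Q_+}$ in $X$, each foliated by the leaves of $\Delta$ contained in it, are foliated homeomorphic to some model strips with their canonical foliations.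
   Context: A one-dimensional foliation $\Delta$ on a 2-dimensional manifold $X$ (possibly non-connected, possibly with boundary) belongs to class $\mathcal{F}$ if: (i) each leaf of $\Delta$ is a closed subset of $X$; (ii) every connected component of $\partial X$ is a leaf of $\Delta$; (iii) for each leaf $\omega$, with $J=[0,1)$ if $\omega\subset\partial X$ and $J=(-1,1)$ otherwise, there exist an open neighborhood $U$ of $\omega$ and a homeomorphism $\phi:\mathbb{R}\times J\to U$ with $\phi(\mathbb{R}\times 0)=\omega$ and $\phi(\mathbb{R}\times t)$ a leaf of $\Delta$ for all $t\in J$. A homeomorphism between foliated surfaces is foliated if it maps leaves onto leaves. Let $Y=X/\Delta$ be the space of leaves with the quotient topology and $p:X\to Y$ the quotient map. A point $y\in Y$ is special if $y\neq\bigcap_{V}\overline{V}$, where $V$ runs over all neighborhoods of $y$ (i.e. this intersection is not $\{y\}$); a leaf $\omega$ is special if $p(\omega)$ is a special point. A family of subsets is locally finite if every point of $X$ has a neighborhood meeting only finitely many of them. A model strip is a subset $S\subset\mathbb{R}^2$ such that for some $a<b$: $\mathbb{R}\times(a,b)\subset S\subset\mathbb{R}\times[a,b]$ and $S\cap(\mathbb{R}\times\{a,b\})$ is a disjoint union of open intervals. Its canonical foliation consists of the lines $\mathbb{R}\times\{t\}$, $a<t<b$, and the open intervals forming $S\cap(\mathbb{R}\times\{a,b\})$. The standard cylinder $C$ (resp. standard Möbius band $M$) is the quotient of $\mathbb{R}\times[-1,1]$ by identifying $(t,-1)$ with $(t,1)$ (resp. with $(-t,1)$) for all $t\in\mathbb{R}$,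 foliated by the images of the lines $\mathbb{R}\times\{s\}$, $s\in[-1,1]$. *)

theory Defs
  imports "HOL-Analysis.Analysis"
begin

definition half_plane :: "(real \<times> real) set" where
  "half_plane = {p. snd p \<ge> 0}"

definition two_manifold :: "'a topology \<Rightarrow> bool" where
  "two_manifold X \<longleftrightarrow> Hausdorff_space X \<and> second_countable X \<and>
     (\<forall>x\<in>topspace X. \<exists>U V. openin X U \<and> x \<in> U \<and> openin (top_of_set half_plane) V \<and>
        subtopology X U homeomorphic_space top_of_set V)"

definition mboundary :: "'a topology \<Rightarrow> 'a set" where
  "mboundary X = {x \<in> topspace X. \<not> (\<exists>U V. openin X U \<and> x \<in> U \<and> open (V :: (real \<times> real) set) \<and>
        subtopology X U homeomorphic_space top_of_set V)}"

text \<open>A foliation is given as its set of leaves (a partition of the space).\<close>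
definition class_F :: "'a topology \<Rightarrow> 'a set set \<Rightarrow> bool" where
  "class_F X \<Delta> \<longleftrightarrow>
     (\<forall>L\<in>\<Delta>. L \<noteq> {}) \<and> \<Union>\<Delta> = topspace X \<and> pairwise disjnt \<Delta> \<and>
     (\<forall>L\<in>\<Delta>. closedin X L) \<and>
     connected_components_of (subtopology X (mboundary X)) \<subseteq> \<Delta> \<and>
     (\<forall>L\<in>\<Delta>. \<exists>U \<phi>.
        (let J = (if L \<subseteq> mboundary X then {0..<1} else {-1<..<1::real}) in
          openin X U \<and> L \<subseteq> U \<and>
          homeomorphic_map (top_of_set ((UNIV::real set) \<times> J)) (subtopology X U) \<phi> \<and>
          \<phi> ` ((UNIV::real set) \<times> {0}) = L \<and>
          (\<forall>t\<in>J. \<phi> ` ((UNIV::real set) \<times> {t}) \<in> \<Delta>)))"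

definition foliated_homeomorphic ::
  "'a topology \<Rightarrow> 'a set set \<Rightarrow> 'b topology \<Rightarrow> 'b set set \<Rightarrow> bool" where
  "foliated_homeomorphic X \<Delta> Y \<Gamma> \<longleftrightarrow>
     (\<exists>f. homeomorphic_map X Y f \<and> (\<lambda>L. f ` L) ` \<Delta> = \<Gamma>)"

definition foliated_homeo_map ::
  "'a topology \<Rightarrow> 'a set set \<Rightarrow> 'b topology \<Rightarrow> 'b set set \<Rightarrow> ('a \<Rightarrow> 'b) \<Rightarrow> bool" where
  "foliated_homeo_map X \<Delta> Y \<Gamma> f \<longleftrightarrow> homeomorphic_map X Y f \<and> (\<lambda>L. f ` L) ` \<Delta> = \<Gamma>"

definition restr_fol :: "'a set set \<Rightarrow> 'a set \<Rightarrow> 'a set set" where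
  "restr_fol \<Delta> A = {L \<in> \<Delta>. L \<subseteq> A}"

definition leaf_of :: "'a set set \<Rightarrow> 'a \<Rightarrow> 'a set" where
  "leaf_of \<Delta> x = (THE L. L \<in> \<Delta> \<and> x \<in> L)"

definition leaf_space :: "'a topology \<Rightarrow> 'a set set \<Rightarrow> 'a set topology" where
  "leaf_space X \<Delta> = topology (\<lambda>V. V \<subseteq> \<Delta> \<and> openin X {x \<in> topspace X. leaf_of \<Delta> x \<in> V})"

definition nbhd_of :: "'b topology \<Rightarrow> 'b \<Rightarrow> 'b set \<Rightarrow> bool" where
  "nbhd_of Y y V \<longleftrightarrow> V \<subseteq> topspace Y \<and> (\<exists>U. openin Y U \<and> y \<in> U \<and> U \<subseteq> V)"

definition special_point :: "'b topology \<Rightarrow> 'b \<Rightarrow> bool" where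
  "special_point Y y \<longleftrightarrow> \<Inter>{Y closure_of V | V. nbhd_of Y y V} \<noteq> {y}"

definition special_leaves :: "'a topology \<Rightarrow> 'a set set \<Rightarrow> 'a set set" where
  "special_leaves X \<Delta> = {L \<in> \<Delta>. special_point (leaf_space X \<Delta>) L}"

definition loc_finite_family :: "'a topology \<Rightarrow> 'a set set \<Rightarrow> bool" where
  "loc_finite_family X \<F> \<longleftrightarrow>
     (\<forall>x\<in>topspace X. \<exists>U. openin X U \<and> x \<in> U \<and> finite {S \<in> \<F>. S \<inter> U \<noteq> {}})"

definition open_interval_real :: "real set \<Rightarrow> bool" where
  "open_interval_real I \<longleftrightarrow> I \<noteq> {} \<and> open I \<and> is_interval I"

definition model_strip :: "(real \<times> real) set \<Rightarrow> real \<Rightarrow> real \<Rightarrow> (real \<times> real) set set \<Rightarrow> bool" where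
  "model_strip S a b F \<longleftrightarrow> a < b \<and> (UNIV::real set) \<times> {a<..<b} \<subseteq> S \<and> S \<subseteq> (UNIV::real set) \<times> {a..b} \<and>
     (\<forall>E\<in>F. \<exists>I c. open_interval_real I \<and> c \<in> {a, b} \<and> E = I \<times> {c}) \<and>
     pairwise disjnt F \<and> \<Union>F = S \<inter> ((UNIV::real set) \<times> {a, b})"

definition canonical_fol :: "real \<Rightarrow> real \<Rightarrow> (real \<times> real) set set \<Rightarrow> (real \<times> real) set set" where
  "canonical_fol a b F = {(UNIV::real set) \<times> {t} | t. a < t \<and> t < b} \<union> F"

definition open_strip :: "(real \<times> real) set" where
  "open_strip = (UNIV::real set) \<times> {-1<..<1}"

definition open_strip_fol :: "(real \<times> real) set set" where
  "open_strip_fol = {(UNIV::real set) \<times> {t} | t. -1 < t \<and> t < 1}"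

definition cls :: "'a topology \<Rightarrow> ('a \<Rightarrow> 'a \<Rightarrow> bool) \<Rightarrow> 'a \<Rightarrow> 'a set" where
  "cls T R x = {y \<in> topspace T. R x y}"

definition quot_top :: "'a topology \<Rightarrow> ('a \<Rightarrow> 'a \<Rightarrow> bool) \<Rightarrow> 'a set topology" where
  "quot_top T R = topology (\<lambda>V. V \<subseteq> cls T R ` topspace T \<and>
      openin T {x \<in> topspace T. cls T R x \<in> V})"

definition closed_band :: "(real \<times> real) topology" where
  "closed_band = top_of_set ((UNIV::real set) \<times> {-1..1})"

definition cyl_rel :: "real \<times> real \<Rightarrow> real \<times> real \<Rightarrow> bool" where
  "cyl_rel p q \<longleftrightarrow> p = q \<or>
     (snd p = -1 \<and> snd q = 1 \<and> fst q = fst p) \<or> (snd p = 1 \<and> snd q = -1 \<and> fst q = fst p)"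

definition moeb_rel :: "real \<times> real \<Rightarrow> real \<times> real \<Rightarrow> bool" where
  "moeb_rel p q \<longleftrightarrow> p = q \<or>
     (snd p = -1 \<and> snd q = 1 \<and> fst q = - fst p) \<or> (snd p = 1 \<and> snd q = -1 \<and> fst q = - fst p)"

definition std_cylinder :: "(real \<times> real) set topology" where
  "std_cylinder = quot_top closed_band cyl_rel"

definition std_cylinder_fol :: "(real \<times> real) set set set" where
  "std_cylinder_fol = {cls closed_band cyl_rel ` ((UNIV::real set) \<times> {s}) | s. -1 \<le> s \<and> s \<le> 1}"

definition std_moebius :: "(real \<times> real) set topology" where
  "std_moebius = quot_top closed_band moeb_rel"

definition std_moebius_fol :: "(real \<times> real) set set set" where
  "std_moebius_fol = {cls closed_band moeb_rel ` ((UNIV::real set) \<times> {s}) | s. -1 \<le> s \<and> s \<le> 1}"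

end

theory Submission
  imports Defs
begin

text \<open>The non-special leaves in the component \<open>Q\<close> form a connected, Hausdorff, second countable
  one-manifold without boundary, hence a line or a circle, and \<open>Q\<close> is a locally trivial bundle of
  lines over it. Trivialisations over adjacent intervals are glued along a common leaf, so over a
  line \<open>Q\<close> is the open strip; over a circle the monodromy is a homeomorphism of the real line, which a
  linear isotopy deforms to \<open>x \<mapsto> x\<close> or \<open>x \<mapsto> - x\<close>. In the circle case the leaf space of \<open>Q\<close> is compact, and
  compact sets of non-special leaves are closed, so \<open>Q\<close> is also closed.

  For the closure of a half strip, every leaf \<open>L\<close> added at the end has a one-sided collar whose leaves
  are exactly the leaves near the end of the strip. The collar coordinate, squashed by \<open>arctan\<close>,
  extends continuously to the whole closure and is constantly \<open>pi / 2\<close> or \<open>- pi / 2\<close> on every other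
  added leaf. A weighted sum of these functions over the countably many added leaves maps
  each leaf of the half strip increasingly onto one fixed open interval and the added leaves onto
  disjoint open subintervals of it, which straightens the closure to a model strip.\<close>

section \<open>Arcs in one-dimensional manifolds\<close>

text \<open>Local finiteness enters through one fact: a thin enough collar contains no special leaf
  except possibly its core. Each side of the core is then a connected set of ordinary points, so it
  lies in \<open>Q\<close> or misses it. The leaf space itself need not be Hausdorff, but a
  non-special leaf is separated from every other leaf, special or not, and this is enough for the
  usual compactness arguments. The obstacle in the second part is the order of the added leaves.
  They are countable, but along the end they may be ordered like any countable set, for instance
  densely, so their intervals cannot be laid out one after another. The weighted sum needs no
  explicit order: for two points at the end all summands are weakly ordered in the same way, and the
  summand of a leaf through one of the points tells them apart. The weights add up to 1, so the sum
  stays strictly between \<open>- pi / 2\<close> and \<open>pi / 2\<close>, and \<open>tan\<close>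
  spreads it over the line. The two halves are treated apart because a leaf may be approached by
  both ends of \<open>Q\<close>, once from each side; one half reaches it from one side
  only.\<close>

definition arc_on :: "'b topology \<Rightarrow> real set \<Rightarrow> (real \<Rightarrow> 'b) \<Rightarrow> bool" where
  "arc_on T S f \<longleftrightarrow> open S \<and> continuous_map (top_of_set S) T f \<and> inj_on f S"

text \<open>A parametrised circle that exhausts \<open>T\<close>. Covering the whole space is part
  of the notion, so the existence of such a curve already is the circle case of the
  classification.\<close>

definition closed_curve :: "'b topology \<Rightarrow> real \<Rightarrow> real \<Rightarrow> (real \<Rightarrow> 'b) \<Rightarrow> bool" where
  "closed_curve T a b c \<longleftrightarrow> a < b \<and> continuous_map (top_of_set {a..b}) T c \<and> c a = c b \<and>
     inj_on c {a..<b} \<and> c ` {a..b} = topspace T"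

lemma openin_top_of_set_iff:
  assumes "open S" shows "openin (top_of_set S) W \<longleftrightarrow> open W \<and> W \<subseteq> S"
  using assms openin_open_eq by blast

lemma open_preimage_arc:
  assumes "arc_on T S f" "openin T O'"
  shows "open {t\<in>S. f t \<in> O'}"
  using assms openin_continuous_map_preimage[of "top_of_set S" T f O']
  by (auto simp: arc_on_def openin_top_of_set_iff)

lemma open_nbhd_real:
  fixes W :: "real set"
  assumes "open W" "s \<in> W"
  obtains e where "e > 0" "\<And>x. \<bar>x - s\<bar> < e \<Longrightarrow> x \<in> W"
  using assms unfolding open_dist dist_real_def by metis

locale one_manifold =
  fixes T :: "'b topology"
  assumes Hausdorff: "Hausdorff_space T"
    and chart: "\<And>x. x \<in> topspace T \<Longrightarrow> \<exists>U e. openin T U \<and> x \<in> U \<and>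
          homeomorphic_map (top_of_set {-1<..<1::real}) (subtopology T U) e"
begin

text \<open>Read in a chart, the arc becomes a continuous injection between subsets of the line, so
  invariance of domain applies near every point.\<close>

lemma arc_open_image:
  assumes f: "arc_on T S f" and W: "open W" "W \<subseteq> S"
  shows "openin T (f ` W)"
proof (subst openin_subopen, intro ballI)
  fix x assume "x \<in> f ` W"
  then obtain w where w: "w \<in> W" "x = f w" by auto
  have "x \<in> topspace T"
    using f w W by (auto simp: arc_on_def continuous_map_def)
  then obtain U e where U: "openin T U" "x \<in> U"
    and "homeomorphic_map (top_of_set {-1<..<1::real}) (subtopology T U) e"
    using chart by blast
  then obtain k where k: "homeomorphic_maps (top_of_set {-1<..<1::real}) (subtopology T U) e k"
    unfolding homeomorphic_map_maps by blast
  have UT: "topspace (subtopology T U) = U"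
    using U openin_subset by fastforce
  have "open ({t\<in>S. f t \<in> U} \<inter> W)"
    using open_preimage_arc[OF f U(1)] W by blast
  moreover have "w \<in> {t\<in>S. f t \<in> U} \<inter> W" using w W U by auto
  ultimately obtain \<epsilon> where \<epsilon>: "\<epsilon> > 0" "\<And>t. \<bar>t - w\<bar> < \<epsilon> \<Longrightarrow> t \<in> {t\<in>S. f t \<in> U} \<inter> W"
    using open_nbhd_real by metis
  define B where "B = {w-\<epsilon><..<w+\<epsilon>}"
  have B: "B \<subseteq> W" "B \<subseteq> S" "f ` B \<subseteq> U" "w \<in> B" "open B"
    using \<epsilon> by (force simp: B_def abs_if)+
  have cf: "continuous_map (top_of_set B) (subtopology T U) f"
    using f B unfolding arc_on_def
    by (metis continuous_map_from_subtopology_mono continuous_map_in_subtopology image_subset_iff_funcset topspace_euclidean_subtopology)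
  have ck: "continuous_map (subtopology T U) (top_of_set {-1<..<1::real}) k"
    using k by (simp add: homeomorphic_maps_def)
  have c: "continuous_on B (k \<circ> f)"
    using continuous_map_compose[OF cf ck] by (simp add: continuous_map_in_subtopology)
  have ek: "\<And>y. y \<in> U \<Longrightarrow> e (k y) = y"
    using k UT by (simp add: homeomorphic_maps_def)
  have "inj_on (k \<circ> f) B"
    by (rule inj_onI) (metis B(2,3) arc_on_def comp_apply ek f image_subset_iff inj_on_def subset_eq)
  then have o: "open ((k \<circ> f) ` B)"
    using invariance_of_domain[OF c] B by blast
  have "(k \<circ> f) ` B \<subseteq> {-1<..<1}"
    using continuous_map_compose[OF cf ck] by (auto simp: continuous_map_def)
  then have "openin (top_of_set {-1<..<1}) ((k \<circ> f) ` B)" using o by (simp add: openin_top_of_set_iff)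
  then have "openin (subtopology T U) (e ` ((k \<circ> f) ` B))"
    using k homeomorphic_maps_imp_map homeomorphic_imp_open_map open_map_def by metis
  moreover have "e ` ((k \<circ> f) ` B) = f ` B"
    using ek B by (force simp: image_iff)
  ultimately have "openin T (f ` B)" using U openin_trans_full by metis
  then show "\<exists>V. openin T V \<and> x \<in> V \<and> V \<subseteq> f ` W" using w B by blast
qed

lemma arc_homeomorphic_map:
  assumes f: "arc_on T S f"
  shows "homeomorphic_map (top_of_set S) (subtopology T (f ` S)) f"
proof -
  have "open_map (top_of_set S) T f"
    using f arc_open_image[OF f] by (auto simp: open_map_def openin_top_of_set_iff arc_on_def)
  moreover have "f ` S \<subseteq> topspace T"
    using f by (auto simp: arc_on_def continuous_map_def)
  ultimately show ?thesis
    using f unfolding arc_on_def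
    by (intro bijective_open_imp_homeomorphic_map)
      (simp_all add: continuous_map_in_subtopology open_map_into_subtopology Int_absorb1)
qed

text \<open>The overlap of two arcs is studied through the real function \<open>j\<close>, the
  inverse of \<open>f\<close> after \<open>g\<close>. Being continuous and injective, it is strictly
  monotone on every interval on which it is defined.\<close>

lemma arc_transition:
  assumes f: "arc_on T S f" and g: "arc_on T S' g"
  obtains j where "continuous_on {s\<in>S'. g s \<in> f ` S} j"
    "\<And>s. \<lbrakk>s \<in> S'; g s \<in> f ` S\<rbrakk> \<Longrightarrow> j s \<in> S \<and> f (j s) = g s"
    "inj_on j {s\<in>S'. g s \<in> f ` S}"
proof -
  obtain k where k: "homeomorphic_maps (top_of_set S) (subtopology T (f ` S)) f k"
    using arc_homeomorphic_map[OF f] unfolding homeomorphic_map_maps by blast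
  have fS: "f ` S \<subseteq> topspace T" using f by (auto simp: arc_on_def continuous_map_def)
  let ?W = "{s\<in>S'. g s \<in> f ` S}"
  have cg: "continuous_map (top_of_set ?W) (subtopology T (f ` S)) g"
    using g unfolding arc_on_def continuous_map_in_subtopology
    by (auto elim: continuous_map_from_subtopology_mono)
  have ck: "continuous_map (subtopology T (f ` S)) (top_of_set S) k"
    using k by (simp add: homeomorphic_maps_def)
  show ?thesis
  proof
    show "continuous_on ?W (k \<circ> g)"
      using continuous_map_compose[OF cg ck] by (simp add: continuous_map_in_subtopology)
    show *: "(k \<circ> g) s \<in> S \<and> f ((k \<circ> g) s) = g s" if "s \<in> S'" "g s \<in> f ` S" for s
      using k that fS by (auto simp: homeomorphic_maps_def continuous_map_def subset_iff)
    show "inj_on (k \<circ> g) ?W"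
      by (rule inj_onI) (metis (mono_tags, lifting) * arc_on_def g inj_on_def mem_Collect_eq)
  qed
qed

text \<open>Hausdorffness makes the compact image of \<open>K\<close> closed. For a transition
  function this means that it leaves every compact part of \<open>S\<close> as the parameter of
  \<open>g\<close> tends to a point outside the overlap.\<close>

lemma arc_avoids_compact:
  assumes f: "arc_on T S f" and K: "compact K" "K \<subseteq> S"
    and g: "arc_on T S' g" and q: "q \<in> S'" "g q \<notin> f ` K"
  obtains e where "e > 0" "\<And>s. \<bar>s - q\<bar> < e \<Longrightarrow> s \<in> S' \<and> g s \<notin> f ` K"
proof -
  have "compactin T (f ` K)"
    using K f image_compactin[of "top_of_set S" K T f]
    by (auto simp: arc_on_def compactin_subtopology)
  then have "closedin T (f ` K)" using Hausdorff compactin_imp_closedin by blast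
  then have "openin T (topspace T - f ` K)" by blast
  from open_preimage_arc[OF g this]
  have "open {t \<in> S'. g t \<in> topspace T - f ` K}" .
  moreover have "q \<in> {t \<in> S'. g t \<in> topspace T - f ` K}"
    using q g by (auto simp: arc_on_def continuous_map_def)
  ultimately obtain e where "e > 0" "\<And>s. \<bar>s - q\<bar> < e \<Longrightarrow> s \<in> {t \<in> S'. g t \<in> topspace T - f ` K}"
    using open_nbhd_real by blast
  then show ?thesis using that[of e] by blast
qed

end

lemma open_realI:
  fixes S :: "real set"
  assumes "\<And>x. x \<in> S \<Longrightarrow> \<exists>e>0. \<forall>y. \<bar>y - x\<bar> < e \<longrightarrow> y \<in> S"
  shows "open S"
  using assms by (auto simp: open_dist dist_real_def)

section \<open>Prolonging one arc along another\<close>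

context one_manifold begin

text \<open>Follow \<open>g\<close> to the right from \<open>s0\<close>; the values at
  \<open>s0\<close> and \<open>s1\<close> say that it runs in the direction of increasing parameter
  of \<open>f\<close>. If it ever leaves the image of \<open>f\<close>, it does so through the end
  \<open>b\<close>. If it never comes back, its remainder prolongs \<open>f\<close>. If it comes
  back, it must come in through the end \<open>a\<close>, and the two arcs close up to a
  circle.\<close>

lemma arc_extend_right:
  assumes conn: "connected_space T"
    and f: "arc_on T {a<..<b} f" and g: "arc_on T {c<..<d} g"
    and s: "c < s0" "s0 < s1" "s1 < d" and gU: "g ` {s0..s1} \<subseteq> f ` {a<..<b}"
    and t: "a < t0" "t0 < t1" "t1 < b" "g s0 = f t0" "g s1 = f t1"
  shows "(\<exists>u v w. closed_curve T u v w) \<or>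
    (\<exists>b' h. b \<le> b' \<and> arc_on T {a<..<b'} h \<and> (\<forall>t\<in>{a<..<b}. h t = f t) \<and>
        g ` {s0..<d} \<subseteq> h ` {a<..<b'})"
proof -
  define U where "U = f ` {a<..<b}"
  define W where "W = {s\<in>{c<..<d}. g s \<in> U}"
  obtain j where cj: "continuous_on W j" and j: "\<And>s. s \<in> W \<Longrightarrow> a < j s \<and> j s < b \<and> f (j s) = g s"
    and ij: "inj_on j W"
    using arc_transition[OF f g] unfolding W_def U_def by (metis (mono_tags, lifting) greaterThanLessThan_iff mem_Collect_eq)
  have injf: "inj_on f {a<..<b}" and injg: "inj_on g {c<..<d}" using f g by (auto simp: arc_on_def)
  have jeq: "j s = t" if "s \<in> {c<..<d}" "t \<in> {a<..<b}" "g s = f t" for s t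
  proof -
    have "s \<in> W" using that by (auto simp: W_def U_def)
    then show ?thesis using j[of s] that injf by (auto simp: inj_on_def)
  qed
  have oU: "openin T U" using arc_open_image[OF f] U_def by auto
  have oW: "open W" using open_preimage_arc[OF g oU] W_def by simp
  have jt: "j s0 = t0" "j s1 = t1" using s t by (auto intro!: jeq)
  have s01W: "{s0..s1} \<subseteq> W" using gU s by (auto simp: W_def U_def)
  show ?thesis
  proof (cases "g ` {s0..<d} \<subseteq> U")
    case True
    then show ?thesis using f U_def by blast
  next
    case False
    define E where "E = {s\<in>{s1..<d}. g s \<notin> U}"
    have "E \<noteq> {}"
    proof -
      obtain s where "s0 \<le> s" "s < d" "g s \<notin> U" using False by force
      moreover then have "s1 \<le> s" using s01W W_def by force
      ultimately show ?thesis by (auto simp: E_def)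
    qed
    \<comment> \<open>The first exit of \<open>g\<close> from the image of \<open>f\<close> after
      \<open>s1\<close>; as \<open>W\<close> is open, \<open>q\<close> itself lies outside
      \<open>W\<close>.\<close>
    define q where "q = Inf E"
    have Eb: "bdd_below E" by (auto simp: E_def bdd_below_def)
    have qs1: "s1 \<le> q" unfolding q_def using \<open>E \<noteq> {}\<close> by (intro cInf_greatest) (auto simp: E_def)
    have qd: "q < d" using \<open>E \<noteq> {}\<close> cInf_lower[OF _ Eb] unfolding q_def E_def by force
    have qW: "q \<notin> W"
    proof
      assume "q \<in> W"
      then obtain e where e: "e > 0" "\<And>x. \<bar>x - q\<bar> < e \<Longrightarrow> x \<in> W" using oW open_nbhd_real by blast
      obtain x where "x \<in> E" "x < q + e" using \<open>E \<noteq> {}\<close> e(1) cInf_lessD[of E "q+e"] q_def by force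
      moreover have "q \<le> x" using \<open>x \<in> E\<close> Eb q_def cInf_lower by blast
      ultimately have "x \<in> W" using e by force
      then show False using \<open>x \<in> E\<close> by (auto simp: W_def E_def)
    qed
    have qc: "q \<in> {c<..<d}" using qs1 qd s by auto
    have gq: "g q \<notin> U" using qW qc W_def by auto
    have "s1 \<in> W" using s01W s by auto
    then have s1q: "s1 < q" using qW qs1 by (metis order_le_less)
    have below: "{s0..<q} \<subseteq> W"
    proof
      fix x assume x: "x \<in> {s0..<q}"
      show "x \<in> W"
      proof (cases "x \<le> s1")
        case True then show ?thesis using x s01W by auto
      next
        case False
        have "x \<notin> E" using x cInf_lower[OF _ Eb] q_def by force
        then show ?thesis using x False qd s by (auto simp: E_def W_def)
      qed
    qed
    have "strict_mono_on {s0..<q} j \<or> strict_antimono_on {s0..<q} j"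
      using injective_eq_monotone_map[of "{s0..<q}" j] cj ij below
      by (meson continuous_on_subset inj_on_subset is_interval_co)
    moreover have "\<not> strict_antimono_on {s0..<q} j"
    proof
      assume anti: "strict_antimono_on {s0..<q} j"
      have "j s1 < j s0" using monotone_onD[OF anti, of s0 s1] s s1q by auto
      then show False using jt t by auto
    qed
    ultimately have smono: "strict_mono_on {s0..<q} j" by blast
    \<comment> \<open>Near a parameter \<open>r\<close> at which \<open>g\<close> is outside
      \<open>U\<close>, the values of \<open>j\<close> avoid any given compact interval: they can
      only escape to an end of \<open>{a<..<b}\<close>.\<close>
    have avoid: "\<exists>e>0. \<forall>s. \<bar>s - r\<bar> < e \<longrightarrow> s \<in> {c<..<d} \<and> (s \<in> W \<longrightarrow> j s \<notin> {x..y})"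
      if rp: "r \<in> {c<..<d}" "g r \<notin> U" and xy: "a < x" "y < b" for r x y
    proof -
      have sub: "{x..y} \<subseteq> {a<..<b}" using xy by auto
      then have "g r \<notin> f ` {x..y}" using rp(2) U_def by auto
      then obtain e where e: "e > 0" "\<And>s. \<bar>s - r\<bar> < e \<Longrightarrow> s \<in> {c<..<d} \<and> g s \<notin> f ` {x..y}"
        using arc_avoids_compact[OF f compact_Icc sub g rp(1)] by blast
      have "j s \<notin> {x..y}" if "\<bar>s - r\<bar> < e" "s \<in> W" for s
        using e(2)[OF that(1)] j[OF that(2)] by (metis image_eqI)
      then show ?thesis using e by blast
    qed
    \<comment> \<open>At \<open>q\<close> the escape is towards \<open>b\<close>, because the
      increasing \<open>j\<close> stays above \<open>t0\<close>.\<close>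
    have lim: "\<exists>s\<in>{s0..<q}. \<forall>s'\<in>{s..<q}. b' < j s'" if b': "b' < b" for b'
    proof -
      obtain e where e: "e > 0" "\<forall>s. \<bar>s - q\<bar> < e \<longrightarrow> (s \<in> W \<longrightarrow> j s \<notin> {t0..max t0 b'})"
        using avoid[OF qc gq, of t0 "max t0 b'"] t b' by auto
      define s where "s = max s0 (q - e/2)"
      have "b' < j s'" if "s' \<in> {s..<q}" for s'
      proof -
        have "s' \<in> {s0..<q}" "\<bar>s' - q\<bar> < e" using that e(1) by (auto simp: s_def)
        moreover have "t0 \<le> j s'"
          using strict_mono_onD[OF smono, of s0 s'] \<open>s' \<in> {s0..<q}\<close> jt(1) by (cases "s' = s0") auto
        moreover have "s' \<in> W" using below calculation by auto
        ultimately show ?thesis using e by force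
      qed
      moreover have "s \<in> {s0..<q}" using e s s1q by (auto simp: s_def)
      ultimately show ?thesis by blast
    qed
    have onto: "\<exists>s\<in>{s0..<q}. j s = t" if tt: "t0 \<le> t" "t < b" for t
    proof -
      obtain s2 where s2: "s2 \<in> {s0..<q}" "t < j s2" using lim[OF tt(2)] by force
      have "continuous_on {s0..s2} j"
        using cj below s2 by (meson atLeastLessThan_iff atLeastatMost_subset_iff continuous_on_subset ivl_subset order.strict_trans1 subset_trans atLeastAtMost_iff subsetI)
      then obtain s where "s0 \<le> s" "s \<le> s2" "j s = t"
        using IVT'[of j s0 t s2] tt jt s2 by auto
      then show ?thesis using s2 by auto
    qed
    show ?thesis
    proof (cases "\<exists>s. q < s \<and> s \<in> W")
      case False
      then have noW: "\<And>s. q \<le> s \<Longrightarrow> s \<notin> W" using qW by (metis order_le_less)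
      \<comment> \<open>The shift puts \<open>g q\<close> at the missing end \<open>b\<close> of
        \<open>f\<close>.\<close>
      define h where "h t = (if t < b then f t else g (t - b + q))" for t
      define b' where "b' = b + (d - q)"
      have bb: "b < b'" using qd by (auto simp: b'_def)
      have "inj_on h {a<..<b'}"
      proof (rule inj_onI)
        fix x y assume xy: "x \<in> {a<..<b'}" "y \<in> {a<..<b'}" "h x = h y"
        have cross: False if "x < b" "\<not> y < b" "x \<in> {a<..<b'}" "y \<in> {a<..<b'}" "h x = h y" for x y
        proof -
          have "f x \<in> U" unfolding U_def by (rule imageI) (use that in simp)
          moreover have "f x = g (y - b + q)" using that by (simp add: h_def)
          moreover have "y - b + q \<in> {c<..<d}" using that qc by (auto simp: b'_def)
          ultimately have "y - b + q \<in> W" by (simp add: W_def)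
          then show False using noW[of "y - b + q"] that by auto
        qed
        consider "x < b" "y < b" | "\<not> x < b" "\<not> y < b" | "x < b" "\<not> y < b" | "\<not> x < b" "y < b"
          by blast
        then show "x = y"
        proof cases
          case 1
          then show ?thesis using xy inj_onD[OF injf, of x y] by (auto simp: h_def)
        next
          case 2
          have "x - b + q = y - b + q"
            by (rule inj_onD[OF injg]) (use xy 2 qc in \<open>auto simp: h_def b'_def\<close>)
          then show ?thesis by simp
        next
          case 3 then show ?thesis using cross[of x y] xy by blast
        next
          case 4 then show ?thesis using cross[of y x] xy by simp
        qed
      qed
      moreover have "continuous_map (top_of_set {a<..<b'}) T h"
        unfolding continuous_map_def
      proof (intro conjI allI impI funcsetI)
        fix x assume x: "x \<in> topspace (top_of_set {a<..<b'})"
        show "h x \<in> topspace T"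
          using f g x qc unfolding h_def arc_on_def continuous_map_def b'_def by (auto simp: Pi_iff)
      next
        fix O' assume O': "openin T O'"
        have of: "open {t\<in>{a<..<b}. f t \<in> O'}" by (rule open_preimage_arc[OF f O'])
        have og: "open {t\<in>{c<..<d}. g t \<in> O'}" by (rule open_preimage_arc[OF g O'])
        let ?P = "{x \<in> topspace (top_of_set {a<..<b'}). h x \<in> O'}"
        have "open ?P"
        proof (rule open_realI)
          fix x assume x: "x \<in> ?P"
          consider "x < b" | "x = b" | "x > b" by linarith
          then show "\<exists>e>0. \<forall>y. \<bar>y - x\<bar> < e \<longrightarrow> y \<in> ?P"
          proof cases
            case 1
            then have "x \<in> {t\<in>{a<..<b}. f t \<in> O'}" using x by (auto simp: h_def)
            then obtain e where "e > 0" "\<And>y. \<bar>y - x\<bar> < e \<Longrightarrow> y \<in> {t\<in>{a<..<b}. f t \<in> O'}"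
              using of open_nbhd_real by blast
            then show ?thesis using bb by (intro exI[of _ e]) (force simp: h_def)
          next
            case 3
            then have "x - b + q \<in> {t\<in>{c<..<d}. g t \<in> O'}" using x qc by (auto simp: h_def b'_def)
            then obtain e where e: "e > 0" "\<And>y. \<bar>y - (x - b + q)\<bar> < e \<Longrightarrow> y \<in> {t\<in>{c<..<d}. g t \<in> O'}"
              using og open_nbhd_real by blast
            have "y \<in> ?P" if "\<bar>y - x\<bar> < min e (x - b)" for y
              using e(2)[of "y - b + q"] that 3 t by (auto simp: h_def b'_def)
            then show ?thesis using e(1) 3 by (intro exI[of _ "min e (x-b)"]) auto
          next
            case 2
            then have "q \<in> {t\<in>{c<..<d}. g t \<in> O'}" using x qc by (auto simp: h_def)
            then obtain e where e: "e > 0" "\<And>y. \<bar>y - q\<bar> < e \<Longrightarrow> y \<in> {t\<in>{c<..<d}. g t \<in> O'}"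
              using og open_nbhd_real by blast
            \<comment> \<open>Continuity at the seam: by \<open>onto\<close>, parameters slightly
              below \<open>b\<close> are values \<open>j s'\<close> with \<open>s'\<close> close to
              \<open>q\<close>, and there \<open>f\<close> takes the values of \<open>g\<close> near
              \<open>g q\<close>.\<close>
            define s where "s = max s0 (q - e/2)"
            have sq: "s \<in> {s0..<q}" "q - e < s" using e s s1q by (auto simp: s_def)
            have "j s < b" using j below sq by blast
            have "y \<in> ?P" if yx: "\<bar>y - x\<bar> < min e (min (b - j s) (b - t0))" for y
            proof (cases "y < b")
              case True
              then obtain s' where s': "s' \<in> {s0..<q}" "j s' = y" using onto[of y] yx 2 by auto
              have "j s < j s'" using yx True 2 s' by auto
              then have "s < s'" using strict_mono_onD[OF smono, of s' s] s'(1) sq(1)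
                by (metis less_asym less_irrefl linorder_less_linear)
              then have "g s' \<in> O'" using e(2)[of s'] s' sq by auto
              moreover have "f y = g s'" using j[of s'] below s' by auto
              ultimately show ?thesis using True yx 2 t bb by (auto simp: h_def)
            next
              case False
              then show ?thesis using e(2)[of "y - b + q"] yx 2 t by (auto simp: h_def b'_def)
            qed
            moreover have "min e (min (b - j s) (b - t0)) > 0" using e \<open>j s < b\<close> t by auto
            ultimately show ?thesis by blast
          qed
        qed
        then show "openin (top_of_set {a<..<b'}) ?P" by (auto simp: openin_top_of_set_iff)
      qed
      ultimately have "arc_on T {a<..<b'} h" by (simp add: arc_on_def)
      moreover have "g ` {s0..<d} \<subseteq> h ` {a<..<b'}"
      proof
        fix y assume "y \<in> g ` {s0..<d}"
        then obtain s where s: "s0 \<le> s" "s < d" "y = g s" by auto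
        show "y \<in> h ` {a<..<b'}"
        proof (cases "s < q")
          case True
          then have "s \<in> W" using below s by auto
          then show ?thesis using j[of s] s bb by (intro image_eqI[of _ _ "j s"]) (auto simp: h_def)
        next
          case False
          then show ?thesis using s t by (intro image_eqI[of _ _ "s - q + b"]) (auto simp: h_def b'_def)
        qed
      qed
      moreover have "\<forall>t\<in>{a<..<b}. h t = f t" by (auto simp: h_def)
      ultimately show ?thesis using bb by (intro disjI2) (metis order_less_imp_le)
    next
      case True
      then obtain s2 where s2: "q < s2" "s2 \<in> W" by blast
      \<comment> \<open>Every return of \<open>g\<close> to \<open>U\<close> comes in through the
        end \<open>a\<close>. Going back from \<open>s\<close>, let \<open>r\<close> be the last
        parameter outside \<open>U\<close>. The parameters of \<open>f\<close> from
        \<open>t0\<close> up to \<open>b\<close> are already taken before \<open>q\<close>, so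
        \<open>j\<close> stays below \<open>t0\<close> and must tend to \<open>a\<close> at
        \<open>r\<close>.\<close>
      have reent: "\<exists>r\<ge>q. r < s \<and> {r<..s} \<subseteq> W \<and> j ` {r<..s} = {a<..j s} \<and> j s < t0"
        if sW: "q < s" "s \<in> W" for s
      proof -
        define R where "R = {x\<in>{q..s}. g x \<notin> U}"
        define r where "r = Sup R"
        have qR: "q \<in> R" using gq sW by (auto simp: R_def)
        have Rb: "bdd_above R" by (auto simp: R_def bdd_above_def)
        have qr: "q \<le> r" using qR Rb cSup_upper r_def by blast
        have rs: "r \<le> s" unfolding r_def using qR by (intro cSup_least) (auto simp: R_def)
        have sd: "s < d" using sW W_def by auto
        have rc: "r \<in> {c<..<d}" using qr rs sd qc by auto
        have rW: "r \<notin> W"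
        proof
          assume "r \<in> W"
          then obtain e where e: "e > 0" "\<And>x. \<bar>x - r\<bar> < e \<Longrightarrow> x \<in> W" using oW open_nbhd_real by blast
          obtain x where "x \<in> R" "r - e < x" using qR e(1) less_cSupD[of R "r-e"] r_def by force
          moreover have "x \<le> r" using \<open>x \<in> R\<close> Rb r_def cSup_upper by blast
          ultimately have "x \<in> W" using e by force
          then show False using \<open>x \<in> R\<close> by (auto simp: W_def R_def)
        qed
        have rs': "r < s" using rs rW sW by (cases "r = s") auto
        have gr: "g r \<notin> U" using rW rc W_def by auto
        have rsW: "{r<..s} \<subseteq> W"
        proof
          fix x assume x: "x \<in> {r<..s}"
          then have "x \<notin> R" using Rb r_def cSup_upper by force
          then show "x \<in> W" using x qr qc sd by (auto simp: R_def W_def)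
        qed
        have jlt: "j x < t0" if xW: "q < x" "x \<in> W" for x
        proof (rule ccontr)
          assume "\<not> j x < t0"
          then obtain s' where "s' \<in> {s0..<q}" "j s' = j x" using onto[of "j x"] j[of x] xW by auto
          then show False using inj_onD[OF ij, of s' x] below xW by auto
        qed
        have lima: "\<exists>x\<in>{r<..s}. j x < a'" if a': "a < a'" for a'
        proof -
          obtain e where e: "e > 0" "\<forall>s. \<bar>s - r\<bar> < e \<longrightarrow> (s \<in> W \<longrightarrow> j s \<notin> {a'..t0})"
            using avoid[OF rc gr, of a' t0] t a' by auto
          define x where "x = min s (r + e/2)"
          have "x \<in> {r<..s}" "\<bar>x - r\<bar> < e" using e(1) rs' by (auto simp: x_def)
          moreover have "x \<in> W" using rsW calculation by blast
          moreover have "j x < t0" using jlt[of x] calculation qr by auto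
          ultimately show ?thesis using e by force
        qed
        have "strict_mono_on {r<..s} j \<or> strict_antimono_on {r<..s} j"
          using injective_eq_monotone_map[of "{r<..s}" j] cj ij rsW
          by (meson continuous_on_subset inj_on_subset is_interval_oc)
        moreover have "\<not> strict_antimono_on {r<..s} j"
        proof
          assume anti: "strict_antimono_on {r<..s} j"
          obtain x where x: "x \<in> {r<..s}" "j x < j s" using lima[of "j s"] j sW by blast
          then have "x < s" by (cases "x = s") auto
          then have "j s < j x" using anti x rs' by (auto simp: monotone_on_def)
          then show False using x by auto
        qed
        ultimately have mono: "strict_mono_on {r<..s} j" by blast
        have "j ` {r<..s} = {a<..j s}"
        proof
          show "j ` {r<..s} \<subseteq> {a<..j s}"
          proof clarify
            fix x assume x: "x \<in> {r<..s}"
            then have "j x \<le> j s"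
              using mono rs' by (cases "x = s") (auto simp: monotone_on_def order_le_less)
            then show "j x \<in> {a<..j s}" using j rsW x by auto
          qed
          show "{a<..j s} \<subseteq> j ` {r<..s}"
          proof
            fix y assume y: "y \<in> {a<..j s}"
            then obtain x where x: "x \<in> {r<..s}" "j x < y" using lima[of y] by auto
            have "continuous_on {x..s} j"
              using cj rsW x by (elim continuous_on_subset) auto
            then obtain z where "x \<le> z" "z \<le> s" "j z = y"
              using IVT'[of j x y s] y x by auto
            then show "y \<in> j ` {r<..s}" using x by auto
          qed
        qed
        then show ?thesis using qr rs' rsW jlt[OF sW] by blast
      qed
      obtain r where r: "q \<le> r" "r < s2" "{r<..s2} \<subseteq> W" "j ` {r<..s2} = {a<..j s2}" "j s2 < t0"
        using reent[OF s2] by blast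
      \<comment> \<open>There is no return between \<open>q\<close> and \<open>r\<close>: it would
        also sweep out parameters arbitrarily close to \<open>a\<close>, which are already taken on
        \<open>{r<..s2}\<close>.\<close>
      have gap: "s \<notin> W" if "q \<le> s" "s \<le> r" for s
      proof
        assume sW: "s \<in> W"
        then have "q < s" using that qW by (cases "q = s") auto
        then obtain r' where r': "{r'<..s} \<subseteq> W" "j ` {r'<..s} = {a<..j s}" using reent sW by blast
        define m where "m = min (j s) (j s2)"
        have "m > a" using j[OF sW] j[OF s2(2)] m_def by auto
        then have "m \<in> j ` {r'<..s}" "m \<in> j ` {r<..s2}" using r' r by (auto simp: m_def)
        then obtain x y where xy: "x \<in> {r'<..s}" "y \<in> {r<..s2}" "j x = j y" by auto
        then have "x = y" using ij r' r by (meson inj_onD subset_iff)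
        then show False using xy that by auto
      qed
      define t2 where "t2 = j s2"
      have t2: "a < t2" "t2 < t0" "f t2 = g s2" using j[OF s2(2)] r by (auto simp: t2_def)
      \<comment> \<open>The loop: along \<open>g\<close> from \<open>s0\<close> to the return
        \<open>s2\<close>, then along \<open>f\<close> from \<open>t2\<close> up to
        \<open>t0\<close>, where \<open>f t0 = g s0\<close>.\<close>
      define v where "v = s2 + (t0 - t2)"
      define w where "w s = (if s \<le> s2 then g s else f (t2 + s - s2))" for s
      have s0s2: "s0 < s2" using s s1q s2 by auto
      have s2d: "s2 < d" using s2 W_def by auto
      have cw: "continuous_map (top_of_set {s0..v}) T w"
        unfolding w_def
      proof (rule continuous_map_cases_le)
        show "continuous_map (subtopology (top_of_set {s0..v}) {x \<in> topspace (top_of_set {s0..v}). x \<le> s2}) T g"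
          using g s0s2 s2d s unfolding arc_on_def subtopology_subtopology
          by (elim conjE continuous_map_from_subtopology_mono) auto
        have "continuous_map (top_of_set {s2..v}) (top_of_set {a<..<b}) (\<lambda>s. t2 + s - s2)"
          using t2 t by (auto intro!: continuous_intros simp: v_def)
        then have "continuous_map (top_of_set {s2..v}) T (f \<circ> (\<lambda>s. t2 + s - s2))"
          using f continuous_map_compose unfolding arc_on_def by blast
        then show "continuous_map (subtopology (top_of_set {s0..v}) {x \<in> topspace (top_of_set {s0..v}). s2 \<le> x}) T (\<lambda>s. f (t2 + s - s2))"
          unfolding subtopology_subtopology o_def by (elim continuous_map_from_subtopology_mono) auto
      qed (use t2 in auto)
      have wim: "w ` {s0..v} = g ` {s0..s2} \<union> f ` {t2..t0}"
      proof -
        have "w ` {s0..v} = w ` {s0..s2} \<union> w ` {s2..v}"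
          using s0s2 t2 by (subst image_Un[symmetric]) (auto simp: v_def ivl_disj_un)
        moreover have "w ` {s0..s2} = g ` {s0..s2}" by (auto simp: w_def)
        moreover have "w ` {s2..v} = f ` {t2..t0}"
        proof -
          have "w ` {s2..v} = (\<lambda>s. f (t2 + s - s2)) ` {s2..v}"
            using t2 by (intro image_cong) (auto simp: w_def)
          also have "\<dots> = f ` ((\<lambda>s. s + (t2 - s2)) ` {s2..v})" by (simp add: image_image algebra_simps)
          also have "(\<lambda>s. s + (t2 - s2)) ` {s2..v} = {t2..t0}"
            by (simp only: image_add_atLeastAtMost') (simp add: v_def)
          finally show ?thesis .
        qed
        ultimately show ?thesis by simp
      qed
      \<comment> \<open>The image of the loop is compact; in this form it is also a union of two
        open sets. Being closed and open it is all of \<open>T\<close>.\<close>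
      have wim2: "w ` {s0..v} = g ` {s0<..<s2} \<union> U"
      proof
        show "w ` {s0..v} \<subseteq> g ` {s0<..<s2} \<union> U"
          unfolding wim using t t2 U_def
          by (force simp: order_le_less)
        have "U \<subseteq> g ` {s0..s2} \<union> f ` {t2..t0}"
        proof
          fix y assume "y \<in> U"
          then obtain x where x: "a < x" "x < b" "y = f x" by (auto simp: U_def)
          consider "x \<le> t2" | "t2 \<le> x" "x \<le> t0" | "t0 \<le> x" by linarith
          then show "y \<in> g ` {s0..s2} \<union> f ` {t2..t0}"
          proof cases
            case 1
            then have "x \<in> j ` {r<..s2}" using r x by (auto simp: t2_def)
            then obtain z where z: "z \<in> {r<..s2}" "x = j z" by auto
            then have "y = g z" using j r x by auto
            then show ?thesis using z r s1q s by auto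
          next
            case 3
            obtain z where z: "z \<in> {s0..<q}" "j z = x" using onto[OF 3 x(2)] by blast
            then have "y = g z" using j below x by auto
            then show ?thesis using z s2 by auto
          qed (use x in auto)
        qed
        then show "g ` {s0<..<s2} \<union> U \<subseteq> w ` {s0..v}" unfolding wim by force
      qed
      have "openin T (w ` {s0..v})"
        unfolding wim2
        by (intro openin_Un oU arc_open_image[OF g]) (use s s2d in auto)
      moreover have "closedin T (w ` {s0..v})"
        using image_compactin[of "top_of_set {s0..v}" "{s0..v}" T w] cw Hausdorff compactin_imp_closedin
        by (auto simp: compactin_subtopology)
      moreover have "w ` {s0..v} \<noteq> {}" using s0s2 t2 by (auto simp: v_def)
      ultimately have wT: "w ` {s0..v} = topspace T"
        using conn connected_space_clopen_in by blast
      \<comment> \<open>Injectivity across the junction: \<open>j\<close> is at least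
        \<open>t0\<close> before \<open>q\<close>, \<open>g\<close> is outside \<open>U\<close> from
        \<open>q\<close> to \<open>r\<close>, and \<open>j\<close> is at most \<open>t2\<close>
        afterwards.\<close>
      have cross: False if "s0 \<le> x" "x \<le> s2" "t2 < y" "y < t0" "g x = f y" for x y
      proof -
        have xW: "x \<in> W" and jx: "j x = y"
          using that t t2 s s2d jeq[of x y] by (auto simp: W_def U_def)
        consider "x < q" | "q \<le> x" "x \<le> r" | "r < x" by linarith
        then show False
        proof cases
          case 1
          then have "t0 \<le> j x" 
            using strict_mono_onD[OF smono, of s0 x] that(1) jt(1) by (cases "x = s0") auto
          then show False using jx that by auto
        next
          case 2 then show False using gap xW by blast
        next
          case 3
          then have "j x \<in> {a<..j s2}" using r that by auto
          then show False using jx that t2_def by auto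
        qed
      qed
      have "inj_on w {s0..<v}"
      proof (rule inj_onI)
        fix x y assume xy: "x \<in> {s0..<v}" "y \<in> {s0..<v}" "w x = w y"
        have *: False if "x \<le> s2" "\<not> y \<le> s2" "x \<in> {s0..<v}" "y \<in> {s0..<v}" "w x = w y" for x y
          using that cross[of x "t2 + y - s2"] by (auto simp: w_def v_def)
        consider "x \<le> s2" "y \<le> s2" | "\<not> x \<le> s2" "\<not> y \<le> s2" | "x \<le> s2" "\<not> y \<le> s2" | "\<not> x \<le> s2" "y \<le> s2"
          by blast
        then show "x = y"
        proof cases
          case 1
          then show ?thesis using xy injg s s2d by (auto simp: w_def inj_on_def)
        next
          case 2
          then have "f (t2 + x - s2) = f (t2 + y - s2)" using xy by (auto simp: w_def)
          moreover have "t2 + x - s2 \<in> {a<..<b}" "t2 + y - s2 \<in> {a<..<b}"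
            using xy 2 t t2 by (auto simp: v_def)
          ultimately have "t2 + x - s2 = t2 + y - s2" using injf inj_onD by metis
          then show ?thesis by simp
        next
          case 3 then show ?thesis using *[of x y] xy by blast
        next
          case 4 then show ?thesis using *[of y x] xy by simp
        qed
      qed
      moreover have "w s0 = w v" using s0s2 t2 t by (auto simp: w_def v_def)
      moreover have "s0 < v" using s0s2 t2 by (auto simp: v_def)
      ultimately have "closed_curve T s0 v w" using cw wT by (simp add: closed_curve_def)
      then show ?thesis by blast
    qed
  qed
qed

end

lemma arc_on_reflect:
  assumes "arc_on T {a<..<b} f" shows "arc_on T {-b<..<-a} (\<lambda>t. f (- t))"
proof -
  have "continuous_map (top_of_set {-b<..<-a}) (top_of_set {a<..<b}) uminus"
    by (auto intro!: continuous_intros)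
  then have "continuous_map (top_of_set {-b<..<-a}) T (f \<circ> uminus)"
    using assms continuous_map_compose unfolding arc_on_def by blast
  moreover have "inj_on (f \<circ> uminus) {-b<..<-a}"
    using assms by (intro comp_inj_on) (auto simp: arc_on_def inj_on_def)
  ultimately show ?thesis by (simp add: arc_on_def o_def)
qed

lemma open_bounded_interval_eq:
  fixes J :: "real set"
  assumes "open J" "is_interval J" "bounded J" "J \<noteq> {}"
  shows "J = {Inf J<..<Sup J}"
proof
  have bb: "bdd_above J" "bdd_below J" using assms bounded_imp_bdd_above bounded_imp_bdd_below by auto
  show "{Inf J<..<Sup J} \<subseteq> J"
  proof
    fix x assume "x \<in> {Inf J<..<Sup J}"
    then obtain y z where "y \<in> J" "y < x" "z \<in> J" "x < z"
      using assms(4) bb by (metis cInf_lessD greaterThanLessThan_iff less_cSupE)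
    then show "x \<in> J" using assms(2) unfolding is_interval_1 by (meson less_imp_le)
  qed
  show "J \<subseteq> {Inf J<..<Sup J}"
  proof
    fix x assume "x \<in> J"
    then obtain e where "e > 0" "\<And>y. \<bar>y - x\<bar> < e \<Longrightarrow> y \<in> J" using assms(1) open_nbhd_real by blast
    then have "x - e/2 \<in> J" "x + e/2 \<in> J" "e > 0" by auto
    then have "Inf J \<le> x - e/2" "x + e/2 \<le> Sup J" using bb by (auto intro: cInf_lower cSup_upper)
    then show "x \<in> {Inf J<..<Sup J}" using \<open>e > 0\<close> by auto
  qed
qed

text \<open>Composing with \<open>arctan\<close> makes every open interval bounded, so half-lines
  and the whole line need no separate treatment.\<close>

lemma homeomorphic_UNIV_open_interval:
  fixes I :: "real set"
  assumes "open I" "is_interval I" "I \<noteq> {}"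
  obtains c where "homeomorphic_map euclideanreal (top_of_set I) c"
proof -
  define J where "J = arctan ` I"
  define p q where "p = Inf J" and "q = Sup J"
  have "inj_on arctan I" by (simp add: inj_on_def arctan_eq_iff)
  have "open J" unfolding J_def using \<open>inj_on arctan I\<close> assms
    by (intro invariance_of_domain continuous_intros) (auto intro: continuous_intros)
  moreover have "is_interval J" unfolding J_def is_interval_connected_1
    using assms by (intro connected_continuous_image continuous_intros) (auto simp: is_interval_connected_1)
  moreover have Jb: "J \<subseteq> {-pi/2<..<pi/2}" unfolding J_def using arctan_bounded by auto
  moreover have "bounded J" using Jb bounded_subset[of "{-pi/2<..<pi/2}"] by auto
  ultimately have J: "J = {p<..<q}" using open_bounded_interval_eq assms by (auto simp: J_def p_def q_def)
  have pq: "p < q" using J assms J_def by (metis empty_is_image greaterThanLessThan_empty_iff linorder_not_le)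
  \<comment> \<open>\<open>arctan x / pi + 1/2\<close> runs through the open unit interval;
    \<open>l\<close> carries it affinely onto \<open>J\<close>.\<close>
  define l where "l x = p + (q - p) * (arctan x / pi + 1/2)" for x
  have l: "l x \<in> J" for x
  proof -
    have "- (1/2) < arctan x / pi" "arctan x / pi < 1/2"
      using arctan_bounded[of x] by (simp_all add: pos_less_divide_eq pos_divide_less_eq)
    then have "0 < arctan x / pi + 1/2" "arctan x / pi + 1/2 < 1" by linarith+
    moreover define m where "m = (q - p) * (arctan x / pi + 1/2)"
    ultimately have "0 < m" "m < q - p"
      using pq mult_strict_left_mono[of "arctan x / pi + 1/2" 1 "q - p"] unfolding m_def by simp_all
    then show ?thesis unfolding J l_def m_def[symmetric] by simp
  qed
  have u_bd: "-(pi/2) < (u - 1/2) * pi \<and> (u - 1/2) * pi < pi/2" if "0 < u" "u < 1" for u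
    using mult_strict_right_mono[OF that(1), of pi] mult_strict_right_mono[OF that(2), of pi]
    by (simp add: left_diff_distrib)
  define c where "c x = tan (l x)" for x
  define d where "d t = tan (((arctan t - p) / (q - p) - 1/2) * pi)" for t
  have cI: "c x \<in> I" for x
    using l[of x] unfolding J_def c_def by (auto simp: tan_arctan)
  have dc: "d (c x) = x" for x
  proof -
    have "arctan (c x) = l x" unfolding c_def using l[of x] Jb by (intro arctan_tan) auto
    then show ?thesis using pq by (simp add: d_def l_def tan_arctan)
  qed
  have cd: "c (d t) = t" if "t \<in> I" for t
  proof -
    let ?u = "(arctan t - p) / (q - p)"
    have "arctan t \<in> {p<..<q}" using that J J_def by blast
    then have "0 < ?u" "?u < 1" using pq by auto
    then have "-(pi/2) < (?u - 1/2) * pi" "(?u - 1/2) * pi < pi/2"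
      using u_bd[of ?u] by blast+
    then have "arctan (d t) = (?u - 1/2) * pi" unfolding d_def by (intro arctan_tan) auto
    then have "l (d t) = arctan t" using pq by (simp add: l_def)
    then show ?thesis by (simp add: c_def tan_arctan)
  qed
  have "continuous_on UNIV c"
  proof -
    have "cos (l x) \<noteq> 0" for x using l[of x] Jb cos_gt_zero_pi[of "l x"] by force
    moreover have "continuous_on UNIV l" unfolding l_def by (intro continuous_intros) auto
    ultimately show ?thesis unfolding c_def by (intro continuous_intros) auto
  qed
  moreover have "continuous_on I d"
  proof -
    have "cos (((arctan t - p) / (q - p) - 1/2) * pi) \<noteq> 0" if "t \<in> I" for t
    proof -
      let ?u = "(arctan t - p) / (q - p)"
      have "arctan t \<in> {p<..<q}" using that J J_def by blast
      then have "0 < ?u" "?u < 1" using pq by auto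
      then have "-(pi/2) < (?u - 1/2) * pi" "(?u - 1/2) * pi < pi/2"
        using u_bd[of ?u] by blast+
      then show ?thesis using cos_gt_zero_pi by force
    qed
    then show ?thesis unfolding d_def using pq by (intro continuous_intros) auto
  qed
  ultimately have "homeomorphic_maps euclideanreal (top_of_set I) c d"
    using cI cd dc by (auto simp: homeomorphic_maps_def continuous_map_in_subtopology)
  then show ?thesis using that homeomorphic_maps_imp_map by blast
qed

section \<open>Absorbing charts and the classification of connected one-manifolds\<close>

context one_manifold begin

text \<open>Only the mutual direction of the two arcs is missing for
  \<open>arc_extend_right\<close>. It is read off from two nearby parameters in the overlap, and
  reversing \<open>f\<close> turns the wrong direction into the right one.\<close>

lemma arc_extend:
  assumes conn: "connected_space T"
    and f: "arc_on T {a<..<b} f" and g: "arc_on T {c<..<d} g"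
    and s: "s0 \<in> {c<..<d}" "g s0 \<in> f ` {a<..<b}"
    and nc: "\<nexists>u v w. closed_curve T u v w"
  shows "\<exists>a' b' h. a' \<le> a \<and> b \<le> b' \<and> arc_on T {a'<..<b'} h \<and> (\<forall>t\<in>{a<..<b}. h t = f t) \<and>
        g ` {s0..<d} \<subseteq> h ` {a'<..<b'}"
proof -
  have oU: "openin T (f ` {a<..<b})" using arc_open_image[OF f] by auto
  obtain e where e: "e > 0" "\<And>x. \<bar>x - s0\<bar> < e \<Longrightarrow> x \<in> {s\<in>{c<..<d}. g s \<in> f ` {a<..<b}}"
    using open_nbhd_real[OF open_preimage_arc[OF g oU], of s0] s by blast
  define s1 where "s1 = s0 + e/2"
  have s1: "s0 < s1" using e by (auto simp: s1_def)
  have sub: "g ` {s0..s1} \<subseteq> f ` {a<..<b}" using e by (auto simp: s1_def)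
  have s1d: "s1 < d" using e(2)[of s1] e(1) by (auto simp: s1_def)
  have "g s0 \<in> f ` {a<..<b}" "g s1 \<in> f ` {a<..<b}" using sub s1 by auto
  then obtain t0 t1 where t: "t0 \<in> {a<..<b}" "t1 \<in> {a<..<b}" "g s0 = f t0" "g s1 = f t1"
    by blast
  have "t0 \<noteq> t1"
  proof
    assume "t0 = t1"
    then have "g s0 = g s1" using t by simp
    then have "s0 = s1" using g s s1 s1d by (auto simp: arc_on_def inj_on_def)
    then show False using s1 by simp
  qed
  then consider "t0 < t1" | "t1 < t0" by linarith
  then show ?thesis
  proof cases
    case 1
    have A: "c < s0" "a < t0" "t1 < b" using s t by auto
    from arc_extend_right[OF conn f g A(1) s1 s1d sub A(2) 1 A(3) t(3,4)] nc
    obtain b' h where "b \<le> b'" "arc_on T {a<..<b'} h" "\<forall>t\<in>{a<..<b}. h t = f t"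
      "g ` {s0..<d} \<subseteq> h ` {a<..<b'}" by blast
    then show ?thesis by (intro exI[of _ a] exI[of _ b'] exI[of _ h]) simp
  next
    case 2
    have r: "g ` {s0..s1} \<subseteq> (\<lambda>t. f (-t)) ` {-b<..<-a}"
    proof
      fix y assume "y \<in> g ` {s0..s1}"
      then obtain t where "t \<in> {a<..<b}" "y = f t" using sub by blast
      then show "y \<in> (\<lambda>t. f (-t)) ` {-b<..<-a}" by (intro image_eqI[of _ _ "-t"]) auto
    qed
    have A: "c < s0" "-b < -t0" "-t0 < -t1" "-t1 < -a" "g s0 = f (- (- t0))" "g s1 = f (- (- t1))"
      using s t 2 by auto
    from arc_extend_right[OF conn arc_on_reflect[OF f] g A(1) s1 s1d r A(2-6)] nc
    obtain b' h where h: "-a \<le> b'" "arc_on T {-b<..<b'} h"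
      "\<And>t. t \<in> {-b<..<-a} \<Longrightarrow> h t = f (-t)" "g ` {s0..<d} \<subseteq> h ` {-b<..<b'}" by blast
    have "arc_on T {-b'<..<b} (\<lambda>t. h (-t))" using arc_on_reflect[OF h(2)] by simp
    moreover have "g ` {s0..<d} \<subseteq> (\<lambda>t. h (-t)) ` {-b'<..<b}"
    proof
      fix y assume "y \<in> g ` {s0..<d}"
      then obtain t where "t \<in> {-b<..<b'}" "y = h t" using h(4) by blast
      then show "y \<in> (\<lambda>t. h (-t)) ` {-b'<..<b}" by (intro image_eqI[of _ _ "-t"]) auto
    qed
    moreover have "\<forall>t\<in>{a<..<b}. h (-t) = f t" using h(3) by force
    moreover have "-b' \<le> a" using h(1) by simp
    ultimately show ?thesis by (metis order_refl)
  qed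
qed

text \<open>Two extensions: to the right along \<open>g\<close>, and then to the right along the
  reversed \<open>g\<close>, which takes in the left part of \<open>g\<close>.\<close>

lemma arc_absorb:
  assumes conn: "connected_space T"
    and f: "arc_on T {a<..<b} f" and g: "arc_on T {c<..<d} g"
    and meet: "g ` {c<..<d} \<inter> f ` {a<..<b} \<noteq> {}"
    and nc: "\<nexists>u v w. closed_curve T u v w"
  shows "\<exists>a' b' h. a' \<le> a \<and> b \<le> b' \<and> arc_on T {a'<..<b'} h \<and> (\<forall>t\<in>{a<..<b}. h t = f t) \<and>
        g ` {c<..<d} \<subseteq> h ` {a'<..<b'}"
proof -
  obtain s0 where s0: "s0 \<in> {c<..<d}" "g s0 \<in> f ` {a<..<b}" using meet by blast
  obtain a1 b1 h1 where 1: "a1 \<le> a" "b \<le> b1" "arc_on T {a1<..<b1} h1" "\<forall>t\<in>{a<..<b}. h1 t = f t"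
    "g ` {s0..<d} \<subseteq> h1 ` {a1<..<b1}"
    using arc_extend[OF conn f g s0 nc] by blast
  have "g s0 \<in> g ` {s0..<d}" using s0(1) by auto
  then have "g s0 \<in> h1 ` {a1<..<b1}" using 1(5) by blast
  then have "-s0 \<in> {-d<..<-c}" "g (- (- s0)) \<in> h1 ` {a1<..<b1}" using s0 by auto
  then obtain a2 b2 h2 where 2: "a2 \<le> a1" "b1 \<le> b2" "arc_on T {a2<..<b2} h2" "\<forall>t\<in>{a1<..<b1}. h2 t = h1 t"
    "(\<lambda>t. g (-t)) ` {-s0..<-c} \<subseteq> h2 ` {a2<..<b2}"
    using arc_extend[OF conn 1(3) arc_on_reflect[OF g] _ _ nc] by blast
  have "g ` {c<..<d} \<subseteq> h2 ` {a2<..<b2}"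
  proof
    fix y assume "y \<in> g ` {c<..<d}"
    then obtain x where x: "c < x" "x < d" "y = g x" by auto
    show "y \<in> h2 ` {a2<..<b2}"
    proof (cases "s0 \<le> x")
      case True
      then have "y \<in> h1 ` {a1<..<b1}" using 1(5) x by auto
      then obtain t where t: "t \<in> {a1<..<b1}" "y = h1 t" by blast
      then have "y = h2 t" "t \<in> {a2<..<b2}" using 2 by auto
      then show ?thesis by blast
    next
      case False
      then have "y \<in> (\<lambda>t. g (-t)) ` {-s0..<-c}" using x by (intro image_eqI[of _ _ "-x"]) auto
      then show ?thesis using 2(5) by blast
    qed
  qed
  moreover have "\<forall>t\<in>{a<..<b}. h2 t = f t" using 1 2 by auto
  ultimately show ?thesis using 1 2 by (meson order_trans)
qed

text \<open>Without a closed curve arcs never close up, so an increasing sequence of arcs can absorb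
  the charts of a countable cover. The union of the sequence is an arc with open image. A chart that
  meets this image is contained in it, so the complement is open as well, and connectedness leaves
  only the whole space.\<close>

theorem classification:
  assumes conn: "connected_space T" and sc: "second_countable T" and ne: "topspace T \<noteq> {}"
  shows "(\<exists>u v w. closed_curve T u v w) \<or> (\<exists>c. homeomorphic_map euclideanreal T c)"
proof (cases "\<exists>u v w. closed_curve T u v w")
  case False
  then have nc: "\<nexists>u v w. closed_curve T u v w" by blast
  let ?J = "{-1<..<1::real}"
  have charts: "\<exists>e. arc_on T ?J e \<and> x \<in> e ` ?J" if x: "x \<in> topspace T" for x
  proof -
    obtain U e where U: "openin T U" "x \<in> U" "homeomorphic_map (top_of_set ?J) (subtopology T U) e"
      using chart[OF x] by blast
    have UT: "topspace (subtopology T U) = U" using U openin_subset by fastforce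
    have "arc_on T ?J e" using U unfolding arc_on_def
      by (auto dest: homeomorphic_imp_injective_map homeomorphic_imp_continuous_map simp: continuous_map_in_subtopology)
    moreover have "e ` ?J = U" using homeomorphic_imp_surjective_map[OF U(3)] UT by simp
    ultimately show ?thesis using U by blast
  qed
  define \<U> where "\<U> = {e ` ?J | e. arc_on T ?J e}"
  have "\<forall>U\<in>\<U>. openin T U" using arc_open_image by (auto simp: \<U>_def)
  moreover have "\<Union>\<U> = topspace T"
  proof
    show "\<Union>\<U> \<subseteq> topspace T" using calculation openin_subset by blast
    show "topspace T \<subseteq> \<Union>\<U>" using charts unfolding \<U>_def by blast
  qed
  ultimately obtain \<V> where V: "countable \<V>" "\<V> \<subseteq> \<U>" "\<Union>\<V> = topspace T"
    using second_countable_imp_Lindelof_space[OF sc] unfolding Lindelof_space_def by metis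
  have "\<V> \<noteq> {}" using V(3) ne by (metis Union_empty)
  have "\<exists>e. arc_on T ?J e \<and> from_nat_into \<V> n = e ` ?J" for n
    using from_nat_into[OF \<open>\<V> \<noteq> {}\<close>, of n] V(2) unfolding \<U>_def by blast
  then obtain E where E: "\<And>n. arc_on T ?J (E n)" "\<And>n. from_nat_into \<V> n = E n ` ?J" by metis
  have cover: "\<exists>n. x \<in> E n ` ?J" if x: "x \<in> topspace T" for x
  proof -
    obtain V where "V \<in> \<V>" "x \<in> V" using V x by blast
    then show ?thesis using E(2) from_nat_into_surj[OF V(1)] by metis
  qed
  define im where "im = (\<lambda>(a,b,h::real\<Rightarrow>'b). h ` {a<..<b::real})"
  define Pr where "Pr = (\<lambda>(a,b,h::real\<Rightarrow>'b). a < b \<and> arc_on T {a<..<b::real} h)"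
  define ext where "ext = (\<lambda>(a,b,h::real\<Rightarrow>'b) (a',b',h'). a' \<le> a \<and> b \<le> b' \<and> (\<forall>t\<in>{a<..<b::real}. h' t = h t))"
  \<comment> \<open>Each chart has to be tried again at arbitrarily late stages, because it may be
    disjoint from the current arc and be met only later. In a pairing enumeration every index occurs
    infinitely often.\<close>
  define \<kappa> where "\<kappa> n = fst (prod_decode n)" for n
  have "\<exists>F. \<forall>n. Pr (F n) \<and> (ext (F n) (F (Suc n)) \<and>
      (E (\<kappa> n) ` ?J \<inter> im (F n) \<noteq> {} \<longrightarrow> E (\<kappa> n) ` ?J \<subseteq> im (F (Suc n))))"
  proof (rule dependent_nat_choice)
    show "\<exists>x. Pr x" using E(1)[of 0] by (intro exI[of _ "(-1,1,E 0)"]) (auto simp: Pr_def)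
  next
    fix x n assume P: "Pr x"
    obtain a b h where x: "x = (a,b,h)" by (metis prod_cases3)
    show "\<exists>y. Pr y \<and> (ext x y \<and> (E (\<kappa> n) ` ?J \<inter> im x \<noteq> {} \<longrightarrow> E (\<kappa> n) ` ?J \<subseteq> im y))"
    proof (cases "E (\<kappa> n) ` ?J \<inter> im x = {}")
      case True
      then show ?thesis using P by (intro exI[of _ x]) (auto simp: ext_def x)
    next
      case False
      then have m: "E (\<kappa> n) ` ?J \<inter> h ` {a<..<b} \<noteq> {}" by (auto simp: im_def x)
      have ah: "a < b" "arc_on T {a<..<b} h" using P by (auto simp: Pr_def x)
      obtain a' b' h' where "a' \<le> a" "b \<le> b'" "arc_on T {a'<..<b'} h'" "\<forall>t\<in>{a<..<b}. h' t = h t"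
        "E (\<kappa> n) ` ?J \<subseteq> h' ` {a'<..<b'}"
        using arc_absorb[OF conn ah(2) E(1) m nc] by blast
      then show ?thesis using ah by (intro exI[of _ "(a',b',h')"]) (auto simp: Pr_def ext_def im_def x)
    qed
  qed
  then obtain F where F: "\<And>n. Pr (F n)" "\<And>n. ext (F n) (F (Suc n))"
    "\<And>n. E (\<kappa> n) ` ?J \<inter> im (F n) \<noteq> {} \<Longrightarrow> E (\<kappa> n) ` ?J \<subseteq> im (F (Suc n))" by metis
  define A where "A n = fst (F n)" for n
  define B where "B n = fst (snd (F n))" for n
  define H where "H n = snd (snd (F n))" for n
  have FABH: "F n = (A n, B n, H n)" for n by (simp add: A_def B_def H_def)
  have AB: "A n < B n" "arc_on T {A n<..<B n} (H n)" for n
    using F(1)[of n] by (simp_all add: FABH Pr_def)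
  have imF: "im (F n) = H n ` {A n<..<B n}" for n by (simp add: im_def FABH)
  have extm: "A n \<le> A m \<and> B m \<le> B n \<and> (\<forall>t\<in>{A m<..<B m}. H n t = H m t)" if "m \<le> n" for m n
    using that
  proof (induction n rule: dec_induct)
    case (step n)
    have "A (Suc n) \<le> A n" "B n \<le> B (Suc n)" "\<forall>t\<in>{A n<..<B n}. H (Suc n) t = H n t"
      using F(2)[of n] by (auto simp: ext_def FABH)
    then show ?case using step by auto
  qed auto
  define I where "I = (\<Union>n. {A n<..<B n})"
  \<comment> \<open>The arcs of the sequence extend one another, so every stage whose interval
    contains \<open>t\<close> gives the same value.\<close>
  define h where "h t = H (LEAST n. t \<in> {A n<..<B n}) t" for t
  have h: "h t = H n t" if "t \<in> {A n<..<B n}" for t n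
  proof -
    let ?m = "LEAST n. t \<in> {A n<..<B n}"
    have "t \<in> {A ?m<..<B ?m}" using that by (rule LeastI)
    moreover have "?m \<le> n" using that by (rule Least_le)
    ultimately show ?thesis using extm[of ?m n] by (simp add: h_def)
  qed
  have common: "\<exists>n. x \<in> {A n<..<B n} \<and> y \<in> {A n<..<B n}" if xy: "x \<in> I" "y \<in> I" for x y
  proof -
    obtain m n where mn: "x \<in> {A m<..<B m}" "y \<in> {A n<..<B n}" using xy by (auto simp: I_def)
    then show ?thesis using extm[of m "max m n"] extm[of n "max m n"] 
      by (intro exI[of _ "max m n"]) auto
  qed
  have "arc_on T I h"
    unfolding arc_on_def
  proof (intro conjI)
    show oI: "open I" by (auto simp: I_def)
    show "inj_on h I"
    proof (rule inj_onI)
      fix x y assume xy: "x \<in> I" "y \<in> I" "h x = h y"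
      then obtain n where n: "x \<in> {A n<..<B n}" "y \<in> {A n<..<B n}" using common by blast
      then show "x = y" using xy h AB(2)[of n] by (auto simp: arc_on_def inj_on_def)
    qed
    show "continuous_map (top_of_set I) T h"
      unfolding continuous_map_def
    proof (intro conjI allI impI funcsetI)
      fix x assume "x \<in> topspace (top_of_set I)"
      then obtain n where "x \<in> {A n<..<B n}" by (auto simp: I_def)
      then show "h x \<in> topspace T" using h AB(2)[of n] by (auto simp: arc_on_def continuous_map_def)
    next
      fix O' assume O': "openin T O'"
      have "{x \<in> topspace (top_of_set I). h x \<in> O'} = (\<Union>n. {t\<in>{A n<..<B n}. H n t \<in> O'})"
        using h by (auto simp: I_def)
      moreover have "open \<dots>" using open_preimage_arc[OF AB(2) O'] by blast
      ultimately show "openin (top_of_set I) {x \<in> topspace (top_of_set I). h x \<in> O'}"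
        using oI by (auto simp: openin_top_of_set_iff)
    qed
  qed
  have imh: "h ` I = (\<Union>n. im (F n))" using h by (force simp: I_def imF)
  have oh: "openin T (h ` I)" using arc_open_image[OF \<open>arc_on T I h\<close>] \<open>arc_on T I h\<close> by (auto simp: arc_on_def)
  have absorb: "E k ` ?J \<subseteq> h ` I" if meet: "E k ` ?J \<inter> h ` I \<noteq> {}" for k
  proof -
    obtain n where n: "E k ` ?J \<inter> im (F n) \<noteq> {}" using meet imh by blast
    \<comment> \<open>A stage at which chart \<open>k\<close> is tried and which does not come
      before stage \<open>n\<close>.\<close>
    define m where "m = prod_encode (k, n)"
    have "n \<le> m" unfolding m_def by (rule le_prod_encode_2)
    then have e: "A m \<le> A n" "B n \<le> B m" "\<forall>t\<in>{A n<..<B n}. H m t = H n t"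
      using extm[of n m] by blast+
    have "im (F n) \<subseteq> im (F m)"
      unfolding imF
    proof clarify
      fix t assume t: "t \<in> {A n<..<B n}"
      then have "H n t = H m t" "t \<in> {A m<..<B m}" using e by auto
      then show "H n t \<in> H m ` {A m<..<B m}" by blast
    qed
    moreover have "\<kappa> m = k" by (simp add: \<kappa>_def m_def)
    ultimately have "E k ` ?J \<subseteq> im (F (Suc m))" using F(3)[of m] n by auto
    then show ?thesis using imh by blast
  qed
  have "openin T (topspace T - h ` I)"
  proof (subst openin_subopen, intro ballI)
    fix x assume x: "x \<in> topspace T - h ` I"
    then obtain k where "x \<in> E k ` ?J" using cover by blast
    moreover have "openin T (E k ` ?J)" using arc_open_image[OF E(1)] by auto
    moreover have "E k ` ?J \<subseteq> topspace T - h ` I"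
      using absorb[of k] x \<open>x \<in> E k ` ?J\<close> openin_subset[OF \<open>openin T (E k ` ?J)\<close>] by blast
    ultimately show "\<exists>V. openin T V \<and> x \<in> V \<and> V \<subseteq> topspace T - h ` I" by blast
  qed
  then have "closedin T (h ` I)" using oh closedin_def openin_subset by blast
  moreover have "I \<noteq> {}" using AB(1)[of 0] by (auto simp: I_def intro!: exI[of _ 0] dense)
  ultimately have hT: "h ` I = topspace T"
    using conn oh unfolding connected_space_clopen_in by blast
  have "is_interval I"
    unfolding is_interval_1
  proof (intro ballI allI impI)
    fix a b x assume ab: "a \<in> I" "b \<in> I" "a \<le> x \<and> x \<le> b"
    obtain n where "a \<in> {A n<..<B n}" "b \<in> {A n<..<B n}" using common[OF ab(1,2)] by blast
    then have "x \<in> {A n<..<B n}" using ab(3) by auto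
    then show "x \<in> I" by (auto simp: I_def)
  qed
  then obtain c where c: "homeomorphic_map euclideanreal (top_of_set I) c"
    using homeomorphic_UNIV_open_interval \<open>I \<noteq> {}\<close> \<open>arc_on T I h\<close> unfolding arc_on_def by metis
  have "homeomorphic_map (top_of_set I) T h"
    using arc_homeomorphic_map[OF \<open>arc_on T I h\<close>] by (simp add: hT)
  then have "homeomorphic_map euclideanreal T (h \<circ> c)"
    using c homeomorphic_map_compose by blast
  then show ?thesis by blast
qed blast

end

section \<open>The space of leaves\<close>

lemma openin_leaf_space_raw:
  "openin (leaf_space X \<Delta>) V \<longleftrightarrow> V \<subseteq> \<Delta> \<and> openin X {x \<in> topspace X. leaf_of \<Delta> x \<in> V}"
proof -
  have "istopology (\<lambda>V. V \<subseteq> \<Delta> \<and> openin X {x \<in> topspace X. leaf_of \<Delta> x \<in> V})"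
    unfolding istopology_def
  proof (intro conjI allI impI; (elim conjE)?)
    fix S T assume "openin X {x \<in> topspace X. leaf_of \<Delta> x \<in> S}" "openin X {x \<in> topspace X. leaf_of \<Delta> x \<in> T}"
    moreover have "{x \<in> topspace X. leaf_of \<Delta> x \<in> S \<inter> T} =
        {x \<in> topspace X. leaf_of \<Delta> x \<in> S} \<inter> {x \<in> topspace X. leaf_of \<Delta> x \<in> T}" by auto
    ultimately show "openin X {x \<in> topspace X. leaf_of \<Delta> x \<in> S \<inter> T}" by auto
  next
    fix K assume K: "\<forall>S\<in>K. S \<subseteq> \<Delta> \<and> openin X {x \<in> topspace X. leaf_of \<Delta> x \<in> S}"
    have "{x \<in> topspace X. leaf_of \<Delta> x \<in> \<Union>K} = (\<Union>S\<in>K. {x \<in> topspace X. leaf_of \<Delta> x \<in> S})" by auto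
    then show "openin X {x \<in> topspace X. leaf_of \<Delta> x \<in> \<Union>K}" using K by auto
  qed auto
  then show ?thesis by (simp add: leaf_space_def topology_inverse')
qed

definition collar :: "'a topology \<Rightarrow> 'a set set \<Rightarrow> 'a set \<Rightarrow> real set \<Rightarrow> 'a set \<Rightarrow> (real \<times> real \<Rightarrow> 'a) \<Rightarrow> bool" where
  "collar X \<Delta> L J U \<phi> \<longleftrightarrow> openin X U \<and> L \<subseteq> U \<and>
     homeomorphic_map (top_of_set (UNIV \<times> J)) (subtopology X U) \<phi> \<and>
     \<phi> ` (UNIV \<times> {0}) = L \<and> (\<forall>t\<in>J. \<phi> ` (UNIV \<times> {t}) \<in> \<Delta>)"

locale foliated_space =
  fixes X :: "'a topology" and \<Delta> :: "'a set set"
  assumes Hausdorff_X: "Hausdorff_space X"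
    and second_countable_X: "second_countable X"
    and class_F: "class_F X \<Delta>"
begin

abbreviation "Y \<equiv> leaf_space X \<Delta>"
abbreviation "\<Sigma> \<equiv> special_leaves X \<Delta>"

lemma leaf_nonempty: "L \<in> \<Delta> \<Longrightarrow> L \<noteq> {}"
  and Union_leaves: "\<Union>\<Delta> = topspace X"
  using class_F unfolding class_F_def by blast+

lemma leaves_disjoint: 
  assumes "L \<in> \<Delta>" "L' \<in> \<Delta>" "x \<in> L" "x \<in> L'" shows "L = L'"
proof -
  have "pairwise disjnt \<Delta>" using class_F unfolding class_F_def by blast
  then show ?thesis using assms by (meson disjnt_iff pairwiseD)
qed

lemma leaf_of_eq: "\<lbrakk>L \<in> \<Delta>; x \<in> L\<rbrakk> \<Longrightarrow> leaf_of \<Delta> x = L"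
  unfolding leaf_of_def by (rule the_equality) (auto dest: leaves_disjoint)

lemma leaf_of_in: "x \<in> topspace X \<Longrightarrow> leaf_of \<Delta> x \<in> \<Delta> \<and> x \<in> leaf_of \<Delta> x"
  using Union_leaves leaf_of_eq by (metis Union_iff)

lemma leaf_subset: "L \<in> \<Delta> \<Longrightarrow> L \<subseteq> topspace X"
  using Union_leaves by blast

lemma leaf_of_preimage: "V \<subseteq> \<Delta> \<Longrightarrow> {x \<in> topspace X. leaf_of \<Delta> x \<in> V} = \<Union>V"
  using leaf_of_in leaf_of_eq leaf_subset by blast

lemma openin_leaf_space: "openin Y V \<longleftrightarrow> V \<subseteq> \<Delta> \<and> openin X (\<Union>V)"
  using openin_leaf_space_raw leaf_of_preimage by metis

lemma topspace_leaf_space: "topspace Y = \<Delta>"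
proof -
  have "openin Y \<Delta>" by (simp add: openin_leaf_space Union_leaves)
  then show ?thesis using openin_leaf_space openin_subset openin_topspace by blast
qed

lemma closedin_leaf_space: "closedin Y V \<longleftrightarrow> V \<subseteq> \<Delta> \<and> closedin X (\<Union>V)"
proof -
  have "\<Union>(\<Delta> - V) = topspace X - \<Union>V" if "V \<subseteq> \<Delta>"
    using that Union_leaves leaves_disjoint by blast
  then show ?thesis
    unfolding closedin_def openin_leaf_space topspace_leaf_space
    using Union_leaves by (metis Diff_subset Union_mono)
qed

lemma collar_exists:
  assumes "L \<in> \<Delta>"
  obtains U \<phi> where "collar X \<Delta> L (if L \<subseteq> mboundary X then {0..<1} else {-1<..<1}) U \<phi>"
  using assms class_F unfolding class_F_def collar_def Let_def by metis

lemma collarD: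
  assumes "collar X \<Delta> L J U \<phi>"
  shows "continuous_map (top_of_set (UNIV \<times> J)) X \<phi>"
    "inj_on \<phi> (UNIV \<times> J)" "\<phi> ` (UNIV \<times> J) = U" "open_map (top_of_set (UNIV \<times> J)) X \<phi>"
    "t \<in> J \<Longrightarrow> \<phi> ` (UNIV \<times> {t}) \<in> \<Delta>" "t \<in> J \<Longrightarrow> leaf_of \<Delta> (\<phi> (x, t)) = \<phi> ` (UNIV \<times> {t})"
proof -
  have h: "homeomorphic_map (top_of_set (UNIV \<times> J)) (subtopology X U) \<phi>" and U: "openin X U"
    and l: "\<And>t. t \<in> J \<Longrightarrow> \<phi> ` (UNIV \<times> {t}) \<in> \<Delta>"
    using assms by (auto simp: collar_def)
  show "continuous_map (top_of_set (UNIV \<times> J)) X \<phi>"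
    using homeomorphic_imp_continuous_map[OF h] by (simp add: continuous_map_in_subtopology)
  show "inj_on \<phi> (UNIV \<times> J)" using homeomorphic_imp_injective_map[OF h] by simp
  show "\<phi> ` (UNIV \<times> J) = U"
    using homeomorphic_imp_surjective_map[OF h] openin_subset[OF U] by (simp add: Int_absorb1)
  show "open_map (top_of_set (UNIV \<times> J)) X \<phi>"
    using homeomorphic_imp_open_map[OF h] open_map_from_open_subtopology[OF U] by blast
  show *: "\<phi> ` (UNIV \<times> {t}) \<in> \<Delta>" if "t \<in> J" for t by (rule l[OF that])
  show "t \<in> J \<Longrightarrow> leaf_of \<Delta> (\<phi> (x, t)) = \<phi> ` (UNIV \<times> {t})"
    by (intro leaf_of_eq *) auto
qed

lemma collar_leaf_inj:
  assumes "collar X \<Delta> L J U \<phi>" "t \<in> J" "t' \<in> J" "\<phi> ` (UNIV \<times> {t}) = \<phi> ` (UNIV \<times> {t'})"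
  shows "t = t'"
proof -
  have "\<phi> (0,t) \<in> \<phi> ` (UNIV \<times> {t'})" using assms(4) by blast
  then obtain x where "\<phi> (0,t) = \<phi> (x,t')" by auto
  then show ?thesis using inj_onD[OF collarD(2)[OF assms(1)], of "(0,t)" "(x,t')"] assms by auto
qed

lemma collar_open_image:
  assumes c: "collar X \<Delta> L J U \<phi>" and I: "open I"
  shows "openin X (\<phi> ` (UNIV \<times> (J \<inter> I)))"
proof -
  have "openin (top_of_set (UNIV \<times> J)) ((UNIV \<times> J) \<inter> (UNIV \<times> I))"
    using I by (intro openin_open_Int open_Times) auto
  moreover have "(UNIV \<times> J) \<inter> (UNIV \<times> I) = UNIV \<times> (J \<inter> I)" by auto
  ultimately show ?thesis using collarD(4)[OF c] unfolding open_map_def by metis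
qed

lemma collar_connected_image:
  assumes c: "collar X \<Delta> L J U \<phi>" and S: "connected S" "S \<subseteq> UNIV \<times> J"
  shows "connectedin X (\<phi> ` S)"
  using connectedin_continuous_map_image[OF collarD(1)[OF c], of S] S
  by (simp add: connectedin_subtopology connectedin_iff_connected)

lemma connected_leaf:
  assumes "L \<in> \<Delta>" shows "connectedin X L"
proof -
  obtain U \<phi> where c: "collar X \<Delta> L (if L \<subseteq> mboundary X then {0..<1} else {-1<..<1}) U \<phi>"
    using collar_exists[OF assms] .
  have "connected (UNIV \<times> {0::real} :: (real \<times> real) set)" by (intro connected_Times) auto
  then have "connectedin X (\<phi> ` (UNIV \<times> {0}))"
    by (intro collar_connected_image[OF c]) auto
  then show ?thesis using c by (simp add: collar_def)
qed

text \<open>Restricted to a set of levels that is open in the line, the collar is a chart on an open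
  subset of the plane.\<close>

lemma collar_interior_points:
  assumes c: "collar X \<Delta> L J U \<phi>" and I: "open I" "I \<subseteq> J" "t \<in> I"
  shows "\<phi> (x, t) \<notin> mboundary X"
proof -
  let ?U = "\<phi> ` (UNIV \<times> I)"
  have JI: "J \<inter> I = I" using I by auto
  have "openin X ?U" using collar_open_image[OF c I(1)] JI by simp
  moreover have "homeomorphic_map (top_of_set (UNIV \<times> I)) (subtopology X ?U) \<phi>"
  proof (rule bijective_open_imp_homeomorphic_map)
    have s: "UNIV \<times> I \<subseteq> UNIV \<times> J" using I by auto
    show "continuous_map (top_of_set (UNIV \<times> I)) (subtopology X ?U) \<phi>"
      using collarD(1)[OF c] s
      by (auto simp: continuous_map_in_subtopology intro: continuous_map_from_subtopology_mono)
    have "openin (top_of_set (UNIV \<times> J)) (UNIV \<times> I)"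
      by (intro open_subset[OF s] open_Times) (use I in auto)
    then have "open_map (top_of_set (UNIV \<times> I)) X \<phi>"
      using open_map_from_subtopology[OF collarD(4)[OF c], of "UNIV \<times> I"] s
      unfolding subtopology_subtopology Int_absorb1[OF s] by blast
    then show "open_map (top_of_set (UNIV \<times> I)) (subtopology X ?U) \<phi>"
      by (intro open_map_into_subtopology) auto
    show "\<phi> ` topspace (top_of_set (UNIV \<times> I)) = topspace (subtopology X ?U)"
      using \<open>openin X ?U\<close> openin_subset by fastforce
    show "inj_on \<phi> (topspace (top_of_set (UNIV \<times> I)))"
      using collarD(2)[OF c] s by (auto intro: inj_on_subset)
  qed
  then have "subtopology X ?U homeomorphic_space top_of_set ((UNIV :: real set) \<times> I)"
    by (subst homeomorphic_space_sym) (rule homeomorphic_map_imp_homeomorphic_space)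
  moreover have "open (UNIV \<times> I :: (real \<times> real) set)" using I by (simp add: open_Times)
  moreover have "\<phi> (x, t) \<in> ?U" using I by auto
  ultimately show ?thesis unfolding mboundary_def by blast
qed

text \<open>A leaf that is not wholly in the boundary has a two-sided collar, and then every point
  of its core is an interior point.\<close>

lemma leaf_boundary_cases:
  assumes "L \<in> \<Delta>" shows "L \<subseteq> mboundary X \<or> L \<inter> mboundary X = {}"
proof (cases "L \<subseteq> mboundary X")
  case False
  then obtain U \<phi> where c: "collar X \<Delta> L {-1<..<1} U \<phi>"
    using collar_exists[OF assms] by metis
  have "\<phi> (x, 0) \<notin> mboundary X" for x
    by (rule collar_interior_points[OF c, of "{-1<..<1}"]) auto
  moreover have "L = \<phi> ` (UNIV \<times> {0})" using c by (simp add: collar_def)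
  ultimately show ?thesis by auto
qed auto

text \<open>Openness spreads along the leaves of a collar: if \<open>W\<close> contains the point
  with coordinates \<open>(x0, 0)\<close>, it contains those with coordinates \<open>(x0, t)\<close>
  for small \<open>t\<close>, so all nearby leaves meet \<open>W\<close>. The projection to the leaf
  space is therefore open, which provides charts and second countability there.\<close>

lemma open_saturation:
  assumes "openin X W" shows "openin X (\<Union>{L\<in>\<Delta>. L \<inter> W \<noteq> {}})"
proof (subst openin_subopen, intro ballI)
  fix y assume "y \<in> \<Union>{L\<in>\<Delta>. L \<inter> W \<noteq> {}}"
  then obtain L where L: "L \<in> \<Delta>" "L \<inter> W \<noteq> {}" "y \<in> L" by blast
  define J where "J = (if L \<subseteq> mboundary X then {0..<1} else {-1<..<1::real})"
  obtain U \<phi> where c: "collar X \<Delta> L J U \<phi>"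
    using collar_exists[OF L(1)] unfolding J_def by blast
  have L0: "\<phi> ` (UNIV \<times> {0}) = L" using c by (simp add: collar_def)
  have J0: "0 \<in> J" by (auto simp: J_def)
  obtain x0 where x0: "\<phi> (x0, 0) \<in> W" using L(2) L0 by auto
  have "openin (top_of_set (UNIV \<times> J)) {z \<in> UNIV \<times> J. \<phi> z \<in> W}"
    using openin_continuous_map_preimage[OF collarD(1)[OF c] assms] by simp
  then obtain G where G: "open G" "{z \<in> UNIV \<times> J. \<phi> z \<in> W} = (UNIV \<times> J) \<inter> G"
    unfolding openin_open by blast
  have "(x0, 0) \<in> G" using G x0 J0 by auto
  then obtain A B where AB: "open A" "open B" "(x0, 0) \<in> A \<times> B" "A \<times> B \<subseteq> G"
    using open_prod_elim[OF G(1)] by metis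
  have "\<phi> ` (UNIV \<times> (J \<inter> B)) \<subseteq> \<Union>{L\<in>\<Delta>. L \<inter> W \<noteq> {}}"
  proof clarify
    fix x t assume t: "t \<in> J" "t \<in> B"
    then have "(x0, t) \<in> (UNIV \<times> J) \<inter> G" using AB by auto
    then have "\<phi> (x0, t) \<in> W" using G by blast
    then have "\<phi> ` (UNIV \<times> {t}) \<in> {L\<in>\<Delta>. L \<inter> W \<noteq> {}}" using collarD(5)[OF c t(1)] by auto
    then show "\<phi> (x, t) \<in> \<Union>{L\<in>\<Delta>. L \<inter> W \<noteq> {}}" by blast
  qed
  moreover have "y \<in> \<phi> ` (UNIV \<times> (J \<inter> B))" using L L0 J0 AB by auto
  ultimately show "\<exists>T. openin X T \<and> y \<in> T \<and> T \<subseteq> \<Union>{L\<in>\<Delta>. L \<inter> W \<noteq> {}}"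
    using collar_open_image[OF c AB(2)] by blast
qed

lemma continuous_map_leaf_of: "continuous_map X Y (leaf_of \<Delta>)"
  unfolding continuous_map_def topspace_leaf_space
  using leaf_of_in openin_leaf_space_raw by blast

lemma open_map_leaf_of: "open_map X Y (leaf_of \<Delta>)"
  unfolding open_map_def
proof (intro allI impI)
  fix W assume W: "openin X W"
  have "leaf_of \<Delta> ` W = {L\<in>\<Delta>. L \<inter> W \<noteq> {}}"
    using leaf_of_in leaf_of_eq openin_subset[OF W] by blast
  then show "openin Y (leaf_of \<Delta> ` W)"
    unfolding openin_leaf_space using open_saturation[OF W] by auto
qed

lemma leaf_of_image: "leaf_of \<Delta> ` topspace X = \<Delta>"
proof
  show "leaf_of \<Delta> ` topspace X \<subseteq> \<Delta>" using leaf_of_in by blast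
  show "\<Delta> \<subseteq> leaf_of \<Delta> ` topspace X"
  proof
    fix L assume L: "L \<in> \<Delta>"
    then obtain x where "x \<in> L" using leaf_nonempty by blast
    then have "x \<in> topspace X" "L = leaf_of \<Delta> x" using L leaf_subset leaf_of_eq by auto
    then show "L \<in> leaf_of \<Delta> ` topspace X" by blast
  qed
qed

text \<open>Being special is a failure of separation: for a non-special \<open>L\<close> some
  neighbourhood has a closure that misses \<open>L'\<close>. The leaf \<open>L'\<close> may well be
  special; \<open>compact_nonspecial_closed\<close> relies on that case.\<close>

lemma nonspecial_separated:
  assumes L: "L \<in> \<Delta>" "L \<notin> \<Sigma>" and L': "L' \<in> \<Delta>" "L' \<noteq> L"
  obtains V W where "openin Y V" "openin Y W" "L \<in> V" "L' \<in> W" "V \<inter> W = {}"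
proof -
  have "\<Inter>{Y closure_of V | V. nbhd_of Y L V} = {L}"
    using L by (auto simp: special_leaves_def special_point_def)
  then have "L' \<notin> \<Inter>{Y closure_of V | V. nbhd_of Y L V}" using L' by blast
  then obtain V where V: "nbhd_of Y L V" "L' \<notin> Y closure_of V" by blast
  then obtain U where U: "openin Y U" "L \<in> U" "U \<subseteq> V" by (auto simp: nbhd_of_def)
  show ?thesis
  proof (rule that[OF U(1) _ U(2)])
    show "openin Y (topspace Y - Y closure_of V)" by (intro openin_diff) auto
    show "L' \<in> topspace Y - Y closure_of V" using V L' topspace_leaf_space by blast
    show "U \<inter> (topspace Y - Y closure_of V) = {}"
      using U closure_of_subset[of V Y] V(1) by (auto simp: nbhd_of_def)
  qed
qed

text \<open>The proof that compact subsets of a Hausdorff space are closed, with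
  \<open>nonspecial_separated\<close> in place of the Hausdorff property, which the leaf space as a
  whole may lack.\<close>

lemma compact_nonspecial_closed:
  assumes K: "compactin Y K" "K \<inter> \<Sigma> = {}" shows "closedin Y K"
proof -
  have KD: "K \<subseteq> \<Delta>" using compactin_subset_topspace[OF K(1)] topspace_leaf_space by simp
  have "openin Y (\<Delta> - K)"
  proof (subst openin_subopen, intro ballI)
    fix y assume y: "y \<in> \<Delta> - K"
    have "\<forall>k\<in>K. \<exists>V W. openin Y V \<and> openin Y W \<and> k \<in> V \<and> y \<in> W \<and> V \<inter> W = {}"
    proof
      fix k assume k: "k \<in> K"
      show "\<exists>V W. openin Y V \<and> openin Y W \<and> k \<in> V \<and> y \<in> W \<and> V \<inter> W = {}"
        by (rule nonspecial_separated[of k y]) (use k y K KD in \<open>blast+\<close>)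
    qed
    then obtain V W where VW: "\<And>k. k \<in> K \<Longrightarrow> openin Y (V k) \<and> openin Y (W k) \<and> k \<in> V k \<and> y \<in> W k \<and> V k \<inter> W k = {}"
      by metis
    have "\<exists>\<F>. finite \<F> \<and> \<F> \<subseteq> V ` K \<and> K \<subseteq> \<Union>\<F>"
      using compactinD[OF K(1), of "V ` K"] VW by blast
    then obtain F where F: "finite F" "F \<subseteq> K" "K \<subseteq> \<Union>(V ` F)"
      by (metis finite_subset_image)
    define N where "N = \<Delta> \<inter> (\<Inter>k\<in>F. W k)"
    have "openin Y N"
    proof (cases "F = {}")
      case True then show ?thesis using topspace_leaf_space by (metis N_def INT_empty inf_top.right_neutral openin_topspace)
    next
      case False
      have "openin Y (\<Inter>k\<in>F. W k)" using F False VW by (intro openin_Inter) auto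
      then show ?thesis unfolding N_def using topspace_leaf_space by (metis openin_Int openin_topspace)
    qed
    moreover have "y \<in> N" using y VW F by (auto simp: N_def)
    moreover have "N \<subseteq> \<Delta> - K"
    proof
      fix z assume z: "z \<in> N"
      have "z \<notin> K"
      proof
        assume "z \<in> K"
        then obtain k where "k \<in> F" "z \<in> V k" using F by blast
        then show False using VW[of k] F z unfolding N_def by blast
      qed
      then show "z \<in> \<Delta> - K" using z N_def by auto
    qed
    ultimately show "\<exists>T. openin Y T \<and> y \<in> T \<and> T \<subseteq> \<Delta> - K" by blast
  qed
  then show ?thesis using KD by (simp add: closedin_def topspace_leaf_space)
qed

end

section \<open>Ordinary leaves and thin collars\<close>

context foliated_space begin

abbreviation "ordinary \<equiv> topspace X - (\<Union>\<Sigma> \<union> mboundary X)"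

lemma special_leaves_subset: "\<Sigma> \<subseteq> \<Delta>"
  by (auto simp: special_leaves_def)

lemma leaf_ordinary:
  assumes "L \<in> \<Delta>" "L \<inter> ordinary \<noteq> {}"
  shows "L \<subseteq> ordinary" "L \<notin> \<Sigma>" "\<not> L \<subseteq> mboundary X"
proof -
  show "L \<notin> \<Sigma>" using assms by blast
  moreover have b: "L \<inter> mboundary X = {}" using leaf_boundary_cases[OF assms(1)] assms(2) by blast
  ultimately show "L \<subseteq> ordinary"
    using leaves_disjoint assms(1) special_leaves_subset leaf_subset by blast
  show "\<not> L \<subseteq> mboundary X" using b leaf_nonempty assms by blast
qed

lemma ordinary_leafI:
  assumes "L \<in> \<Delta>" "L \<notin> \<Sigma>" "\<not> L \<subseteq> mboundary X"
  shows "L \<subseteq> ordinary"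
  using assms leaf_boundary_cases[OF assms(1)] leaves_disjoint special_leaves_subset leaf_subset by blast

text \<open>The transverse parameter of a collar is a local coordinate on the leaf space.\<close>

lemma collar_leaf_map:
  assumes c: "collar X \<Delta> L J U \<phi>"
  defines "\<kappa> \<equiv> \<lambda>t. \<phi> ` (UNIV \<times> {t})"
  shows "continuous_map (top_of_set J) Y \<kappa>" "inj_on \<kappa> J"
    "open I \<Longrightarrow> openin Y (\<kappa> ` (J \<inter> I))"
proof -
  have "continuous_map (top_of_set J) (top_of_set (UNIV \<times> J)) (\<lambda>t. (0::real, t))"
    by (auto simp: continuous_map_in_subtopology intro!: continuous_intros)
  then have "continuous_map (top_of_set J) Y (leaf_of \<Delta> \<circ> (\<phi> \<circ> (\<lambda>t. (0, t))))"
    using collarD(1)[OF c] continuous_map_leaf_of continuous_map_compose by metis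
  then show "continuous_map (top_of_set J) Y \<kappa>"
    by (rule continuous_map_eq) (auto simp: \<kappa>_def collarD(6)[OF c])
  show "inj_on \<kappa> J" unfolding \<kappa>_def by (rule inj_onI) (use collar_leaf_inj[OF c] in blast)
  assume "open I"
  from collar_open_image[OF c this] have "openin Y (leaf_of \<Delta> ` (\<phi> ` (UNIV \<times> (J \<inter> I))))"
    using open_map_leaf_of unfolding open_map_def by blast
  moreover have "leaf_of \<Delta> ` (\<phi> ` (UNIV \<times> (J \<inter> I))) = \<kappa> ` (J \<inter> I)"
  proof
    show "leaf_of \<Delta> ` (\<phi> ` (UNIV \<times> (J \<inter> I))) \<subseteq> \<kappa> ` (J \<inter> I)"
      using collarD(6)[OF c] by (auto simp: \<kappa>_def)
    show "\<kappa> ` (J \<inter> I) \<subseteq> leaf_of \<Delta> ` (\<phi> ` (UNIV \<times> (J \<inter> I)))"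
    proof clarify
      fix t assume t: "t \<in> J" "t \<in> I"
      then have "\<kappa> t = leaf_of \<Delta> (\<phi> (0, t))" using collarD(6)[OF c t(1)] by (simp add: \<kappa>_def)
      then show "\<kappa> t \<in> leaf_of \<Delta> ` (\<phi> ` (UNIV \<times> (J \<inter> I)))" using t by blast
    qed
  qed
  ultimately show "openin Y (\<kappa> ` (J \<inter> I))" by simp
qed

text \<open>By local finiteness a short transversal through the point with coordinates
  \<open>(0, 0)\<close> meets only finitely many special leaves, and different levels lie on
  different leaves. So only finitely many levels on the transversal are special, and those other
  than 0 keep a positive distance from 0.\<close>

lemma collar_nearby_ordinary:
  assumes lf: "loc_finite_family X \<Sigma>"
    and c: "collar X \<Delta> L J U \<phi>" and J: "J = {0..<1} \<or> J = {-1<..<1}"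
  obtains e where "e > 0" "e \<le> 1" "\<And>t. \<lbrakk>t \<in> J; t \<noteq> 0; \<bar>t\<bar> < e\<rbrakk> \<Longrightarrow> \<phi> ` (UNIV \<times> {t}) \<subseteq> ordinary"
proof -
  have J0: "0 \<in> J" using J by auto
  have "\<phi> (0,0) \<in> topspace X"
    using collarD(1)[OF c] J0 by (auto simp: continuous_map_def)
  then obtain U' where U': "openin X U'" "\<phi> (0,0) \<in> U'" "finite {S \<in> \<Sigma>. S \<inter> U' \<noteq> {}}"
    using lf unfolding loc_finite_family_def by blast
  have "continuous_map (top_of_set J) (top_of_set (UNIV \<times> J)) (\<lambda>t. (0::real, t))"
    by (auto simp: continuous_map_in_subtopology intro!: continuous_intros)
  then have "continuous_map (top_of_set J) X (\<phi> \<circ> (\<lambda>t. (0, t)))"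
    using collarD(1)[OF c] continuous_map_compose by metis
  then have "openin (top_of_set J) {t \<in> J. \<phi> (0,t) \<in> U'}"
    using openin_continuous_map_preimage[OF _ U'(1)] by fastforce
  then obtain G where G: "open G" "{t \<in> J. \<phi> (0,t) \<in> U'} = J \<inter> G" unfolding openin_open by blast
  have "0 \<in> G" using G U' J0 by auto
  then obtain e1 where e1: "e1 > 0" "\<And>t. \<bar>t - 0\<bar> < e1 \<Longrightarrow> t \<in> G" using G open_nbhd_real by metis
  define B where "B = {t \<in> J. t \<noteq> 0 \<and> \<phi> (0,t) \<in> U' \<and> \<phi> ` (UNIV \<times> {t}) \<in> \<Sigma>}"
  have "finite B"
  proof (rule inj_on_finite)
    show "inj_on (\<lambda>t. \<phi> ` (UNIV \<times> {t})) B"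
      by (rule inj_on_subset[OF collar_leaf_map(2)[OF c]]) (auto simp: B_def)
    show "(\<lambda>t. \<phi> ` (UNIV \<times> {t})) ` B \<subseteq> {S \<in> \<Sigma>. S \<inter> U' \<noteq> {}}" by (auto simp: B_def)
  qed (rule U'(3))
  then have "open (- B)" by (simp add: finite_imp_closed open_Compl)
  moreover have "0 \<in> - B" by (auto simp: B_def)
  ultimately obtain e2 where e2: "e2 > 0" "\<And>t. \<bar>t - 0\<bar> < e2 \<Longrightarrow> t \<in> - B" using open_nbhd_real by metis
  show ?thesis
  proof (rule that[of "min (min e1 e2) 1"])
    fix t assume t: "t \<in> J" "t \<noteq> 0" "\<bar>t\<bar> < min (min e1 e2) 1"
    then have "t \<in> J \<inter> G" "t \<notin> B" using e1(2)[of t] e2(2)[of t] by auto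
    then have ns: "\<phi> ` (UNIV \<times> {t}) \<notin> \<Sigma>" using t G(2) by (auto simp: B_def)
    \<comment> \<open>An interval of levels that contains \<open>t\<close>, lies in \<open>J\<close>
      and is open in the line, also when \<open>J\<close> is half-open.\<close>
    define I where "I = (if 0 < t then {0<..<1} else {-1<..<1::real})"
    have "\<phi> (0,t) \<notin> mboundary X"
      by (rule collar_interior_points[OF c, of I]) (use J t in \<open>auto simp: I_def split: if_splits\<close>)
    then have "\<not> \<phi> ` (UNIV \<times> {t}) \<subseteq> mboundary X" by auto
    then show "\<phi> ` (UNIV \<times> {t}) \<subseteq> ordinary"
      using ordinary_leafI[OF collarD(5)[OF c t(1)] ns] by blast
  qed (use e1 e2 in auto)
qed

end

section \<open>The component Q and its space of leaves\<close>

locale region = foliated_space X \<Delta> for X :: "'a topology" and \<Delta> :: "'a set set" +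
  fixes Q :: "'a set" and q :: 'a
  assumes locfin: "loc_finite_family X \<Sigma>"
    and q: "q \<in> topspace X - (\<Union>\<Sigma> \<union> mboundary X)"
    and Q: "Q = connected_component_of_set (subtopology X (topspace X - (\<Union>\<Sigma> \<union> mboundary X))) q"
begin

lemma Q_ordinary: "Q \<subseteq> ordinary"
  unfolding Q using connected_component_of_subset_topspace by fastforce

lemma q_in_Q: "q \<in> Q"
  unfolding Q using q by (simp add: connected_component_of_refl)

lemma Q_connected: "connectedin X Q"
  unfolding Q using connectedin_connected_component_of connectedin_subtopology by metis

lemma Q_maximal:
  assumes "connectedin X S" "S \<subseteq> ordinary" "S \<inter> Q \<noteq> {}"
  shows "S \<subseteq> Q"
proof -
  obtain y where y: "y \<in> S" "y \<in> Q" using assms by blast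
  have "connectedin (subtopology X ordinary) S" using assms by (simp add: connectedin_subtopology)
  then have "S \<subseteq> connected_component_of_set (subtopology X ordinary) y"
    using y connected_component_of_maximal by metis
  moreover have "connected_component_of_set (subtopology X ordinary) y = Q"
    using y(2) unfolding Q
    by (metis connected_component_of_equiv mem_Collect_eq)
  ultimately show ?thesis by simp
qed

lemma leaf_in_Q:
  assumes "L \<in> \<Delta>" "L \<inter> Q \<noteq> {}" shows "L \<subseteq> Q"
  using assms Q_ordinary leaf_ordinary[of L] Q_maximal[OF connected_leaf[of L]] by blast

text \<open>A thin collar of a leaf of \<open>Q\<close> is connected and consists of ordinary
  points, so it stays in the component.\<close>

lemma Q_collar:
  assumes "L \<in> \<Delta>" "L \<subseteq> Q"
  obtains U \<phi> e where "collar X \<Delta> L {-1<..<1} U \<phi>" "e > 0" "e \<le> 1" "\<phi> ` (UNIV \<times> {-e<..<e}) \<subseteq> Q"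
proof -
  have "L \<inter> ordinary \<noteq> {}" using assms Q_ordinary leaf_nonempty by blast
  note L = leaf_ordinary[OF assms(1) this]
  obtain U \<phi> where c: "collar X \<Delta> L {-1<..<1} U \<phi>" using collar_exists[OF assms(1)] L by metis
  obtain e where e: "e > 0" "e \<le> 1"
    "\<And>t. \<lbrakk>t \<in> {-1<..<1}; t \<noteq> 0; \<bar>t\<bar> < e\<rbrakk> \<Longrightarrow> \<phi> ` (UNIV \<times> {t}) \<subseteq> ordinary"
    using collar_nearby_ordinary[OF locfin c] by blast
  have L0: "\<phi> ` (UNIV \<times> {0}) = L" using c by (simp add: collar_def)
  have o: "\<phi> ` (UNIV \<times> {-e<..<e}) \<subseteq> ordinary"
  proof clarify
    fix x t assume t: "t \<in> {-e<..<e}"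
    show "\<phi> (x,t) \<in> ordinary"
    proof (cases "t = 0")
      case True then show ?thesis using L0 L by blast
    next
      case False
      then have "\<phi> ` (UNIV \<times> {t}) \<subseteq> ordinary" using t e(2) by (intro e(3)) auto
      then show ?thesis by blast
    qed
  qed
  have "connected (UNIV \<times> {-e<..<e} :: (real \<times> real) set)" by (intro connected_Times) auto
  then have "connectedin X (\<phi> ` (UNIV \<times> {-e<..<e}))"
    by (rule collar_connected_image[OF c]) (use e in auto)
  moreover have "\<phi> ` (UNIV \<times> {-e<..<e}) \<inter> Q \<noteq> {}"
  proof -
    have "\<phi> (0,0) \<in> L" using L0 by blast
    moreover have "\<phi> (0,0) \<in> \<phi> ` (UNIV \<times> {-e<..<e})" using e by auto
    ultimately show ?thesis using assms by blast
  qed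
  ultimately show ?thesis using that[OF c e(1,2)] Q_maximal o by blast
qed

lemma Q_open: "openin X Q"
proof (subst openin_subopen, intro ballI)
  fix y assume y: "y \<in> Q"
  then have "y \<in> topspace X" using Q_ordinary by blast
  then have L: "leaf_of \<Delta> y \<in> \<Delta>" "y \<in> leaf_of \<Delta> y" using leaf_of_in by auto
  then obtain U \<phi> e where c: "collar X \<Delta> (leaf_of \<Delta> y) {-1<..<1} U \<phi>" "e > 0" "e \<le> 1" "\<phi> ` (UNIV \<times> {-e<..<e}) \<subseteq> Q"
    using Q_collar leaf_in_Q y by (metis disjoint_iff)
  have "\<phi> ` (UNIV \<times> {0}) = leaf_of \<Delta> y" using c by (simp add: collar_def)
  then obtain x where "y = \<phi> (x, 0)" using L(2) by blast
  then have "y \<in> \<phi> ` (UNIV \<times> {-e<..<e})" using c(2) by auto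
  moreover have "openin X (\<phi> ` (UNIV \<times> {-e<..<e}))"
    using collar_open_image[OF c(1), of "{-e<..<e}"] c(3) by (simp add: Int_absorb1)
  ultimately show "\<exists>T. openin X T \<and> y \<in> T \<and> T \<subseteq> Q" using c(4) by blast
qed

definition "Qleaves = restr_fol \<Delta> Q"
definition "TQ = subtopology Y Qleaves"

lemma Qleaves_subset: "Qleaves \<subseteq> \<Delta>" and Qleaves_in: "L \<in> Qleaves \<Longrightarrow> L \<subseteq> Q"
  by (auto simp: Qleaves_def restr_fol_def)

lemma Union_Qleaves: "\<Union>Qleaves = Q"
proof
  show "Q \<subseteq> \<Union>Qleaves"
  proof
    fix y assume y: "y \<in> Q"
    then have "y \<in> topspace X" using Q_ordinary by blast
    then have L: "leaf_of \<Delta> y \<in> \<Delta>" "y \<in> leaf_of \<Delta> y" using leaf_of_in by auto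
    then have "leaf_of \<Delta> y \<subseteq> Q" using leaf_in_Q y by blast
    then show "y \<in> \<Union>Qleaves" using L by (auto simp: Qleaves_def restr_fol_def)
  qed
  show "\<Union>Qleaves \<subseteq> Q" using Qleaves_in by (rule Union_least)
qed

lemma Qleaves_not_special:
  assumes L: "L \<in> Qleaves" shows "L \<notin> \<Sigma>"
proof -
  have "L \<noteq> {}" "L \<subseteq> Q" using L Qleaves_in Qleaves_subset leaf_nonempty by auto
  then show ?thesis using Q_ordinary by blast
qed

lemma leaf_of_Q:
  assumes "y \<in> Q" shows "leaf_of \<Delta> y \<in> Qleaves"
proof -
  obtain L where L: "L \<in> Qleaves" "y \<in> L" using Union_Qleaves assms by blast
  then have "leaf_of \<Delta> y = L" using leaf_of_eq Qleaves_subset by auto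
  then show ?thesis using L by simp
qed

lemma leaf_of_image_Q: "leaf_of \<Delta> ` Q = Qleaves"
proof
  show "leaf_of \<Delta> ` Q \<subseteq> Qleaves" using leaf_of_Q by blast
  show "Qleaves \<subseteq> leaf_of \<Delta> ` Q"
  proof
    fix L assume L: "L \<in> Qleaves"
    then have "L \<in> \<Delta>" using Qleaves_subset by auto
    then obtain y where y: "y \<in> L" using leaf_nonempty by blast
    then have "leaf_of \<Delta> y = L" "y \<in> Q" using leaf_of_eq \<open>L \<in> \<Delta>\<close> Qleaves_in[OF L] by auto
    then show "L \<in> leaf_of \<Delta> ` Q" by blast
  qed
qed

lemma openin_Qleaves: "openin Y Qleaves"
  using Qleaves_subset Union_Qleaves Q_open by (simp add: openin_leaf_space)

lemma topspace_TQ: "topspace TQ = Qleaves"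
  using openin_subset[OF openin_Qleaves] by (auto simp: TQ_def)

lemma Hausdorff_TQ: "Hausdorff_space TQ"
  unfolding Hausdorff_space_def
proof (intro allI impI, elim conjE)
  fix L L' assume L: "L \<in> topspace TQ" "L' \<in> topspace TQ" "L \<noteq> L'"
  then have "L \<in> \<Delta>" "L \<notin> \<Sigma>" "L' \<in> \<Delta>" "L' \<noteq> L"
    using Qleaves_not_special Qleaves_subset by (auto simp: topspace_TQ)
  then obtain V W where "openin Y V" "openin Y W" "L \<in> V" "L' \<in> W" "V \<inter> W = {}"
    using nonspecial_separated by blast
  then show "\<exists>U V. openin TQ U \<and> openin TQ V \<and> L \<in> U \<and> L' \<in> V \<and> disjnt U V"
    using L unfolding topspace_TQ TQ_def
    by (intro exI[of _ "V \<inter> Qleaves"] exI[of _ "W \<inter> Qleaves"])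
       (auto simp: openin_subtopology_Int disjnt_def)
qed

sublocale TQ: one_manifold TQ
proof
  show "Hausdorff_space TQ" by (rule Hausdorff_TQ)
  fix L assume "L \<in> topspace TQ"
  then have L: "L \<in> \<Delta>" "L \<subseteq> Q" using Qleaves_in Qleaves_subset by (auto simp: topspace_TQ)
  obtain U \<phi> e where c: "collar X \<Delta> L {-1<..<1} U \<phi>" "e > 0" "e \<le> 1" "\<phi> ` (UNIV \<times> {-e<..<e}) \<subseteq> Q"
    using Q_collar[OF L] by blast
  define \<kappa> where "\<kappa> t = \<phi> ` (UNIV \<times> {t})" for t
  let ?J = "{-1<..<1::real}"
  \<comment> \<open>Rescaling from \<open>{-e<..<e}\<close> to the chart domain demanded by
    \<open>one_manifold\<close>.\<close>
  let ?k = "\<lambda>t. \<kappa> (e * t)"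
  have et: "e * t \<in> {-e<..<e} \<and> e * t \<in> ?J" if "t \<in> ?J" for t
  proof -
    have "e * \<bar>t\<bar> < e * 1" using that c(2) by (intro mult_strict_left_mono) auto
    then have "\<bar>e * t\<bar> < e" using c(2) by (simp add: abs_mult)
    then show ?thesis using c(3) by auto
  qed
  define V where "V = \<kappa> ` {-e<..<e}"
  have Vo: "openin Y V"
    using collar_leaf_map(3)[OF c(1), of "{-e<..<e}"] c(3) by (simp add: V_def \<kappa>_def Int_absorb1)
  have VQ: "V \<subseteq> Qleaves"
  proof
    fix M assume "M \<in> V"
    then obtain t where t: "t \<in> {-e<..<e}" "M = \<phi> ` (UNIV \<times> {t})" by (auto simp: V_def \<kappa>_def)
    then have "M \<in> \<Delta>" using c(3) collarD(5)[OF c(1)] by auto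
    moreover have "M \<subseteq> Q" using t c(4) by blast
    ultimately show "M \<in> Qleaves" by (auto simp: Qleaves_def restr_fol_def)
  qed
  have VT: "openin TQ V" using Vo VQ by (simp add: TQ_def openin_open_subtopology openin_Qleaves)
  have sub: "subtopology TQ V = subtopology Y V"
    using VQ by (simp add: TQ_def subtopology_subtopology Int_absorb1)
  have kim: "?k ` ?J = V"
  proof
    show "?k ` ?J \<subseteq> V" using et by (auto simp: V_def)
    show "V \<subseteq> ?k ` ?J"
    proof
      fix M assume "M \<in> V"
      then obtain t where t: "t \<in> {-e<..<e}" "M = \<kappa> t" by (auto simp: V_def)
      then show "M \<in> ?k ` ?J" using c(2)
        by (intro image_eqI[of _ _ "t/e"]) (auto simp: field_simps)
    qed
  qed
  have "homeomorphic_map (top_of_set ?J) (subtopology Y V) ?k"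
  proof (rule bijective_open_imp_homeomorphic_map)
    have "continuous_map (top_of_set ?J) (top_of_set ?J) ((*) e)"
      using et by (auto simp: continuous_map_in_subtopology intro!: continuous_intros)
    then have "continuous_map (top_of_set ?J) Y (\<kappa> \<circ> (*) e)"
      using collar_leaf_map(1)[OF c(1)] continuous_map_compose unfolding \<kappa>_def by blast
    then show "continuous_map (top_of_set ?J) (subtopology Y V) ?k"
      using kim by (auto simp: continuous_map_in_subtopology o_def)
    show "inj_on ?k (topspace (top_of_set ?J))"
    proof (rule inj_onI)
      fix s t assume "s \<in> topspace (top_of_set ?J)" "t \<in> topspace (top_of_set ?J)" "?k s = ?k t"
      then have "e * s = e * t"
        using inj_onD[OF collar_leaf_map(2)[OF c(1)], of "e * s" "e * t"] et unfolding \<kappa>_def by auto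
      then show "s = t" using c(2) by simp
    qed
    show "?k ` topspace (top_of_set ?J) = topspace (subtopology Y V)"
      using kim openin_subset[OF Vo] by auto
    show "open_map (top_of_set ?J) (subtopology Y V) ?k"
      unfolding open_map_def
    proof (intro allI impI)
      fix W assume "openin (top_of_set ?J) W"
      then have W: "open W" "W \<subseteq> ?J" by (auto simp: openin_top_of_set_iff)
      have "open ((*) e ` W)" using W c(2) open_scaling[of e W] by simp
      moreover have "?J \<inter> (*) e ` W = (*) e ` W" using et W by blast
      ultimately have "openin Y (\<kappa> ` ((*) e ` W))"
        using collar_leaf_map(3)[OF c(1), of "(*) e ` W"] by (simp add: \<kappa>_def)
      moreover have "\<kappa> ` ((*) e ` W) = ?k ` W" by (simp add: image_image)
      moreover have "?k ` W \<subseteq> V" using W kim by blast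
      ultimately show "openin (subtopology Y V) (?k ` W)"
        by (simp add: openin_open_subtopology Vo)
    qed
  qed
  moreover have "L \<in> V" using c(1,2) by (auto simp: V_def \<kappa>_def collar_def image_iff intro!: bexI[of _ 0])
  ultimately show "\<exists>U e. openin TQ U \<and> L \<in> U \<and> homeomorphic_map (top_of_set ?J) (subtopology TQ U) e"
    using VT sub by metis
qed

lemma connected_TQ: "connected_space TQ"
proof -
  have "connectedin Y (leaf_of \<Delta> ` Q)"
    using connectedin_continuous_map_image[OF continuous_map_leaf_of Q_connected] .
  then show ?thesis unfolding leaf_of_image_Q TQ_def by (simp add: connectedin_def)
qed

lemma second_countable_TQ: "second_countable TQ"
  unfolding TQ_def using second_countable_X continuous_map_leaf_of open_map_leaf_of leaf_of_image
  by (intro second_countable_subtopology second_countable_open_map_image[of X Y]) (auto simp: topspace_leaf_space)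

lemma TQ_cases: "(\<exists>u v w. closed_curve TQ u v w) \<or> (\<exists>c. homeomorphic_map euclideanreal TQ c)"
  using TQ.classification[OF connected_TQ second_countable_TQ] leaf_of_Q[OF q_in_Q] topspace_TQ by auto

lemma compact_leaf_space_imp_Q_all:
  assumes "connected_space X" "closed_curve TQ u v w"
  shows "Q = topspace X"
proof -
  have "compactin TQ (w ` {u..v})"
    using assms(2) image_compactin[of "top_of_set {u..v}" "{u..v}" TQ w]
    by (auto simp: closed_curve_def compactin_subtopology)
  then have "compactin Y Qleaves"
    using assms(2) topspace_TQ by (auto simp: closed_curve_def TQ_def compactin_subtopology)
  then have "closedin Y Qleaves" using compact_nonspecial_closed Qleaves_not_special by blast
  then have "closedin X Q" by (simp add: closedin_leaf_space Union_Qleaves)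
  then show ?thesis using assms(1) Q_open q_in_Q unfolding connected_space_clopen_in by blast
qed

end

section \<open>Trivialising strips of leaves\<close>

text \<open>Invariance of domain does not apply, because \<open>J\<close> may contain endpoints.
  Instead, two values \<open>\<alpha>\<close> and \<open>\<beta>\<close> on either side of
  \<open>f (x0,t0)\<close> stay between the values of \<open>f\<close> at \<open>l\<close> and at
  \<open>r\<close> for all \<open>t\<close> near \<open>t0\<close>, and the intermediate value
  theorem on each line fills the resulting box.\<close>

lemma shear_open_image:
  fixes f :: "real \<times> real \<Rightarrow> real"
  assumes cf: "continuous_on (UNIV \<times> J) f" and sm: "\<And>t. t \<in> J \<Longrightarrow> strict_mono (\<lambda>x. f (x, t))"
    and W: "openin (top_of_set (UNIV \<times> J)) W"
  shows "openin (top_of_set (UNIV \<times> J)) ((\<lambda>z. (f z, snd z)) ` W)"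
proof (subst openin_subopen, intro ballI)
  fix z assume "z \<in> (\<lambda>z. (f z, snd z)) ` W"
  then obtain x0 t0 where xt: "(x0, t0) \<in> W" "z = (f (x0,t0), t0)" by auto
  obtain G where G: "open G" "W = (UNIV \<times> J) \<inter> G" using W unfolding openin_open by blast
  have t0: "t0 \<in> J" and "(x0,t0) \<in> G" using xt G by auto
  then obtain A B where AB: "open A" "open B" "(x0, t0) \<in> A \<times> B" "A \<times> B \<subseteq> G"
    using open_prod_elim[OF G(1)] by metis
  obtain e where e: "e > 0" "\<And>x. \<bar>x - x0\<bar> < e \<Longrightarrow> x \<in> A" using AB open_nbhd_real by (metis mem_Sigma_iff)
  define l r where "l = x0 - e/2" and "r = x0 + e/2"
  have lr: "l < x0" "x0 < r" "{l..r} \<subseteq> A" using e by (auto simp: l_def r_def)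
  obtain \<alpha> where \<alpha>: "f (l,t0) < \<alpha>" "\<alpha> < f (x0,t0)" using dense strict_monoD[OF sm[OF t0] lr(1)] by blast
  obtain \<beta> where \<beta>: "f (x0,t0) < \<beta>" "\<beta> < f (r,t0)" using dense strict_monoD[OF sm[OF t0] lr(2)] by blast
  have cx: "continuous_on J (\<lambda>t. f (x,t))" for x
    by (rule continuous_on_compose2[OF cf]) (auto intro!: continuous_intros)
  have "openin (top_of_set J) (J \<inter> (\<lambda>t. f (l,t)) -` {..<\<alpha>})"
    "openin (top_of_set J) (J \<inter> (\<lambda>t. f (r,t)) -` {\<beta><..})"
    using continuous_openin_preimage_gen[OF cx] by auto
  then have "openin (top_of_set J) ((J \<inter> (\<lambda>t. f (l,t)) -` {..<\<alpha>}) \<inter> (J \<inter> (\<lambda>t. f (r,t)) -` {\<beta><..}))"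
    by blast
  then obtain B' where B': "open B'" "(J \<inter> (\<lambda>t. f (l,t)) -` {..<\<alpha>}) \<inter> (J \<inter> (\<lambda>t. f (r,t)) -` {\<beta><..}) = J \<inter> B'"
    unfolding openin_open by blast
  have B'D: "f (l,t) < \<alpha>" "\<beta> < f (r,t)" if "t \<in> J" "t \<in> B'" for t
    using B'(2) that by blast+
  let ?N = "(UNIV \<times> J) \<inter> ({\<alpha><..<\<beta>} \<times> (B \<inter> B'))"
  have "openin (top_of_set (UNIV \<times> J)) ?N"
    using AB B' by (intro openin_open_Int open_Times) auto
  moreover have "z \<in> ?N" using t0 xt \<alpha> \<beta> AB B' by auto
  moreover have "?N \<subseteq> (\<lambda>z. (f z, snd z)) ` W"
  proof clarify
    fix y t assume t: "t \<in> J" "y \<in> {\<alpha><..<\<beta>}" "t \<in> B" "t \<in> B'"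
    have "continuous_on {l..r} (\<lambda>x. f (x,t))"
      by (rule continuous_on_compose2[OF cf]) (use t in \<open>auto intro!: continuous_intros\<close>)
    moreover have "f (l,t) \<le> y" "y \<le> f (r,t)" using B'D[OF t(1,4)] t(2) by auto
    ultimately obtain x where "l \<le> x" "x \<le> r" "f (x,t) = y"
      using IVT'[of "\<lambda>x. f (x,t)" l y r] lr by auto
    moreover then have "(x,t) \<in> W" using lr(3) AB t G by auto
    ultimately show "(y, t) \<in> (\<lambda>z. (f z, snd z)) ` W" by (intro image_eqI[of _ _ "(x,t)"]) auto
  qed
  ultimately show "\<exists>T. openin (top_of_set (UNIV \<times> J)) T \<and> z \<in> T \<and> T \<subseteq> (\<lambda>z. (f z, snd z)) ` W"
    by blast
qed

lemma shear_homeomorphic_map: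
  fixes f :: "real \<times> real \<Rightarrow> real"
  assumes cf: "continuous_on (UNIV \<times> J) f" and sm: "\<And>t. t \<in> J \<Longrightarrow> strict_mono (\<lambda>x. f (x, t))"
    and su: "\<And>t. t \<in> J \<Longrightarrow> surj (\<lambda>x. f (x, t))"
  shows "homeomorphic_map (top_of_set (UNIV \<times> J)) (top_of_set (UNIV \<times> J)) (\<lambda>z. (f z, snd z))"
proof (rule bijective_open_imp_homeomorphic_map)
  show "continuous_map (top_of_set (UNIV \<times> J)) (top_of_set (UNIV \<times> J)) (\<lambda>z. (f z, snd z))"
    using cf by (auto simp: continuous_map_in_subtopology intro!: continuous_intros)
  show "open_map (top_of_set (UNIV \<times> J)) (top_of_set (UNIV \<times> J)) (\<lambda>z. (f z, snd z))"
    using shear_open_image[OF cf sm] by (auto simp: open_map_def)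
  have "\<exists>x. f (x,t) = y" if "t \<in> J" for y t using surjD[OF su[OF that], of y] by metis
  then show "(\<lambda>z. (f z, snd z)) ` topspace (top_of_set (UNIV \<times> J)) = topspace (top_of_set (UNIV \<times> J))"
    by (auto simp: image_iff) metis
  show "inj_on (\<lambda>z. (f z, snd z)) (topspace (top_of_set (UNIV \<times> J)))"
    using strict_mono_eq[OF sm] by (auto simp: inj_on_def)
qed

lemma quotient_maps_same_fibres:
  assumes f: "quotient_map Z A f" and g: "quotient_map Z B g"
    and fib: "\<And>x y. \<lbrakk>x \<in> topspace Z; y \<in> topspace Z\<rbrakk> \<Longrightarrow> f x = f y \<longleftrightarrow> g x = g y"
  obtains h where "homeomorphic_map A B h" "\<And>x. x \<in> topspace Z \<Longrightarrow> h (f x) = g x"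
proof -
  obtain h where h: "continuous_map A B h" "\<And>x. x \<in> topspace Z \<Longrightarrow> h (f x) = g x"
    using quotient_map_lift_exists[OF f quotient_imp_continuous_map[OF g]] fib by metis
  obtain k where k: "continuous_map B A k" "\<And>x. x \<in> topspace Z \<Longrightarrow> k (g x) = f x"
    using quotient_map_lift_exists[OF g quotient_imp_continuous_map[OF f]] fib by metis
  have "k (h y) = y" if y: "y \<in> topspace A" for y
  proof -
    obtain x where "x \<in> topspace Z" "y = f x" using y quotient_imp_surjective_map[OF f] by blast
    then show ?thesis using h k by simp
  qed
  moreover have "h (k y) = y" if y: "y \<in> topspace B" for y
  proof -
    obtain x where "x \<in> topspace Z" "y = g x" using y quotient_imp_surjective_map[OF g] by blast
    then show ?thesis using h k by simp
  qed
  ultimately have "homeomorphic_maps A B h k"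
    unfolding homeomorphic_maps_def using h k by blast
  then show ?thesis using that h homeomorphic_maps_imp_map by blast
qed

lemma foliated_homeomorphicI:
  assumes f: "homeomorphic_map A B f" and im: "(\<lambda>L. f ` L) ` \<Gamma>' = \<Gamma>" and sub: "\<And>L. L \<in> \<Gamma>' \<Longrightarrow> L \<subseteq> topspace A"
  shows "foliated_homeomorphic B \<Gamma> A \<Gamma>'"
proof -
  obtain g where g: "homeomorphic_maps A B f g" using f homeomorphic_map_maps by blast
  have "g ` f ` L = L" if "L \<in> \<Gamma>'" for L
    using sub[OF that] g by (force simp: homeomorphic_maps_def image_iff)
  then have "(\<lambda>L. g ` L) ` \<Gamma> = \<Gamma>'" unfolding im[symmetric] image_image by simp
  moreover have "homeomorphic_map B A g" using g homeomorphic_maps_sym homeomorphic_maps_imp_map by metis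
  ultimately show ?thesis unfolding foliated_homeomorphic_def by blast
qed

section \<open>Strips over curves of leaves and their gluing\<close>

context region begin

abbreviation "XQ \<equiv> subtopology X Q"

lemma topspace_XQ: "topspace XQ = Q"
  using openin_subset[OF Q_open] by auto

text \<open>A trivialisation of the leaves along a curve \<open>c\<close> in the leaf space. It need
  not be injective: on a closed curve both edges lie on the same leaf. Closedness is demanded
  instead of a homeomorphism onto the image, because it survives gluing and makes the strip over a
  full circle a quotient map.\<close>

definition strip :: "real \<Rightarrow> real \<Rightarrow> (real \<Rightarrow> 'a set) \<Rightarrow> (real \<times> real \<Rightarrow> 'a) \<Rightarrow> bool" where
  "strip a b c f \<longleftrightarrow> continuous_map (top_of_set (UNIV \<times> {a..b})) XQ f \<and>
     closed_map (top_of_set (UNIV \<times> {a..b})) XQ f \<and>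
     (\<forall>t\<in>{a..b}. bij_betw (\<lambda>x. f (x, t)) UNIV (c t))"

lemma strip_mem: "\<lbrakk>strip a b c f; t \<in> {a..b}\<rbrakk> \<Longrightarrow> f (x, t) \<in> c t"
  unfolding strip_def bij_betw_def by blast

lemma leaf_of_continuous_Q: "continuous_map XQ TQ (leaf_of \<Delta>)"
  unfolding TQ_def continuous_map_in_subtopology topspace_XQ
  using continuous_map_leaf_of leaf_of_Q by (auto intro: continuous_map_from_subtopology)

lemma Union_preimage_Q:
  assumes "K \<subseteq> Qleaves" shows "{y \<in> Q. leaf_of \<Delta> y \<in> K} = \<Union>K"
proof -
  have KD: "K \<subseteq> \<Delta>" using assms Qleaves_subset by blast
  have "\<Union>K \<subseteq> Q" using assms Qleaves_in by blast
  moreover have "Q \<subseteq> topspace X" using Q_ordinary by blast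
  ultimately show ?thesis using leaf_of_preimage[OF KD] by blast
qed

lemma closedin_TQ_Union:
  assumes "closedin TQ K" shows "closedin XQ (\<Union>K)"
proof -
  have "K \<subseteq> Qleaves" using closedin_subset[OF assms] by (simp only: topspace_TQ)
  with closedin_continuous_map_preimage[OF leaf_of_continuous_Q assms] show ?thesis
    unfolding topspace_XQ by (simp only: Union_preimage_Q)
qed

lemma openin_TQ_Union:
  assumes "openin TQ K" shows "openin XQ (\<Union>K)"
proof -
  have "K \<subseteq> Qleaves" using openin_subset[OF assms] by (simp only: topspace_TQ)
  with openin_continuous_map_preimage[OF leaf_of_continuous_Q assms] show ?thesis
    unfolding topspace_XQ by (simp only: Union_preimage_Q)
qed

lemma collar_arc:
  assumes c: "collar X \<Delta> L {-1<..<1} U \<phi>" and e: "e > 0" "e \<le> 1" "\<phi> ` (UNIV \<times> {-e<..<e}) \<subseteq> Q"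
  shows "arc_on TQ {-e<..<e} (\<lambda>t. \<phi> ` (UNIV \<times> {t}))"
proof -
  have s: "{-e<..<e} \<subseteq> {-1<..<1}" using e by auto
  have "\<phi> ` (UNIV \<times> {t}) \<in> Qleaves" if "t \<in> {-e<..<e}" for t
  proof -
    have "\<phi> ` (UNIV \<times> {t}) \<in> \<Delta>" using that s by (intro collarD(5)[OF c]) auto
    moreover have "\<phi> ` (UNIV \<times> {t}) \<subseteq> Q" using that e(3) by blast
    ultimately show ?thesis by (auto simp: Qleaves_def restr_fol_def)
  qed
  then show ?thesis
    using collar_leaf_map(1,2)[OF c] s inj_on_subset
    unfolding arc_on_def TQ_def continuous_map_in_subtopology
    by (auto intro: continuous_map_from_subtopology_mono)
qed

text \<open>Inside one collar the strip is the collar map itself, with the level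
  \<open>\<sigma> t\<close> of the leaf \<open>c t\<close> substituted for the transverse
  coordinate.\<close>

lemma strip_in_collar:
  assumes col: "collar X \<Delta> L {-1<..<1} U \<phi>" and e: "e > 0" "e \<le> 1" "\<phi> ` (UNIV \<times> {-e<..<e}) \<subseteq> Q"
    and c: "continuous_map (top_of_set {a..b}) TQ c"
    and cV: "\<And>t. t \<in> {a..b} \<Longrightarrow> c t \<in> (\<lambda>t. \<phi> ` (UNIV \<times> {t})) ` {-e<..<e}"
  shows "\<exists>f. strip a b c f"
proof -
  define \<kappa> where "\<kappa> = (\<lambda>t. \<phi> ` (UNIV \<times> {t}))"
  let ?E = "{-e<..<e}"
  have arc: "arc_on TQ ?E \<kappa>" using collar_arc[OF col e] by (simp add: \<kappa>_def)
  obtain k where k: "homeomorphic_maps (top_of_set ?E) (subtopology TQ (\<kappa> ` ?E)) \<kappa> k"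
    using TQ.arc_homeomorphic_map[OF arc] homeomorphic_map_maps by blast
  have "continuous_map (top_of_set {a..b}) (subtopology TQ (\<kappa> ` ?E)) c"
    using c cV by (auto simp: continuous_map_in_subtopology \<kappa>_def)
  moreover have "continuous_map (subtopology TQ (\<kappa> ` ?E)) (top_of_set ?E) k"
    using k by (simp add: homeomorphic_maps_def)
  ultimately have \<sigma>c: "continuous_map (top_of_set {a..b}) (top_of_set ?E) (k \<circ> c)"
    by (rule continuous_map_compose)
  define \<sigma> where "\<sigma> = k \<circ> c"
  have \<sigma>E: "\<sigma> t \<in> ?E" if "t \<in> {a..b}" for t
    using \<sigma>c that by (auto simp: continuous_map_def \<sigma>_def)
  have cs: "continuous_on {a..b} \<sigma>" using \<sigma>c by (auto simp: \<sigma>_def continuous_map_in_subtopology)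
  have c_eq: "c t = \<phi> ` (UNIV \<times> {\<sigma> t})" if t: "t \<in> {a..b}" for t
  proof -
    have "c t \<in> topspace TQ" using c t by (auto simp: continuous_map_def)
    then have "\<kappa> (k (c t)) = c t" using k cV[OF t] by (simp add: homeomorphic_maps_def \<kappa>_def)
    then show ?thesis by (simp add: \<kappa>_def \<sigma>_def)
  qed
  define g where "g = (\<lambda>z::real\<times>real. (fst z, \<sigma> (snd z)))"
  define f where "f = \<phi> \<circ> g"
  have s: "UNIV \<times> ?E \<subseteq> UNIV \<times> {-1<..<1}" using e by auto
  have cg: "continuous_map (top_of_set (UNIV \<times> {a..b})) (top_of_set (UNIV \<times> ?E)) g"
    using \<sigma>E unfolding g_def continuous_map_in_subtopology
    by (auto intro!: continuous_intros continuous_on_compose2[OF cs])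
  have c\<phi>: "continuous_map (top_of_set (UNIV \<times> ?E)) XQ \<phi>"
    using continuous_map_from_subtopology_mono[OF collarD(1)[OF col] s] e(3)
    by (auto simp: continuous_map_in_subtopology)
  have cf: "continuous_map (top_of_set (UNIV \<times> {a..b})) XQ f"
    unfolding f_def using cg c\<phi> by (rule continuous_map_compose)
  \<comment> \<open>\<open>\<sigma>\<close> is proper because \<open>{a..b}\<close> is compact, and
    so is its product with the identity of the line.\<close>
  have pg: "closed_map (top_of_set (UNIV \<times> {a..b})) (top_of_set (UNIV \<times> ?E)) g"
  proof -
    have "proper_map euclideanreal euclideanreal id" by simp
    moreover have "proper_map (top_of_set {a..b}) (top_of_set ?E) \<sigma>"
      using \<sigma>c unfolding \<sigma>_def
      by (intro continuous_imp_proper_map) (auto simp: compact_space_subtopology intro!: Hausdorff_imp_kc_space Hausdorff_space_subtopology)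
    ultimately have "proper_map (prod_topology euclideanreal (top_of_set {a..b})) (prod_topology euclideanreal (top_of_set ?E)) (\<lambda>(x,y). (id x, \<sigma> y))"
      by (subst proper_map_prod) blast
    moreover have "prod_topology euclideanreal (top_of_set S) = top_of_set ((UNIV::real set) \<times> S)" for S :: "real set"
      using prod_topology_subtopology(2)[of euclideanreal euclideanreal S] by simp
    moreover have "(\<lambda>(x,y). (id x, \<sigma> y)) = g" by (auto simp: g_def)
    ultimately have "proper_map (top_of_set (UNIV \<times> {a..b})) (top_of_set (UNIV \<times> ?E)) g" by simp
    then show ?thesis by (rule proper_imp_closed_map)
  qed
  let ?W = "\<phi> ` (UNIV \<times> ?E)"
  have \<phi>W: "homeomorphic_map (top_of_set (UNIV \<times> ?E)) (subtopology X ?W) \<phi>"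
  proof -
    have "homeomorphic_map (top_of_set (UNIV \<times> {-1<..<1})) (subtopology X U) \<phi>"
      using col by (simp add: collar_def)
    from homeomorphic_map_subtopologies[OF this, of "UNIV \<times> ?E" ?W]
    have "homeomorphic_map (subtopology (top_of_set (UNIV \<times> {-1<..<1})) (UNIV \<times> ?E)) (subtopology (subtopology X U) ?W) \<phi>"
      using s collarD(3)[OF col] openin_subset[of X U] col unfolding collar_def by auto
    moreover have "?W \<subseteq> U" using collarD(3)[OF col] s by blast
    ultimately show ?thesis unfolding subtopology_subtopology by (simp only: Int_absorb1[OF s] Int_absorb1)
  qed
  have clf: "closed_map (top_of_set (UNIV \<times> {a..b})) XQ f"
    unfolding closed_map_def
  proof (intro allI impI)
    fix A :: "(real \<times> real) set" assume A: "closedin (top_of_set (UNIV \<times> {a..b})) A"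
    have "closedin (top_of_set (UNIV \<times> ?E)) (g ` A)" using pg A by (auto simp: closed_map_def)
    then have "closedin (subtopology X ?W) (\<phi> ` (g ` A))"
      using homeomorphic_imp_closed_map[OF \<phi>W] by (auto simp: closed_map_def)
    then obtain C where C: "closedin X C" "f ` A = C \<inter> ?W"
      unfolding closedin_subtopology f_def image_comp by blast
    \<comment> \<open>The collar map is closed only into its own image. The leaves over
      \<open>{a..b}\<close> form a set \<open>N\<close> that is closed in \<open>Q\<close> and
      contained in that image, so intersecting with \<open>N\<close> gives closedness in
      \<open>Q\<close>.\<close>
    define N where "N = \<Union>(c ` {a..b})"
    have "compactin TQ (c ` {a..b})"
      using image_compactin[of "top_of_set {a..b}" "{a..b}" TQ c] c by (auto simp: compactin_subtopology)
    then have "closedin TQ (c ` {a..b})" using compactin_imp_closedin Hausdorff_TQ by blast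
    then have N: "closedin XQ N" unfolding N_def by (rule closedin_TQ_Union)
    have AS: "A \<subseteq> UNIV \<times> {a..b}" using closedin_subset[OF A] by simp
    have "N \<subseteq> ?W" unfolding N_def using c_eq \<sigma>E by auto
    moreover have "f ` A \<subseteq> N"
    proof clarify
      fix x t assume "(x,t) \<in> A"
      then have t: "t \<in> {a..b}" using AS by auto
      have "f (x,t) = \<phi> (x, \<sigma> t)" by (simp add: f_def g_def)
      then have "f (x,t) \<in> c t" using c_eq[OF t] by auto
      then show "f (x,t) \<in> N" using t by (auto simp: N_def)
    qed
    ultimately have "f ` A = C \<inter> N" using C(2) by blast
    moreover have "C \<inter> N = (C \<inter> Q) \<inter> N" using closedin_subset[OF N] topspace_XQ by auto
    moreover have "closedin XQ (C \<inter> Q)" using C(1) closedin_subtopology by blast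
    ultimately show "closedin XQ (f ` A)" using N by (metis closedin_Int)
  qed
  have "bij_betw (\<lambda>x. f (x,t)) UNIV (c t)" if t: "t \<in> {a..b}" for t
  proof -
    have "inj (\<lambda>x. f (x,t))"
    proof (rule injI)
      fix x y assume "f (x,t) = f (y,t)"
      then have "\<phi> (x, \<sigma> t) = \<phi> (y, \<sigma> t)" by (simp add: f_def g_def)
      moreover have "(x, \<sigma> t) \<in> UNIV \<times> {-1<..<1}" "(y, \<sigma> t) \<in> UNIV \<times> {-1<..<1}"
        using \<sigma>E[OF t] e(2) by auto
      ultimately have "(x, \<sigma> t) = (y, \<sigma> t)" by (rule inj_onD[OF collarD(2)[OF col]])
      then show "x = y" by simp
    qed
    moreover have "range (\<lambda>x. f (x,t)) = c t"
      unfolding c_eq[OF t] by (auto simp: f_def g_def)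
    ultimately show ?thesis by (simp add: bij_betw_def)
  qed
  then show ?thesis using cf clf unfolding strip_def by blast
qed

lemma strip_local:
  assumes c: "continuous_map (top_of_set I) TQ c" and t0: "t0 \<in> I"
  shows "\<exists>d>0. \<forall>a b. a \<le> t0 \<and> t0 \<le> b \<and> {a..b} \<subseteq> I \<and> b - a < d \<longrightarrow> (\<exists>f. strip a b c f)"
proof -
  have L: "c t0 \<in> Qleaves" using c t0 by (auto simp: continuous_map_def topspace_TQ)
  obtain U \<phi> e where col: "collar X \<Delta> (c t0) {-1<..<1} U \<phi>" "e > 0" "e \<le> 1" "\<phi> ` (UNIV \<times> {-e<..<e}) \<subseteq> Q"
    using Q_collar L Qleaves_in Qleaves_subset by blast
  define V where "V = (\<lambda>t. \<phi> ` (UNIV \<times> {t})) ` {-e<..<e}"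
  have "openin TQ V" unfolding V_def by (rule TQ.arc_open_image[OF collar_arc[OF col]]) auto
  then have "openin (top_of_set I) {t \<in> I. c t \<in> V}"
    using openin_continuous_map_preimage[OF c] by simp
  then obtain G where G: "open G" "{t \<in> I. c t \<in> V} = I \<inter> G" unfolding openin_open by blast
  have "\<phi> ` (UNIV \<times> {0}) = c t0" using col by (simp add: collar_def)
  then have "c t0 \<in> V" using col(2) by (auto simp: V_def image_iff intro!: bexI[of _ 0])
  then have "t0 \<in> G" using G t0 by auto
  then obtain d where d: "d > 0" "\<And>t. \<bar>t - t0\<bar> < d \<Longrightarrow> t \<in> G" using G(1) open_nbhd_real by metis
  have "\<exists>f. strip a b c f" if ab: "a \<le> t0" "t0 \<le> b" "{a..b} \<subseteq> I" "b - a < d" for a b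
  proof (rule strip_in_collar[OF col])
    show "continuous_map (top_of_set {a..b}) TQ c"
      using c ab(3) by (rule continuous_map_from_subtopology_mono)
    fix t assume t: "t \<in> {a..b}"
    then have "t \<in> I \<inter> G" using ab d(2)[of t] by auto
    then show "c t \<in> (\<lambda>t. \<phi> ` (UNIV \<times> {t})) ` {-e<..<e}" using G(2) V_def by blast
  qed
  then show ?thesis using d(1) by blast
qed

text \<open>A closed subset of the line of level \<open>t\<close> is closed in the whole band, so
  closedness of \<open>f\<close> passes to the slice.\<close>

lemma strip_slice:
  assumes f: "strip a b c f" and t: "t \<in> {a..b}" and cQ: "c t \<subseteq> Q"
  shows "homeomorphic_map euclideanreal (subtopology X (c t)) (\<lambda>x. f (x, t))"
proof (rule bijective_closed_imp_homeomorphic_map)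
  have im: "range (\<lambda>x. f (x,t)) = c t" and inj: "inj (\<lambda>x. f (x,t))"
    using f t by (auto simp: strip_def bij_betw_def)
  have "continuous_map euclideanreal (top_of_set (UNIV \<times> {a..b})) (\<lambda>x. (x, t))"
    using t by (auto simp: continuous_map_in_subtopology intro!: continuous_intros)
  then have "continuous_map euclideanreal XQ (f \<circ> (\<lambda>x. (x, t)))"
    using f unfolding strip_def using continuous_map_compose by blast
  then show "continuous_map euclideanreal (subtopology X (c t)) (\<lambda>x. f (x, t))"
    using im by (auto simp: continuous_map_in_subtopology o_def)
  show "(\<lambda>x. f (x,t)) ` topspace euclideanreal = topspace (subtopology X (c t))"
    using im cQ topspace_XQ by auto
  show "inj_on (\<lambda>x. f (x,t)) (topspace euclideanreal)" using inj by simp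
  show "closed_map euclideanreal (subtopology X (c t)) (\<lambda>x. f (x,t))"
    unfolding closed_map_def
  proof (intro allI impI)
    fix A :: "real set" assume "closedin euclideanreal A"
    then have "closedin (top_of_set (UNIV \<times> {a..b})) (A \<times> {t})"
      using t by (intro closed_subset) (auto intro: closed_Times)
    then have "closedin XQ (f ` (A \<times> {t}))" using f by (auto simp: strip_def closed_map_def)
    moreover have "f ` (A \<times> {t}) = (\<lambda>x. f (x,t)) ` A" by auto
    ultimately obtain C where "closedin X C" "(\<lambda>x. f (x,t)) ` A = C \<inter> Q"
      by (auto simp: closedin_subtopology)
    moreover then have "(\<lambda>x. f (x,t)) ` A = C \<inter> c t" using im cQ by blast
    ultimately show "closedin (subtopology X (c t)) ((\<lambda>x. f (x,t)) ` A)"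
      by (auto simp: closedin_subtopology)
  qed
qed

text \<open>Both slices parametrise the same leaf, so they differ by a homeomorphism of the line.
  This is the correction needed for gluing and, over a circle, the monodromy.\<close>

lemma strip_transition:
  assumes f: "strip a b c f" "s \<in> {a..b}" and g: "strip a' b' c' g" "s' \<in> {a'..b'}"
    and c: "c s = c' s'" "c s \<subseteq> Q"
  obtains \<theta> where "homeomorphic_map euclideanreal euclideanreal \<theta>" "\<And>x. g (\<theta> x, s') = f (x, s)"
proof -
  obtain k where k: "homeomorphic_maps euclideanreal (subtopology X (c s)) (\<lambda>x. g (x, s')) k"
    using strip_slice[OF g] c homeomorphic_map_maps by metis
  have "homeomorphic_map (subtopology X (c s)) euclideanreal k"
    using k homeomorphic_maps_sym homeomorphic_maps_imp_map by metis
  then have h: "homeomorphic_map euclideanreal euclideanreal (k \<circ> (\<lambda>x. f (x, s)))"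
    using homeomorphic_map_compose[OF strip_slice[OF f c(2)]] by blast
  have "g (k y, s') = y" if "y \<in> c s" for y
    using k that c topspace_XQ by (auto simp: homeomorphic_maps_def)
  moreover have "f (x, s) \<in> c s" for x using strip_mem[OF f] .
  ultimately show ?thesis using that[OF h] by simp
qed

lemma strip_shear:
  assumes f: "strip a b c f"
    and h: "homeomorphic_map (top_of_set (UNIV \<times> {a..b})) (top_of_set (UNIV \<times> {a..b})) h"
    and snd: "\<And>x t. t \<in> {a..b} \<Longrightarrow> snd (h (x, t)) = t"
  shows "strip a b c (f \<circ> h)"
  unfolding strip_def
proof (intro conjI ballI)
  show "continuous_map (top_of_set (UNIV \<times> {a..b})) XQ (f \<circ> h)"
    using f homeomorphic_imp_continuous_map[OF h] continuous_map_compose unfolding strip_def by blast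
  show "closed_map (top_of_set (UNIV \<times> {a..b})) XQ (f \<circ> h)"
    using f homeomorphic_imp_closed_map[OF h] closed_map_compose unfolding strip_def by blast
  fix t assume t: "t \<in> {a..b}"
  have inj: "inj_on h (UNIV \<times> {a..b})" using homeomorphic_imp_injective_map[OF h] by simp
  have im: "h ` (UNIV \<times> {a..b}) = UNIV \<times> {a..b}" using homeomorphic_imp_surjective_map[OF h] by simp
  have h_eq: "h (x,t) = (fst (h (x,t)), t)" for x using snd[OF t] by (metis prod.collapse)
  have "bij_betw (\<lambda>x. fst (h (x,t))) UNIV UNIV"
    unfolding bij_betw_def
  proof
    show "inj (\<lambda>x. fst (h (x,t)))"
    proof (rule injI)
      fix x y assume "fst (h (x,t)) = fst (h (y,t))"
      then have "h (x,t) = h (y,t)" using h_eq by metis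
      then show "x = y" using inj_onD[OF inj] t by blast
    qed
    show "range (\<lambda>x. fst (h (x,t))) = UNIV"
    proof -
      have "y \<in> range (\<lambda>x. fst (h (x,t)))" for y
      proof -
        have "(y,t) \<in> h ` (UNIV \<times> {a..b})" using im t by auto
        then obtain x s where "s \<in> {a..b}" "(y,t) = h (x,s)" by auto
        moreover then have "s = t" using snd[of s x] by (metis snd_conv)
        ultimately show ?thesis by (metis fst_conv rangeI)
      qed
      then show ?thesis by blast
    qed
  qed
  moreover have "bij_betw (\<lambda>x. f (x,t)) UNIV (c t)" using f t by (auto simp: strip_def)
  ultimately have "bij_betw ((\<lambda>x. f (x,t)) \<circ> (\<lambda>x. fst (h (x,t)))) UNIV (c t)" by (rule bij_betw_trans)
  moreover have "(\<lambda>x. f (x,t)) \<circ> (\<lambda>x. fst (h (x,t))) = (\<lambda>x. (f \<circ> h) (x,t))"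
    using h_eq by (auto simp: fun_eq_iff)
  ultimately show "bij_betw (\<lambda>x. (f \<circ> h) (x,t)) UNIV (c t)" by simp
qed

lemma strip_reparam:
  assumes f: "strip a b c f" and \<theta>: "homeomorphic_map euclideanreal euclideanreal \<theta>"
  shows "strip a b c (\<lambda>z. f (\<theta> (fst z), snd z))"
proof -
  obtain k where k: "homeomorphic_maps euclideanreal euclideanreal \<theta> k" using \<theta> homeomorphic_map_maps by blast
  then have ct: "continuous_on UNIV \<theta>" "continuous_on UNIV k" "\<And>x. k (\<theta> x) = x" "\<And>x. \<theta> (k x) = x"
    by (auto simp: homeomorphic_maps_def)
  have "homeomorphic_maps (top_of_set (UNIV \<times> {a..b})) (top_of_set (UNIV \<times> {a..b}))
     (\<lambda>z. (\<theta> (fst z), snd z)) (\<lambda>z. (k (fst z), snd z))"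
    using ct(3,4) unfolding homeomorphic_maps_def continuous_map_in_subtopology
    by (auto intro!: continuous_intros continuous_on_compose2[OF ct(1)] continuous_on_compose2[OF ct(2)])
  then have "homeomorphic_map (top_of_set (UNIV \<times> {a..b})) (top_of_set (UNIV \<times> {a..b})) (\<lambda>z. (\<theta> (fst z), snd z))"
    using homeomorphic_maps_imp_map by blast
  from strip_shear[OF f this] show ?thesis by (simp add: o_def)
qed

text \<open>A closed set splits into its parts over the two intervals, and the union of their closed
  images is closed.\<close>

lemma strip_glue:
  assumes f: "strip a m c f" and g: "strip m b c g" and am: "a \<le> m" "m \<le> b"
    and eq: "\<And>x. f (x,m) = g (x,m)"
  shows "strip a b c (\<lambda>z. if snd z \<le> m then f z else g z)"
proof -
  let ?h = "\<lambda>z. if snd z \<le> m then f z else g z"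
  have S1: "UNIV \<times> {a..b} \<inter> {z. snd z \<le> m} = UNIV \<times> {a..m}" 
    and S2: "UNIV \<times> {a..b} \<inter> {z. m \<le> snd z} = UNIV \<times> {m..b}" using am by auto
  have ch: "continuous_map (top_of_set (UNIV \<times> {a..b})) XQ ?h"
  proof (rule continuous_map_cases_le)
    show "continuous_map (top_of_set (UNIV \<times> {a..b})) euclideanreal snd"
      by (auto intro!: continuous_intros)
    show "continuous_map (subtopology (top_of_set (UNIV \<times> {a..b})) {z \<in> topspace (top_of_set (UNIV \<times> {a..b})). snd z \<le> m}) XQ f"
      using f S1 unfolding strip_def subtopology_subtopology
      by (auto simp: Int_def elim: continuous_map_from_subtopology_mono)
    show "continuous_map (subtopology (top_of_set (UNIV \<times> {a..b})) {z \<in> topspace (top_of_set (UNIV \<times> {a..b})). m \<le> snd z}) XQ g"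
      using g S2 unfolding strip_def subtopology_subtopology
      by (auto simp: Int_def elim: continuous_map_from_subtopology_mono)
  qed (use eq in auto)
  moreover have "closed_map (top_of_set (UNIV \<times> {a..b})) XQ ?h"
    unfolding closed_map_def
  proof (intro allI impI)
    fix A :: "(real \<times> real) set" assume A: "closedin (top_of_set (UNIV \<times> {a..b})) A"
    then obtain C where C: "closed C" "A = (UNIV \<times> {a..b}) \<inter> C" unfolding closedin_closed by blast
    let ?A1 = "(UNIV \<times> {a..m}) \<inter> C" and ?A2 = "(UNIV \<times> {m..b}) \<inter> C"
    have "A = ?A1 \<union> ?A2" using C am by auto
    then have "?h ` A = ?h ` ?A1 \<union> ?h ` ?A2" by blast
    moreover have "?h ` ?A1 = f ` ?A1" by (intro image_cong) auto
    moreover have "?h ` ?A2 = g ` ?A2" using eq by (intro image_cong) (auto simp: le_less)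
    moreover have "closedin XQ (f ` ?A1)" using f C unfolding strip_def closed_map_def
      by (meson closedin_closed_Int)
    moreover have "closedin XQ (g ` ?A2)" using g C unfolding strip_def closed_map_def
      by (meson closedin_closed_Int)
    ultimately show "closedin XQ (?h ` A)" by auto
  qed
  moreover have "bij_betw (\<lambda>x. ?h (x,t)) UNIV (c t)" if "t \<in> {a..b}" for t
    using f g that unfolding strip_def by (cases "t \<le> m") auto
  ultimately show ?thesis unfolding strip_def by blast
qed

lemma curve_in_Q: "\<lbrakk>continuous_map (top_of_set I) TQ c; t \<in> I\<rbrakk> \<Longrightarrow> c t \<in> Qleaves \<and> c t \<subseteq> Q"
  using Qleaves_in by (auto simp: continuous_map_def topspace_TQ)

text \<open>One of the strips is reparametrised, in the same way at all levels, to match the other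
  along the leaf \<open>c m\<close>. Both variants serve to extend a given strip to either side
  without changing it.\<close>

lemma strip_join:
  assumes f: "strip a m c f" and g: "strip m b c g" and am: "a \<le> m" "m \<le> b"
    and c: "continuous_map (top_of_set {a..b}) TQ c"
  shows "\<exists>h. strip a b c h \<and> (\<forall>x. \<forall>t\<in>{a..m}. h (x,t) = f (x,t))"
    "\<exists>h. strip a b c h \<and> (\<forall>x. \<forall>t\<in>{m..b}. h (x,t) = g (x,t))"
proof -
  have cm: "c m \<subseteq> Q" using curve_in_Q[OF c, of m] am by auto
  have m: "m \<in> {a..m}" "m \<in> {m..b}" using am by auto
  obtain \<theta> where \<theta>: "homeomorphic_map euclideanreal euclideanreal \<theta>" "\<And>x. g (\<theta> x, m) = f (x, m)"
    using strip_transition[OF f m(1) g m(2) refl cm] by blast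
  show "\<exists>h. strip a b c h \<and> (\<forall>x. \<forall>t\<in>{a..m}. h (x,t) = f (x,t))"
    using strip_glue[OF f strip_reparam[OF g \<theta>(1)] am] \<theta>(2)
    by (intro exI[of _ "\<lambda>z. if snd z \<le> m then f z else g (\<theta> (fst z), snd z)"]) auto
  obtain \<eta> where \<eta>: "homeomorphic_map euclideanreal euclideanreal \<eta>" "\<And>x. f (\<eta> x, m) = g (x, m)"
    using strip_transition[OF g m(2) f m(1) refl cm] by blast
  show "\<exists>h. strip a b c h \<and> (\<forall>x. \<forall>t\<in>{m..b}. h (x,t) = g (x,t))"
    using strip_glue[OF strip_reparam[OF f \<eta>(1)] g am] \<eta>(2)
    by (intro exI[of _ "\<lambda>z. if snd z \<le> m then f (\<eta> (fst z), snd z) else g z"]) (auto simp: le_less)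
qed

text \<open>Bisection: strips exist over short intervals by \<open>strip_local\<close>, and adjacent
  ones can be joined.\<close>

lemma strip_exists:
  assumes "a \<le> b" and c: "continuous_map (top_of_set {a..b}) TQ c"
  shows "\<exists>f. strip a b c f"
proof -
  \<comment> \<open>The premise confines the induction to subintervals of \<open>{a..b}\<close>,
    where \<open>c\<close> is continuous.\<close>
  have "{a..b} \<subseteq> {a..b} \<longrightarrow> (\<exists>f. strip a b c f)"
    using \<open>a \<le> b\<close>
  proof (induction rule: Bolzano[where P = "\<lambda>s t. {s..t} \<subseteq> {a..b} \<longrightarrow> (\<exists>f. strip s t c f)"])
    case (trans s m t)
    show ?case
    proof
      assume st: "{s..t} \<subseteq> {a..b}"
      then obtain f g where fg: "strip s m c f" "strip m t c g" using trans by fastforce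
      have "continuous_map (top_of_set {s..t}) TQ c"
        using c st by (rule continuous_map_from_subtopology_mono)
      then show "\<exists>f. strip s t c f" using strip_join(1)[OF fg trans(3,4)] by blast
    qed
  next
    case (local x)
    then show ?case using strip_local[OF c, of x] by auto
  qed
  then show ?thesis by simp
qed

lemma strip_extend:
  assumes f: "strip a b c f" and ab: "a' \<le> a" "a \<le> b" "b \<le> b'"
    and c: "continuous_map (top_of_set {a'..b'}) TQ c"
  shows "\<exists>g. strip a' b' c g \<and> (\<forall>x. \<forall>t\<in>{a..b}. g (x,t) = f (x,t))"
proof -
  have cs: "continuous_map (top_of_set {s..t}) TQ c" if "a' \<le> s" "t \<le> b'" for s t
    using that by (intro continuous_map_from_subtopology_mono[OF c]) auto
  obtain f1 where "strip b b' c f1" using strip_exists[OF ab(3) cs] ab by auto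
  then obtain g1 where g1: "strip a b' c g1" "\<forall>x. \<forall>t\<in>{a..b}. g1 (x,t) = f (x,t)"
    using strip_join(1)[OF f _ ab(2,3) cs[OF ab(1) order_refl]] by blast
  obtain f2 where "strip a' a c f2" using strip_exists[OF ab(1) cs] ab by auto
  then obtain g where g: "strip a' b' c g" "\<forall>x. \<forall>t\<in>{a..b'}. g (x,t) = g1 (x,t)"
    using strip_join(2)[OF _ g1(1) ab(1) order_trans[OF ab(2,3)] cs[OF order_refl order_refl]] by blast
  show ?thesis
  proof (intro exI conjI allI ballI)
    fix x t assume "t \<in> {a..b}"
    moreover then have "t \<in> {a..b'}" using ab by auto
    ultimately show "g (x,t) = f (x,t)" using g g1 by simp
  qed (rule g(1))
qed

end

section \<open>Cylinder, Moebius band and open strip\<close>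

lemma closed_curve_affine:
  assumes "closed_curve T u v w"
  shows "closed_curve T (-1) 1 (\<lambda>t. w (u + (v - u) * ((t + 1) / 2)))"
proof -
  define l where "l t = u + (v - u) * ((t + 1) / 2)" for t :: real
  have uv: "u < v" using assms by (simp add: closed_curve_def)
  have le: "l s \<le> l t \<longleftrightarrow> s \<le> t" for s t using uv by (simp add: l_def mult_le_cancel_left divide_le_cancel)
  have ends: "l (-1) = u" "l 1 = v" by (simp_all add: l_def)
  have im: "l ` {-1..1} = {u..v}"
  proof
    show "l ` {-1..1} \<subseteq> {u..v}" using le ends by force
    show "{u..v} \<subseteq> l ` {-1..1}"
    proof
      fix y assume y: "y \<in> {u..v}"
      define d where "d = (y - u) / (v - u)"
      define x where "x = 2 * d - 1"
      have "(x + 1) / 2 = d" by (simp add: x_def)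
      moreover have "(v - u) * d = y - u" using uv by (simp add: d_def)
      ultimately have "l x = y" by (simp only: l_def)
      then show "y \<in> l ` {-1..1}" using y le[of "-1" x] le[of x 1] ends by force
    qed
  qed
  have "continuous_on {-1..1} l" unfolding l_def by (intro continuous_intros) auto
  then have "continuous_map (top_of_set {-1..1}) (top_of_set {u..v}) l"
    using im by (auto simp: continuous_map_in_subtopology)
  then have "continuous_map (top_of_set {-1..1}) T (w \<circ> l)"
    using assms continuous_map_compose unfolding closed_curve_def by blast
  moreover have "inj_on (w \<circ> l) {-1..<1}"
  proof (rule comp_inj_on)
    show "inj_on l {-1..<1}" by (rule inj_onI) (metis le order_refl order_antisym)
    have "l ` {-1..<1} \<subseteq> {u..<v}"
    proof clarify
      fix t :: real assume "t \<in> {-1..<1}"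
      then have "u \<le> l t" "\<not> v \<le> l t" using le[of "-1" t] le[of 1 t] ends by auto
      then show "l t \<in> {u..<v}" by auto
    qed
    then show "inj_on w (l ` {-1..<1})"
      using assms inj_on_subset unfolding closed_curve_def by blast
  qed
  moreover have "(w \<circ> l) ` {-1..1} = topspace T"
    using assms im unfolding closed_curve_def image_comp[symmetric] by simp
  moreover have "(w \<circ> l) (-1) = (w \<circ> l) 1" using assms ends by (simp add: closed_curve_def)
  ultimately show ?thesis by (simp add: closed_curve_def o_def l_def)
qed

lemma image_interval_eq: "h ` {a..b} = {h s | s. a \<le> s \<and> s \<le> b}" for a :: real
  by auto

lemma quotient_map_cls: "quotient_map T (quot_top T R) (cls T R)"
proof -
  have "istopology (\<lambda>V. V \<subseteq> cls T R ` topspace T \<and> openin T {x \<in> topspace T. cls T R x \<in> V})"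
    unfolding istopology_def
  proof (intro conjI allI impI; (elim conjE)?)
    fix S S' assume "openin T {x \<in> topspace T. cls T R x \<in> S}" "openin T {x \<in> topspace T. cls T R x \<in> S'}"
    moreover have "{x \<in> topspace T. cls T R x \<in> S \<inter> S'} =
        {x \<in> topspace T. cls T R x \<in> S} \<inter> {x \<in> topspace T. cls T R x \<in> S'}" by auto
    ultimately show "openin T {x \<in> topspace T. cls T R x \<in> S \<inter> S'}" by auto
  next
    fix K assume K: "\<forall>S\<in>K. S \<subseteq> cls T R ` topspace T \<and> openin T {x \<in> topspace T. cls T R x \<in> S}"
    have "{x \<in> topspace T. cls T R x \<in> \<Union>K} = (\<Union>S\<in>K. {x \<in> topspace T. cls T R x \<in> S})" by auto
    then show "openin T {x \<in> topspace T. cls T R x \<in> \<Union>K}" using K by auto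
  qed auto
  then have o: "openin (quot_top T R) V \<longleftrightarrow> V \<subseteq> cls T R ` topspace T \<and> openin T {x \<in> topspace T. cls T R x \<in> V}" for V
    by (simp add: quot_top_def topology_inverse')
  have "{x \<in> topspace T. cls T R x \<in> cls T R ` topspace T} = topspace T" by auto
  then have "openin (quot_top T R) (cls T R ` topspace T)" by (simp add: o)
  then have "topspace (quot_top T R) = cls T R ` topspace T"
    using o openin_subset openin_topspace by (metis subset_antisym)
  then show ?thesis unfolding quotient_map_def using o by auto
qed

section \<open>The leaf space is a line or a circle\<close>

context region begin

text \<open>Strips over growing intervals are chosen so that each extends the previous one; together
  they define a map \<open>G\<close> on the whole plane. Its openness is drawn from the closedness
  of the strips.\<close>

lemma line_case:
  assumes hc: "homeomorphic_map euclideanreal TQ c"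
  shows "foliated_homeomorphic XQ (restr_fol \<Delta> Q) (top_of_set open_strip) open_strip_fol"
proof -
  have cc: "continuous_map euclideanreal TQ c" using hc by (rule homeomorphic_imp_continuous_map)
  have cI: "continuous_map (top_of_set I) TQ c" for I :: "real set"
    using cc by (rule continuous_map_from_subtopology)
  have ic: "inj c" using homeomorphic_imp_injective_map[OF hc] by simp
  have imc: "range c = Qleaves" using homeomorphic_imp_surjective_map[OF hc] by (simp add: topspace_TQ)
  define r where "r n = real n + 1" for n
  have "\<exists>F. \<forall>n. strip (- r n) (r n) c (F n) \<and> (\<forall>x. \<forall>t\<in>{- r n..r n}. F (Suc n) (x,t) = F n (x,t))"
  proof (rule dependent_nat_choice)
    show "\<exists>f. strip (- r 0) (r 0) c f" by (rule strip_exists[OF _ cI]) (auto simp: r_def)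
    fix f n assume "strip (- r n) (r n) c f"
    then show "\<exists>g. strip (- r (Suc n)) (r (Suc n)) c g \<and> (\<forall>x. \<forall>t\<in>{- r n..r n}. g (x,t) = f (x,t))"
      by (rule strip_extend[OF _ _ _ _ cI]) (auto simp: r_def)
  qed
  then obtain F where F: "\<And>n. strip (- r n) (r n) c (F n)"
    "\<And>n x t. t \<in> {- r n..r n} \<Longrightarrow> F (Suc n) (x,t) = F n (x,t)" by metis
  have Fm: "F n (x,t) = F m (x,t)" if "m \<le> n" "t \<in> {- r m..r m}" for m n x t
    using that
  proof (induction n rule: dec_induct)
    case (step n)
    moreover have "t \<in> {- r n..r n}" using step by (auto simp: r_def)
    ultimately show ?case using F(2) by simp
  qed auto
  \<comment> \<open>Any strip whose interval contains the level gives the same value; the ceiling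
    selects one of them.\<close>
  define G where "G z = F (nat \<lceil>\<bar>snd z\<bar>\<rceil>) z" for z
  have G: "G (x,t) = F n (x,t)" if t: "t \<in> {- r n..r n}" for n x t
  proof -
    define m where "m = nat \<lceil>\<bar>t\<bar>\<rceil>"
    have "\<bar>t\<bar> \<le> real m" unfolding m_def by linarith
    then have "t \<in> {- r m..r m}" by (auto simp: r_def)
    moreover have "G (x,t) = F m (x,t)" by (simp add: G_def m_def)
    ultimately show ?thesis using Fm[of m n t x] Fm[of n m t x] t by (cases "m \<le> n") auto
  qed
  have ex: "\<exists>n. t \<in> {- r n<..<r n}" for t
  proof -
    obtain n where "\<bar>t\<bar> < real n" using reals_Archimedean2 by blast
    then have "t \<in> {- r n<..<r n}" by (auto simp: r_def)
    then show ?thesis by blast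
  qed
  let ?S = "\<lambda>n. (UNIV::real set) \<times> {- r n..r n}" and ?O = "\<lambda>n. (UNIV::real set) \<times> {- r n<..<r n}"
  have GF: "G z = F n z" if "z \<in> ?S n" for z n using G[of "snd z" n "fst z"] that by auto
  have bG: "bij_betw (\<lambda>x. G (x,t)) UNIV (c t)" for t
  proof -
    obtain n where n: "t \<in> {- r n<..<r n}" using ex by blast
    then have "t \<in> {- r n..r n}" by auto
    then show ?thesis using F(1)[of n] G by (auto simp: strip_def)
  qed
  have Gc: "G (x,t) \<in> c t" for x t using bG[of t] by (auto simp: bij_betw_def)
  have cD: "c t \<in> \<Delta>" "c t \<subseteq> Q" for t using imc Qleaves_subset Qleaves_in by blast+
  have iG: "inj G"
  proof (rule injI, clarify)
    fix x s y t assume eq: "G (x,s) = G (y,t)"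
    then have "c s = c t" using leaves_disjoint[OF cD(1) cD(1), of "G (x,s)" s t] Gc[of x s] Gc[of y t] by simp
    then have "s = t" using ic by (auto dest: injD)
    moreover then have "x = y" using eq bG[of t] by (auto simp: bij_betw_def dest: injD)
    ultimately show "x = y \<and> s = t" by simp
  qed
  have rG: "range G = Q"
  proof
    show "range G \<subseteq> Q" using Gc cD by fastforce
    show "Q \<subseteq> range G"
    proof
      fix y assume "y \<in> Q"
      then obtain t where "y \<in> c t" using Union_Qleaves imc by blast
      then show "y \<in> range G" using bG[of t] by (force simp: bij_betw_def)
    qed
  qed
  have hG: "homeomorphic_map euclidean XQ G"
  proof (rule bijective_open_imp_homeomorphic_map)
    show "continuous_map euclidean XQ G"
      unfolding continuous_map_def
    proof (intro conjI allI impI funcsetI)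
      fix z show "G z \<in> topspace XQ" using rG topspace_XQ by blast
    next
      fix V assume V: "openin XQ V"
      have "{z \<in> topspace euclidean. G z \<in> V} = (\<Union>n. {z \<in> ?S n. F n z \<in> V} \<inter> ?O n)"
      proof
        show "{z \<in> topspace euclidean. G z \<in> V} \<subseteq> (\<Union>n. {z \<in> ?S n. F n z \<in> V} \<inter> ?O n)"
        proof clarify
          fix x t assume GV: "G (x,t) \<in> V"
          obtain n where n: "t \<in> {- r n<..<r n}" using ex by blast
          then have "(x,t) \<in> ?S n" by auto
          then have "(x,t) \<in> {z \<in> ?S n. F n z \<in> V} \<inter> ?O n" using GF[of "(x,t)" n] GV n by auto
          then show "(x,t) \<in> (\<Union>n. {z \<in> ?S n. F n z \<in> V} \<inter> ?O n)" by blast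
        qed
        show "(\<Union>n. {z \<in> ?S n. F n z \<in> V} \<inter> ?O n) \<subseteq> {z \<in> topspace euclidean. G z \<in> V}"
        proof (rule UN_least, rule subsetI)
          fix n z assume "z \<in> {z \<in> ?S n. F n z \<in> V} \<inter> ?O n"
          then have "z \<in> ?S n" "F n z \<in> V" by blast+
          then show "z \<in> {z \<in> topspace euclidean. G z \<in> V}" using GF by simp
        qed
      qed
      moreover have "open ({z \<in> ?S n. F n z \<in> V} \<inter> ?O n)" for n
      proof -
        have "openin (top_of_set (?S n)) {z \<in> ?S n. F n z \<in> V}"
          using F(1)[of n] openin_continuous_map_preimage[OF _ V] unfolding strip_def by fastforce
        then obtain H where "open H" "{z \<in> ?S n. F n z \<in> V} = ?S n \<inter> H" unfolding openin_open by blast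
        moreover have "?S n \<inter> H \<inter> ?O n = H \<inter> ?O n" by auto
        moreover have "open (?O n)" by (simp add: open_Times)
        ultimately show ?thesis by (metis open_Int)
      qed
      ultimately show "openin euclidean {z \<in> topspace euclidean. G z \<in> V}" by auto
    qed
    show "open_map euclidean XQ G"
      unfolding open_map_def
    proof (intro allI impI)
      fix W :: "(real \<times> real) set" assume "openin euclidean W"
      then have W: "open W" by simp
      \<comment> \<open>An open union of leaves, minus the closed image of what lies outside
        \<open>W\<close>.\<close>
      have "G ` (W \<inter> ?O n) = \<Union>(c ` {- r n<..<r n}) - F n ` (?S n - W)" for n
      proof (intro equalityI subsetI)
        fix y assume "y \<in> G ` (W \<inter> ?O n)"
        then obtain x t where xt: "(x,t) \<in> W" "t \<in> {- r n<..<r n}" "y = G (x,t)" by auto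
        have "y \<notin> F n ` (?S n - W)"
        proof
          assume "y \<in> F n ` (?S n - W)"
          then obtain z where z: "z \<in> ?S n" "z \<notin> W" "y = F n z" by blast
          then have "G z = G (x,t)" using GF[of z n] xt(3) by simp
          then show False using iG z xt by (metis injD)
        qed
        then show "y \<in> \<Union>(c ` {- r n<..<r n}) - F n ` (?S n - W)" using xt Gc by blast
      next
        fix y assume y: "y \<in> \<Union>(c ` {- r n<..<r n}) - F n ` (?S n - W)"
        then obtain t where t: "t \<in> {- r n<..<r n}" "y \<in> c t" by blast
        then obtain x where x: "y = G (x,t)" using bG[of t] by (auto simp: bij_betw_def)
        have "(x,t) \<in> ?S n" using t by auto
        then have "(x,t) \<in> W" using y x GF by auto
        then show "y \<in> G ` (W \<inter> ?O n)" using t x by auto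
      qed
      moreover have "openin XQ (\<Union>(c ` {- r n<..<r n}) - F n ` (?S n - W))" for n
      proof (rule openin_diff)
        have "openin TQ (c ` {- r n<..<r n})"
          using homeomorphic_imp_open_map[OF hc] by (auto simp: open_map_def)
        then show "openin XQ (\<Union>(c ` {- r n<..<r n}))" by (rule openin_TQ_Union)
        have "closedin (top_of_set (?S n)) (?S n - W)"
          using W by (metis closed_Compl closedin_closed_Int Diff_eq)
        then show "closedin XQ (F n ` (?S n - W))" using F(1)[of n] unfolding strip_def closed_map_def by blast
      qed
      ultimately have "openin XQ (G ` (W \<inter> ?O n))" for n by simp
      moreover have "G ` W = (\<Union>n. G ` (W \<inter> ?O n))"
      proof -
        have "W = (\<Union>n. W \<inter> ?O n)" using ex by auto
        then show ?thesis by (metis image_UN)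
      qed
      ultimately show "openin XQ (G ` W)" by (metis (no_types, lifting) imageE openin_Union)
    qed
    show "G ` topspace euclidean = topspace XQ" using rG topspace_XQ by simp
    show "inj_on G (topspace euclidean)" using iG by simp
  qed
  \<comment> \<open>The transverse direction of the plane is compressed to
    \<open>{-1<..<1}\<close>.\<close>
  obtain \<rho> where "homeomorphic_map euclideanreal (top_of_set {-1<..<1::real}) \<rho>"
    using homeomorphic_UNIV_open_interval[of "{-1<..<1::real}"] by (auto simp: is_interval_oo)
  then obtain \<sigma> where \<rho>\<sigma>: "homeomorphic_maps euclideanreal (top_of_set {-1<..<1::real}) \<rho> \<sigma>"
    using homeomorphic_map_maps by blast
  have cr: "continuous_on UNIV \<rho>" "\<And>x. \<rho> x \<in> {-1<..<1}" "continuous_on {-1<..<1} \<sigma>"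
    "\<And>x. \<sigma> (\<rho> x) = x" "\<And>t. t \<in> {-1<..<1} \<Longrightarrow> \<rho> (\<sigma> t) = t"
    using \<rho>\<sigma> by (auto simp: homeomorphic_maps_def continuous_map_in_subtopology)
  have "homeomorphic_maps (top_of_set open_strip) euclidean (\<lambda>z. (fst z, \<sigma> (snd z))) (\<lambda>z. (fst z, \<rho> (snd z)))"
    unfolding homeomorphic_maps_def continuous_map_in_subtopology open_strip_def
    using cr(2,4,5)
    by (auto intro!: continuous_intros continuous_on_compose2[OF cr(1)] continuous_on_compose2[OF cr(3)])
  then have "homeomorphic_map (top_of_set open_strip) euclidean (\<lambda>z. (fst z, \<sigma> (snd z)))"
    using homeomorphic_maps_imp_map by blast
  from homeomorphic_map_compose[OF this hG]
  have hf: "homeomorphic_map (top_of_set open_strip) XQ (G \<circ> (\<lambda>z. (fst z, \<sigma> (snd z))))" .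
  let ?f = "G \<circ> (\<lambda>z. (fst z, \<sigma> (snd z)))"
  have fim: "?f ` (UNIV \<times> {t}) = c (\<sigma> t)" for t
  proof -
    have "?f ` (UNIV \<times> {t}) = range (\<lambda>x. G (x, \<sigma> t))" by force
    then show ?thesis using bG[of "\<sigma> t"] by (simp add: bij_betw_def)
  qed
  have "(\<lambda>L. ?f ` L) ` open_strip_fol = (\<lambda>t. ?f ` (UNIV \<times> {t})) ` {-1<..<1}"
  proof -
    have o: "open_strip_fol = (\<lambda>t. UNIV \<times> {t}) ` {-1<..<1}" by (auto simp: open_strip_fol_def)
    show ?thesis unfolding o image_image by (rule refl)
  qed
  also have "\<dots> = (\<lambda>t. c (\<sigma> t)) ` {-1<..<1}" by (simp only: fim)
  also have "\<dots> = range c"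
  proof
    show "range c \<subseteq> (\<lambda>t. c (\<sigma> t)) ` {-1<..<1}"
    proof clarify
      fix x show "c x \<in> (\<lambda>t. c (\<sigma> t)) ` {-1<..<1}"
        using cr(2)[of x] cr(4)[of x] by (intro image_eqI[of _ _ "\<rho> x"]) auto
    qed
  qed auto
  finally have "(\<lambda>L. ?f ` L) ` open_strip_fol = restr_fol \<Delta> Q" by (simp add: imc Qleaves_def)
  then show ?thesis
    by (rule foliated_homeomorphicI[OF hf]) (auto simp: open_strip_fol_def open_strip_def)
qed

text \<open>At level \<open>t\<close> the strip is reparametrised by \<open>m\<close>, which
  interpolates linearly between the identity at \<open>-1\<close> and \<open>\<eta>\<close> at
  \<open>1\<close>. Convex combinations of increasing bijections of the line are increasing and
  onto; this is why \<open>\<eta>\<close> has to preserve the orientation.\<close>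

lemma strip_twist:
  assumes f: "strip (-1) 1 c f" and \<eta>: "continuous_on UNIV \<eta>" "strict_mono \<eta>" "surj \<eta>"
  obtains g where "strip (-1) 1 c g" "\<And>x. g (x,-1) = f (x,-1)" "\<And>x. g (x,1) = f (\<eta> x, 1)"
proof -
  define m where "m z = (1 - snd z) / 2 * fst z + (1 + snd z) / 2 * \<eta> (fst z)" for z :: "real \<times> real"
  have cm: "continuous_on (UNIV \<times> {-1..1}) m"
    unfolding m_def by (intro continuous_intros continuous_on_compose2[OF \<eta>(1)]) auto
  have sm: "strict_mono (\<lambda>x. m (x,t))" if t: "t \<in> {-1..1}" for t
  proof (rule strict_monoI)
    fix x y :: real assume xy: "x < y"
    have "\<eta> x < \<eta> y" using xy \<eta>(2) by (simp add: strict_monoD)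
    show "m (x,t) < m (y,t)"
    proof (cases "t = 1")
      case True then show ?thesis using \<open>\<eta> x < \<eta> y\<close> by (simp add: m_def)
    next
      case False
      then have "(1 - t) / 2 * x < (1 - t) / 2 * y" using t xy by (intro mult_strict_left_mono) auto
      moreover have "(1 + t) / 2 * \<eta> x \<le> (1 + t) / 2 * \<eta> y"
        using t \<open>\<eta> x < \<eta> y\<close> by (intro mult_left_mono) auto
      ultimately show ?thesis by (simp add: m_def)
    qed
  qed
  have su: "surj (\<lambda>x. m (x,t))" if t: "t \<in> {-1..1}" for t
  proof -
    have "\<exists>x. m (x,t) = y" for y
    proof -
      obtain z where z: "\<eta> z = y" using \<eta>(3) by (metis surjD)
      \<comment> \<open>Bounds for the solution of \<open>m (x, t) = y\<close>: at \<open>x1\<close>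
        both the identity and \<open>\<eta>\<close> are at most \<open>y\<close>, at
        \<open>x2\<close> both are at least \<open>y\<close>.\<close>
      define x1 x2 where "x1 = min y z" and "x2 = max y z"
      have e: "\<eta> x1 \<le> y" "y \<le> \<eta> x2" using z \<eta>(2) by (auto simp: x1_def x2_def strict_mono_less_eq min_def max_def)
      have "m (x1,t) \<le> (1 - t)/2 * y + (1 + t)/2 * y"
        unfolding m_def using t e by (auto intro!: add_mono mult_left_mono simp: x1_def)
      moreover have "(1 - t)/2 * y + (1 + t)/2 * y \<le> m (x2,t)"
        unfolding m_def using t e by (auto intro!: add_mono mult_left_mono simp: x2_def)
      moreover have "(1 - t)/2 * y + (1 + t)/2 * y = y" by (simp add: field_simps)
      moreover have "continuous_on {x1..x2} (\<lambda>x. m (x,t))"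
        by (rule continuous_on_compose2[OF cm]) (use t in \<open>auto intro!: continuous_intros\<close>)
      moreover have "x1 \<le> x2" by (simp add: x1_def x2_def)
      ultimately show ?thesis using IVT'[of "\<lambda>x. m (x,t)" x1 y x2] by auto
    qed
    then show ?thesis unfolding surj_def by metis
  qed
  have "strip (-1) 1 c (f \<circ> (\<lambda>z. (m z, snd z)))"
    by (rule strip_shear[OF f shear_homeomorphic_map[OF cm sm su]]) auto
  then show ?thesis by (rule that) (simp_all add: m_def)
qed

text \<open>With \<open>\<sigma> = 1\<close> the relation is \<open>cyl_rel\<close>, with \<open>\<sigma> = -1\<close> it is \<open>moeb_rel\<close>.\<close>

lemma strip_quotient:
  assumes w: "closed_curve TQ (-1) 1 w" and f: "strip (-1) 1 w f" and QX: "Q = topspace X"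
    and \<sigma>: "\<sigma> = 1 \<or> \<sigma> = -1" and seam: "\<And>x. f (x,1) = f (\<sigma> * x, -1)"
    and rel: "\<And>p q. rel p q \<longleftrightarrow> p = q \<or> (snd p = -1 \<and> snd q = 1 \<and> fst q = \<sigma> * fst p) \<or>
       (snd p = 1 \<and> snd q = -1 \<and> fst q = \<sigma> * fst p)"
  shows "foliated_homeomorphic XQ (restr_fol \<Delta> Q) (quot_top closed_band rel)
     {cls closed_band rel ` (UNIV \<times> {s}) | s. -1 \<le> s \<and> s \<le> 1}"
proof -
  have wc: "continuous_map (top_of_set {-1..1}) TQ w" and w1: "w (-1) = w 1" and wi: "inj_on w {-1..<1}"
    and wT: "w ` {-1..1} = Qleaves"
    using w by (auto simp: closed_curve_def topspace_TQ)
  have wD: "w t \<in> \<Delta>" if "t \<in> {-1..1}" for t using wT that Qleaves_subset by blast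
  have bf: "bij_betw (\<lambda>x. f (x,t)) UNIV (w t)" if "t \<in> {-1..1}" for t using f that by (simp add: strip_def)
  have fw: "f (x,t) \<in> w t" if "t \<in> {-1..1}" for x t using bf[OF that] by (auto simp: bij_betw_def)
  have fi: "x = y" if "f (x,t) = f (y,t)" "t \<in> {-1..1}" for x y t
    using bf[OF that(2)] that(1) by (auto simp: bij_betw_def dest: injD)
  have tb: "topspace closed_band = UNIV \<times> {-1..1}" by (simp add: closed_band_def)
  have fib: "f p = f p' \<longleftrightarrow> rel p p'" if p: "p \<in> topspace closed_band" "p' \<in> topspace closed_band" for p p'
  proof
    assume "rel p p'"
    then show "f p = f p'"
      unfolding rel using seam[of "fst p"] seam[of "fst p'"] \<sigma> by (cases p; cases p') auto
  next
    assume eq: "f p = f p'"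
    obtain x s y t where xs: "p = (x,s)" "p' = (y,t)" by (cases p; cases p')
    have st: "s \<in> {-1..1}" "t \<in> {-1..1}" using p xs by (auto simp: tb)
    have "w s = w t" using leaves_disjoint[OF wD[OF st(1)] wD[OF st(2)], of "f p"] fw[OF st(1)] fw[OF st(2)] eq xs by simp
    consider "s = t" | "s = -1" "t = 1" | "s = 1" "t = -1"
    proof -
      have "s = t \<or> (s = -1 \<and> t = 1) \<or> (s = 1 \<and> t = -1)"
      proof (cases "s = 1"; cases "t = 1")
        assume "s = 1" "t \<noteq> 1"
        then have "w (-1) = w t" using w1 \<open>w s = w t\<close> by simp
        then have "-1 = t" using inj_onD[OF wi, of "-1" t] st \<open>t \<noteq> 1\<close> by auto
        then show ?thesis using \<open>s = 1\<close> by simp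
      next
        assume "s \<noteq> 1" "t = 1"
        then have "w s = w (-1)" using w1 \<open>w s = w t\<close> by simp
        then have "s = -1" using inj_onD[OF wi, of s "-1"] st \<open>s \<noteq> 1\<close> by auto
        then show ?thesis using \<open>t = 1\<close> by simp
      next
        assume "s \<noteq> 1" "t \<noteq> 1"
        then show ?thesis using inj_onD[OF wi \<open>w s = w t\<close>] st by auto
      qed simp
      then show thesis using that by blast
    qed
    then show "rel p p'"
    proof cases
      case 1
      then show ?thesis using fi[of x t y] eq xs st rel by auto
    next
      case 2
      then have "f (x,-1) = f (\<sigma> * y, -1)" using eq xs seam by simp
      then have "x = \<sigma> * y" using fi by auto
      then show ?thesis using 2 xs \<sigma> unfolding rel by auto
    next
      case 3
      then have "f (\<sigma> * x,-1) = f (y, -1)" using eq xs seam by simp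
      then have "\<sigma> * x = y" using fi by auto
      then show ?thesis using 3 xs \<sigma> unfolding rel by auto
    qed
  qed
  \<comment> \<open>Since \<open>\<sigma> * \<sigma> = 1\<close>, the two seam clauses of
    \<open>rel\<close> are inverse to each other.\<close>
  have relt: "rel p p' \<Longrightarrow> rel p r \<longleftrightarrow> rel p' r" for p p' r
    unfolding rel using \<sigma> by (cases p; cases p'; cases r) auto
  have cls: "cls closed_band rel p = cls closed_band rel p' \<longleftrightarrow> rel p p'"
    if p: "p \<in> topspace closed_band" "p' \<in> topspace closed_band" for p p'
  proof
    assume "cls closed_band rel p = cls closed_band rel p'"
    moreover have "p' \<in> cls closed_band rel p'" using p by (simp add: cls_def rel)
    ultimately have "p' \<in> cls closed_band rel p" by simp
    then show "rel p p'" by (simp add: cls_def)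
  next
    assume "rel p p'"
    then have "rel p r = rel p' r" for r by (rule relt)
    then show "cls closed_band rel p = cls closed_band rel p'" by (simp add: cls_def)
  qed
  have "f ` topspace closed_band = Q"
  proof
    show "f ` topspace closed_band \<subseteq> Q" using f unfolding strip_def continuous_map_def topspace_XQ tb by auto
    show "Q \<subseteq> f ` topspace closed_band"
    proof
      fix y assume "y \<in> Q"
      then obtain t where t: "t \<in> {-1..1}" "y \<in> w t" using Union_Qleaves wT by blast
      then show "y \<in> f ` topspace closed_band" using bf[OF t(1)] by (force simp: bij_betw_def tb)
    qed
  qed
  then have im: "f ` topspace closed_band = topspace XQ" by (simp only: topspace_XQ)
  have "continuous_map closed_band XQ f" "closed_map closed_band XQ f"
    using f unfolding strip_def closed_band_def[symmetric] by blast+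
  \<comment> \<open>A closed continuous surjection is a quotient map, and by \<open>fib\<close> and
    \<open>cls\<close> it has the same fibres as the projection onto the classes.\<close>
  then have "quotient_map closed_band XQ f"
    using im by (rule continuous_closed_imp_quotient_map)
  then obtain h where h: "homeomorphic_map XQ (quot_top closed_band rel) h"
    "\<And>p. p \<in> topspace closed_band \<Longrightarrow> h (f p) = cls closed_band rel p"
    using quotient_maps_same_fibres[OF _ quotient_map_cls, of closed_band XQ f rel] fib cls by metis
  have "(\<lambda>L. h ` L) ` (restr_fol \<Delta> Q) = (\<lambda>t. h ` w t) ` {-1..1}"
    using wT by (simp add: Qleaves_def[symmetric] image_image flip: wT)
  also have "\<dots> = (\<lambda>t. cls closed_band rel ` (UNIV \<times> {t})) ` {-1..1}"
  proof (intro image_cong refl)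
    fix t :: real assume t: "t \<in> {-1..1}"
    have "w t = f ` (UNIV \<times> {t})" using bf[OF t] by (force simp: bij_betw_def)
    then have "h ` w t = (\<lambda>p. h (f p)) ` (UNIV \<times> {t})" by (simp add: image_image)
    also have "\<dots> = cls closed_band rel ` (UNIV \<times> {t})"
      using t by (intro image_cong refl h(2)) (auto simp: tb)
    finally show "h ` w t = cls closed_band rel ` (UNIV \<times> {t})" .
  qed
  also have "\<dots> = {cls closed_band rel ` (UNIV \<times> {s}) | s. -1 \<le> s \<and> s \<le> 1}"
    by (rule image_interval_eq)
  finally show ?thesis using h(1) unfolding foliated_homeomorphic_def by blast
qed

text \<open>A strip over the closed curve has both edges on the same leaf; \<open>\<theta>\<close>
  compares them and \<open>k\<close> is its inverse. Twisting the edge at \<open>1\<close> by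
  \<open>k\<close> if it is increasing, and by \<open>k\<close> after a reflection otherwise, turns
  the seam into the identity or into a reflection.\<close>

lemma circle_case:
  assumes conn: "connected_space X" and cc: "closed_curve TQ u v w0"
  shows "Q = topspace X \<and>
    (foliated_homeomorphic XQ (restr_fol \<Delta> Q) std_cylinder std_cylinder_fol \<or>
     foliated_homeomorphic XQ (restr_fol \<Delta> Q) std_moebius std_moebius_fol)"
proof
  show QX: "Q = topspace X" by (rule compact_leaf_space_imp_Q_all[OF conn cc])
  obtain w where w: "closed_curve TQ (-1) 1 w" using closed_curve_affine[OF cc] by blast
  then have wc: "continuous_map (top_of_set {-1..1}) TQ w" and w1: "w 1 = w (-1)" by (auto simp: closed_curve_def)
  obtain f where f: "strip (-1) 1 w f" using strip_exists[OF _ wc] by auto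
  have "w 1 \<subseteq> Q" using curve_in_Q[OF wc, of 1] by auto
  then obtain \<theta> where \<theta>: "homeomorphic_map euclideanreal euclideanreal \<theta>" "\<And>x. f (\<theta> x, -1) = f (x, 1)"
    using strip_transition[OF f _ f _ w1] by auto
  then obtain k where k: "homeomorphic_maps euclideanreal euclideanreal \<theta> k" using homeomorphic_map_maps by blast
  then have ck: "continuous_on UNIV k" "\<And>x. \<theta> (k x) = x" "\<And>x. k (\<theta> x) = x" by (auto simp: homeomorphic_maps_def)
  have ik: "inj k" using ck(2) by (metis injI)
  have sk: "surj k" using ck(3) by (metis surjI)
  have "strict_mono k \<or> strict_antimono_on UNIV k"
    using injective_eq_monotone_map[of UNIV k] ck(1) ik by auto
  then show "foliated_homeomorphic XQ (restr_fol \<Delta> Q) std_cylinder std_cylinder_fol \<or>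
     foliated_homeomorphic XQ (restr_fol \<Delta> Q) std_moebius std_moebius_fol"
  proof
    assume "strict_mono k"
    then obtain g where g: "strip (-1) 1 w g" "\<And>x. g (x,-1) = f (x,-1)" "\<And>x. g (x,1) = f (k x, 1)"
      using strip_twist[OF f ck(1) _ sk] by metis
    have "g (x,1) = g (1 * x, -1)" for x using g \<theta>(2)[of "k x"] ck(2)[of x] by simp
    then have "foliated_homeomorphic XQ (restr_fol \<Delta> Q) std_cylinder std_cylinder_fol"
      unfolding std_cylinder_def std_cylinder_fol_def
      by (intro strip_quotient[OF w g(1) QX, of 1]) (auto simp: cyl_rel_def)
    then show ?thesis ..
  next
    assume anti: "strict_antimono_on UNIV k"
    define \<eta> where "\<eta> x = k (- x)" for x
    have "continuous_on UNIV \<eta>" unfolding \<eta>_def by (intro continuous_on_compose2[OF ck(1)] continuous_intros) auto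
    moreover have "strict_mono \<eta>" using monotone_onD[OF anti] by (auto intro!: strict_monoI simp: \<eta>_def)
    moreover have "surj \<eta>" unfolding \<eta>_def using sk by (metis surj_def minus_minus)
    ultimately obtain g where g: "strip (-1) 1 w g" "\<And>x. g (x,-1) = f (x,-1)" "\<And>x. g (x,1) = f (\<eta> x, 1)"
      using strip_twist[OF f] by metis
    have "g (x,1) = g (-1 * x, -1)" for x using g \<theta>(2)[of "k (-x)"] ck(2)[of "-x"] by (simp add: \<eta>_def)
    then have "foliated_homeomorphic XQ (restr_fol \<Delta> Q) std_moebius std_moebius_fol"
      unfolding std_moebius_def std_moebius_fol_def
      by (intro strip_quotient[OF w g(1) QX, of "-1"]) (auto simp: moeb_rel_def)
    then show ?thesis ..
  qed
qed

end

section \<open>The ends of a strip\<close>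

text \<open>Each slice is strictly monotone; its direction is the sign of
  \<open>f (1,t) - f (0,t)\<close>, which never vanishes and hence is constant on the interval
  \<open>I\<close>.\<close>

lemma inj_family_monotone:
  fixes f :: "real \<times> real \<Rightarrow> real"
  assumes cf: "continuous_on (UNIV \<times> I) f" and I: "is_interval I" "I \<noteq> {}"
    and inj: "\<And>t. t \<in> I \<Longrightarrow> inj (\<lambda>x. f (x, t))"
  obtains \<sigma> :: real where "\<sigma> = 1 \<or> \<sigma> = -1" "\<And>t. t \<in> I \<Longrightarrow> strict_mono (\<lambda>x. f (\<sigma> * x, t))"
proof -
  have cx: "continuous_on UNIV (\<lambda>x. f (x,t))" if "t \<in> I" for t
    by (rule continuous_on_compose2[OF cf]) (use that in \<open>auto intro!: continuous_intros\<close>)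
  have dich: "strict_mono (\<lambda>x. f (x,t)) \<or> strict_antimono_on UNIV (\<lambda>x. f (x,t))" if "t \<in> I" for t
    using injective_eq_monotone_map[of UNIV "\<lambda>x. f (x,t)"] cx[OF that] inj[OF that] by auto
  define D where "D t = f (1,t) - f (0,t)" for t
  have "continuous_on I (\<lambda>t. f (x,t))" for x
    by (rule continuous_on_compose2[OF cf]) (auto intro!: continuous_intros)
  then have cD: "continuous_on I D" unfolding D_def by (intro continuous_on_diff)
  have D0: "D t \<noteq> 0" if "t \<in> I" for t
    using injD[OF inj[OF that], of 1 0] by (auto simp: D_def)
  have pos: "strict_mono (\<lambda>x. f (x,t))" if "t \<in> I" "D t > 0" for t
  proof -
    have "\<not> strict_antimono_on UNIV (\<lambda>x. f (x,t))"
    proof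
      assume anti: "strict_antimono_on UNIV (\<lambda>x. f (x,t))"
      have "f (1,t) < f (0,t)" using monotone_onD[OF anti, of 0 1] by simp
      then show False using that by (simp add: D_def)
    qed
    then show ?thesis using dich that by blast
  qed
  have neg: "strict_mono (\<lambda>x. f (-1 * x,t))" if "t \<in> I" "D t < 0" for t
  proof -
    have "\<not> strict_mono (\<lambda>x. f (x,t))"
    proof
      assume "strict_mono (\<lambda>x. f (x,t))"
      then have "f (0,t) < f (1,t)" by (rule strict_monoD) simp
      then show False using that by (simp add: D_def)
    qed
    then have anti: "strict_antimono_on UNIV (\<lambda>x. f (x,t))" using dich that by blast
    show ?thesis using monotone_onD[OF anti] by (auto intro!: strict_monoI)
  qed
  obtain t0 where t0: "t0 \<in> I" using I by blast
  have conn: "connected (D ` I)" using I cD by (simp add: connected_continuous_image is_interval_connected_1)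
  have zero: "0 \<notin> D ` I" using D0 by auto
  have sgn: "D s < 0 \<Longrightarrow> D t > 0 \<Longrightarrow> s \<in> I \<Longrightarrow> t \<in> I \<Longrightarrow> False" for s t
    using connectedD_interval[OF conn, of "D s" "D t" 0] zero by auto
  show ?thesis
  proof (cases "D t0 > 0")
    case True
    have "D t > 0" if "t \<in> I" for t using sgn[of t t0] True t0 that D0[OF that] by force
    then show ?thesis using that[of 1] pos by auto
  next
    case False
    then have "D t0 < 0" using D0[OF t0] by auto
    then have "D t < 0" if "t \<in> I" for t using sgn[of t0 t] t0 that D0[OF that] by force
    then show ?thesis using that[of "-1"] neg by auto
  qed
qed

section \<open>The lower half of a strip and the leaves in its closure\<close>

locale strip_region = region X \<Delta> Q q for X :: "'a topology" and \<Delta> :: "'a set set" and Q q +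
  fixes \<phi> :: "real \<times> real \<Rightarrow> 'a"
  assumes phi: "foliated_homeo_map (top_of_set open_strip) open_strip_fol (subtopology X Q) (restr_fol \<Delta> Q) \<phi>"
begin

lemma strip_iff: "(x, t) \<in> open_strip \<longleftrightarrow> -1 < t \<and> t < 1"
  by (auto simp: open_strip_def)

lemma phi_homeo: "homeomorphic_map (top_of_set open_strip) XQ \<phi>"
  using phi by (simp add: foliated_homeo_map_def)

lemma phi_cont: "continuous_map (top_of_set open_strip) X \<phi>"
  using homeomorphic_imp_continuous_map[OF phi_homeo] by (simp add: continuous_map_in_subtopology)

lemma phi_inj: "inj_on \<phi> open_strip"
  using homeomorphic_imp_injective_map[OF phi_homeo] by simp

lemma phi_image: "\<phi> ` open_strip = Q"
  using homeomorphic_imp_surjective_map[OF phi_homeo] unfolding topspace_XQ by simp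

lemma phi_open: "open W \<Longrightarrow> W \<subseteq> open_strip \<Longrightarrow> openin X (\<phi> ` W)"
proof -
  assume "open W" "W \<subseteq> open_strip"
  then have "openin XQ (\<phi> ` W)"
    using homeomorphic_imp_open_map[OF phi_homeo] by (simp add: open_map_def open_subset)
  then show ?thesis using Q_open openin_trans_full by blast
qed

definition inv_phi :: "'a \<Rightarrow> real \<times> real" where
  "inv_phi = inv_into open_strip \<phi>"

lemma inv_phi: "z \<in> open_strip \<Longrightarrow> inv_phi (\<phi> z) = z" "y \<in> Q \<Longrightarrow> \<phi> (inv_phi y) = y" "y \<in> Q \<Longrightarrow> inv_phi y \<in> open_strip"
  using phi_inj phi_image unfolding inv_phi_def by (auto intro: inv_into_f_f f_inv_into_f inv_into_into)

lemma inv_phi_cont: "continuous_map XQ (top_of_set open_strip) inv_phi"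
proof -
  obtain k where k: "homeomorphic_maps (top_of_set open_strip) XQ \<phi> k"
    using phi_homeo homeomorphic_map_maps by blast
  have "k y = inv_phi y" if y: "y \<in> topspace XQ" for y
  proof -
    have "k y \<in> open_strip" using k y by (auto simp: homeomorphic_maps_def continuous_map_def)
    moreover have "\<phi> (k y) = y" using k y by (auto simp: homeomorphic_maps_def)
    ultimately show ?thesis using inv_phi(1) by metis
  qed
  moreover have "continuous_map XQ (top_of_set open_strip) k" using k by (simp add: homeomorphic_maps_def)
  ultimately show ?thesis by (metis continuous_map_eq)
qed

definition leaf :: "real \<Rightarrow> 'a set" where "leaf t = \<phi> ` (UNIV \<times> {t})"

lemma leaf_mem: "\<phi> (x, t) \<in> leaf t" by (auto simp: leaf_def)

lemma Qleaves_eq: "Qleaves = leaf ` {-1<..<1}"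
proof -
  have "Qleaves = (\<lambda>L. \<phi> ` L) ` open_strip_fol" using phi by (simp add: foliated_homeo_map_def Qleaves_def)
  also have "open_strip_fol = (\<lambda>t. UNIV \<times> {t}) ` {-1<..<1}" by (auto simp: open_strip_fol_def)
  also have "(\<lambda>L. \<phi> ` L) ` \<dots> = leaf ` {-1<..<1}" unfolding image_image leaf_def by (rule refl)
  finally show ?thesis .
qed

lemma leaf_in: "\<lbrakk>-1 < t; t < 1\<rbrakk> \<Longrightarrow> leaf t \<in> Qleaves" "\<lbrakk>-1 < t; t < 1\<rbrakk> \<Longrightarrow> leaf t \<in> \<Delta>" "\<lbrakk>-1 < t; t < 1\<rbrakk> \<Longrightarrow> leaf t \<subseteq> Q"
  using Qleaves_eq Qleaves_subset Qleaves_in by auto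

lemma inv_phi_leaf: "\<lbrakk>-1 < t; t < 1; y \<in> leaf t\<rbrakk> \<Longrightarrow> snd (inv_phi y) = t"
  unfolding leaf_def using inv_phi(1) strip_iff by auto

lemma leaf_of_snd:
  assumes "L \<in> \<Delta>" "L \<subseteq> Q" "y \<in> L" shows "L = leaf (snd (inv_phi y))" "-1 < snd (inv_phi y)" "snd (inv_phi y) < 1"
proof -
  have "L \<in> Qleaves" using assms by (simp add: Qleaves_def restr_fol_def)
  then obtain t where t: "-1 < t" "t < 1" "L = leaf t" using Qleaves_eq by auto
  then have "snd (inv_phi y) = t" using inv_phi_leaf assms by blast
  then show "L = leaf (snd (inv_phi y))" "-1 < snd (inv_phi y)" "snd (inv_phi y) < 1" using t by auto
qed

text \<open>The band is the union of a compact set of non-special leaves, so it is closed in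
  \<open>X\<close> and not merely in \<open>Q\<close>. A leaf outside \<open>Q\<close> can thus be
  approached only as the level tends to \<open>-1\<close> or \<open>1\<close>.\<close>

lemma band_closed:
  assumes "-1 < a" "b < 1" shows "closedin X (\<phi> ` (UNIV \<times> {a..b}))"
proof -
  have "continuous_map (top_of_set {a..b}) (top_of_set open_strip) (\<lambda>t. (0::real, t))"
    using assms by (auto simp: continuous_map_in_subtopology strip_iff intro!: continuous_intros)
  then have "continuous_map (top_of_set {a..b}) Y (leaf_of \<Delta> \<circ> (\<phi> \<circ> (\<lambda>t. (0, t))))"
    using phi_cont continuous_map_leaf_of continuous_map_compose by metis
  moreover have "(leaf_of \<Delta> \<circ> (\<phi> \<circ> (\<lambda>t. (0, t)))) t = leaf t" if "t \<in> topspace (top_of_set {a..b})" for t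
    using leaf_of_eq[OF leaf_in(2) leaf_mem] that assms by simp
  ultimately have "continuous_map (top_of_set {a..b}) Y leaf" by (rule continuous_map_eq)
  then have "compactin Y (leaf ` {a..b})"
    using image_compactin[of "top_of_set {a..b}" "{a..b}" Y leaf] by (auto simp: compactin_subtopology)
  moreover have "leaf ` {a..b} \<inter> \<Sigma> = {}"
    using leaf_in(1) Qleaves_not_special assms by fastforce
  ultimately have "closedin X (\<Union>(leaf ` {a..b}))"
    using compact_nonspecial_closed closedin_leaf_space by blast
  moreover have "\<Union>(leaf ` {a..b}) = \<phi> ` (UNIV \<times> {a..b})" by (auto simp: leaf_def)
  ultimately show ?thesis by simp
qed

definition "lower_half = \<phi> ` (UNIV \<times> {-1<..0})"
definition "Z = X closure_of lower_half"
text \<open>Meeting \<open>Z\<close> is all that is asked here; that such a leaf is contained in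
  \<open>Z\<close> will follow from its end chart.\<close>

definition "end_leaves = {L \<in> \<Delta>. L \<inter> Z \<noteq> {} \<and> L \<inter> Q = {}}"
abbreviation "XZ \<equiv> subtopology X Z"

lemma lower_half_subset: "lower_half \<subseteq> Q" unfolding lower_half_def phi_image[symmetric] by (auto simp: strip_iff intro!: imageI)

lemma Z_subset: "Z \<subseteq> topspace X" "lower_half \<subseteq> Z" "topspace XZ = Z"
proof -
  show "Z \<subseteq> topspace X" by (simp add: Z_def closure_of_subset_topspace)
  then show "topspace XZ = Z" by auto
  show "lower_half \<subseteq> Z" unfolding Z_def using lower_half_subset Q_ordinary by (intro closure_of_subset) auto
qed

lemma open_disjoint_Z: "openin X W \<Longrightarrow> W \<inter> lower_half = {} \<Longrightarrow> W \<inter> Z = {}"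
  unfolding Z_def by (meson openin_Int_closure_of_eq_empty)

text \<open>The part of the strip above level 0 is open in \<open>X\<close> and disjoint from the
  half, so the closure adds nothing inside \<open>Q\<close>.\<close>

lemma Z_Int_Q: "Z \<inter> Q = lower_half"
proof -
  have "openin X (\<phi> ` (UNIV \<times> {0<..<1}))" by (intro phi_open open_Times) (auto simp: strip_iff)
  moreover have "\<phi> ` (UNIV \<times> {0<..<1}) \<inter> lower_half = {}"
    unfolding lower_half_def by (subst inj_on_image_Int[OF phi_inj, symmetric]) (auto simp: strip_iff)
  ultimately have "\<phi> ` (UNIV \<times> {0<..<1}) \<inter> Z = {}" by (rule open_disjoint_Z)
  moreover have "Q = lower_half \<union> \<phi> ` (UNIV \<times> {0<..<1})"
    unfolding lower_half_def phi_image[symmetric] open_strip_def image_Un[symmetric] by (intro image_cong) auto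
  ultimately show ?thesis using Z_subset by blast
qed

text \<open>On the side \<open>\<sigma>\<close> of its core a thin collar is connected and ordinary,
  so this side misses \<open>Q\<close> or lies in it. In \<open>Q\<close> its leaves have levels
  \<open>\<theta> s\<close> that depend monotonically on \<open>s\<close>, and as \<open>s\<close>
  tends to 0 they leave every closed band. If they tend to \<open>1\<close>, the side is eventually
  clear of the lower half; if they tend to \<open>-1\<close>, it runs into the lower end of the
  strip, which is the second alternative.\<close>

lemma collar_side:
  assumes c: "collar X \<Delta> L J U \<gamma>" and J: "J = {0..<1} \<or> J = {-1<..<1}" and LQ: "L \<inter> Q = {}"
    and e: "e > 0" "e \<le> 1" "\<And>t. \<lbrakk>t \<in> J; t \<noteq> 0; \<bar>t\<bar> < e\<rbrakk> \<Longrightarrow> \<gamma> ` (UNIV \<times> {t}) \<subseteq> ordinary"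
    and \<sigma>: "\<sigma> = 1 \<or> \<sigma> = (-1::real)"
  shows "(\<exists>\<eta>>0. \<forall>s\<in>{0<..<\<eta>}. \<sigma> * s \<in> J \<longrightarrow> \<gamma> ` (UNIV \<times> {\<sigma> * s}) \<inter> lower_half = {}) \<or>
    ((\<forall>s\<in>{0..<e}. \<sigma> * s \<in> J) \<and>
     (\<exists>\<theta>. continuous_on {0<..<e} \<theta> \<and> strict_mono_on {0<..<e} \<theta> \<and>
        (\<forall>a>-1. \<exists>\<eta>>0. \<forall>s\<in>{0<..<e}. s < \<eta> \<longrightarrow> \<theta> s < a) \<and>
        (\<forall>s\<in>{0<..<e}. -1 < \<theta> s \<and> \<theta> s < 1 \<and> \<gamma> ` (UNIV \<times> {\<sigma> * s}) = leaf (\<theta> s))))"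
proof (cases "\<forall>s\<in>{0..<e}. \<sigma> * s \<in> J")
  case False
  \<comment> \<open>A boundary leaf has no such side, so there the first alternative holds
    vacuously.\<close>
  then have "\<sigma> = -1" "J = {0..<1}" using J \<sigma> e(2) by auto
  then show ?thesis by (intro disjI1 exI[of _ 1]) auto
next
  case sJ: True
  have L0: "\<gamma> ` (UNIV \<times> {0}) = L" using c by (simp add: collar_def)
  let ?R = "\<gamma> ` (UNIV \<times> ((*) \<sigma> ` {0<..<e}))"
  have Rord: "?R \<subseteq> ordinary"
  proof clarify
    fix x s assume s: "s \<in> {0<..<e}"
    then have "\<gamma> ` (UNIV \<times> {\<sigma> * s}) \<subseteq> ordinary" using sJ \<sigma> by (intro e(3)) auto
    then show "\<gamma> (x, \<sigma> * s) \<in> ordinary" by blast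
  qed
  have "connected (UNIV \<times> ((*) \<sigma> ` {0<..<e}) :: (real \<times> real) set)"
    by (intro connected_Times connected_continuous_image continuous_intros) auto
  then have Rc: "connectedin X ?R" using sJ by (intro collar_connected_image[OF c]) auto
  show ?thesis
  proof (cases "?R \<inter> Q = {}")
    case True
    then have "\<forall>s\<in>{0<..<e}. \<sigma> * s \<in> J \<longrightarrow> \<gamma> ` (UNIV \<times> {\<sigma> * s}) \<inter> lower_half = {}"
      using lower_half_subset by blast
    then show ?thesis using e(1) by blast
  next
    case False
    then have RQ: "?R \<subseteq> Q" using Q_maximal[OF Rc Rord] by blast
    define \<theta> where "\<theta> s = snd (inv_phi (\<gamma> (0, \<sigma> * s)))" for s
    have inQ: "\<gamma> (x, \<sigma> * s) \<in> Q" if "s \<in> {0<..<e}" for x s using RQ that by blast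
    have lf: "\<gamma> ` (UNIV \<times> {\<sigma> * s}) = leaf (\<theta> s)" "-1 < \<theta> s" "\<theta> s < 1" if s: "s \<in> {0<..<e}" for s
    proof -
      have "\<sigma> * s \<in> J" using sJ s by auto
      then have "\<gamma> ` (UNIV \<times> {\<sigma> * s}) \<in> \<Delta>" by (rule collarD(5)[OF c])
      moreover have "\<gamma> ` (UNIV \<times> {\<sigma> * s}) \<subseteq> Q" using inQ[OF s] by blast
      moreover have "\<gamma> (0, \<sigma> * s) \<in> \<gamma> ` (UNIV \<times> {\<sigma> * s})" by blast
      ultimately show "\<gamma> ` (UNIV \<times> {\<sigma> * s}) = leaf (\<theta> s)" "-1 < \<theta> s" "\<theta> s < 1"
        unfolding \<theta>_def by (rule leaf_of_snd)+
    qed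
    have line: "continuous_map (top_of_set {0..<e}) X (\<lambda>s. \<gamma> (0, \<sigma> * s))"
    proof -
      have "continuous_map (top_of_set {0..<e}) (top_of_set (UNIV \<times> J)) (\<lambda>s. (0::real, \<sigma> * s))"
        using sJ by (auto simp: continuous_map_in_subtopology intro!: continuous_intros)
      from continuous_map_compose[OF this collarD(1)[OF c]] show ?thesis by (simp add: o_def)
    qed
    have c\<theta>: "continuous_on {0<..<e} \<theta>"
    proof -
      have sub0: "{0<..<e} \<subseteq> {0..<e}" by auto
      have "continuous_map (top_of_set {0<..<e}) XQ (\<lambda>s. \<gamma> (0, \<sigma> * s))"
        using continuous_map_from_subtopology_mono[OF line sub0] inQ
        by (auto simp: continuous_map_in_subtopology)
      from continuous_map_compose[OF this inv_phi_cont]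
      have "continuous_on {0<..<e} (\<lambda>s. inv_phi (\<gamma> (0, \<sigma> * s)))"
        by (simp add: o_def continuous_map_in_subtopology)
      then show ?thesis unfolding \<theta>_def by (rule continuous_on_snd)
    qed
    have "inj_on \<theta> {0<..<e}"
    proof (rule inj_onI)
      fix s t assume st: "s \<in> {0<..<e}" "t \<in> {0<..<e}" "\<theta> s = \<theta> t"
      then have "\<gamma> ` (UNIV \<times> {\<sigma> * s}) = \<gamma> ` (UNIV \<times> {\<sigma> * t})" using lf(1) by simp
      then have "\<sigma> * s = \<sigma> * t" using sJ st by (intro collar_leaf_inj[OF c]) auto
      then show "s = t" using \<sigma> by auto
    qed
    then have mono: "strict_mono_on {0<..<e} \<theta> \<or> strict_antimono_on {0<..<e} \<theta>"
      using injective_eq_monotone_map[of "{0<..<e}" \<theta>] c\<theta> by (simp add: is_interval_oo)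
    have avoid: "\<exists>\<eta>>0. \<forall>s\<in>{0<..<e}. s < \<eta> \<longrightarrow> \<theta> s \<notin> {a..b}" if ab: "-1 < a" "b < 1" for a b
    proof -
      have "openin X (topspace X - \<phi> ` (UNIV \<times> {a..b}))" using band_closed[OF ab] by blast
      from openin_continuous_map_preimage[OF line this]
      have "openin (top_of_set {0..<e}) {s \<in> {0..<e}. \<gamma> (0, \<sigma> * s) \<in> topspace X - \<phi> ` (UNIV \<times> {a..b})}"
        by simp
      then obtain G where G: "open G" "{s \<in> {0..<e}. \<gamma> (0, \<sigma> * s) \<in> topspace X - \<phi> ` (UNIV \<times> {a..b})} = {0..<e} \<inter> G"
        unfolding openin_open by blast
      have "\<gamma> (0,0) \<in> L" using L0 by blast
      moreover have "\<phi> ` (UNIV \<times> {a..b}) \<subseteq> Q"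
        using ab unfolding phi_image[symmetric] by (intro image_mono) (auto simp: open_strip_def)
      moreover have "L \<subseteq> topspace X" using c openin_subset[of X U] unfolding collar_def by blast
      ultimately have "\<gamma> (0, \<sigma> * 0) \<in> topspace X - \<phi> ` (UNIV \<times> {a..b})" using LQ by auto
      then have "0 \<in> G" using G(2) e(1) by auto
      then obtain \<eta> where \<eta>: "\<eta> > 0" "\<And>s. \<bar>s - 0\<bar> < \<eta> \<Longrightarrow> s \<in> G" using G(1) open_nbhd_real by metis
      have "\<theta> s \<notin> {a..b}" if s: "s \<in> {0<..<e}" "s < \<eta>" for s
      proof
        assume "\<theta> s \<in> {a..b}"
        have "\<gamma> (0, \<sigma> * s) \<in> leaf (\<theta> s)" using lf(1)[OF s(1)] by blast
        then have "\<gamma> (0, \<sigma> * s) \<in> \<phi> ` (UNIV \<times> {a..b})" using \<open>\<theta> s \<in> {a..b}\<close> by (auto simp: leaf_def)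
        moreover have "s \<in> {0..<e} \<inter> G" using s \<eta>(2)[of s] by auto
        ultimately show False using G(2) by blast
      qed
      then show ?thesis using \<eta>(1) by blast
    qed
    define m where "m = e / 2"
    have m: "m \<in> {0<..<e}" using e(1) by (auto simp: m_def)
    from mono show ?thesis
    proof
      assume sm: "strict_mono_on {0<..<e} \<theta>"
      have "\<exists>\<eta>>0. \<forall>s\<in>{0<..<e}. s < \<eta> \<longrightarrow> \<theta> s < a" if a: "a > -1" for a
      proof -
        obtain \<eta> where \<eta>: "\<eta> > 0" "\<forall>s\<in>{0<..<e}. s < \<eta> \<longrightarrow> \<theta> s \<notin> {a..\<theta> m}"
          using avoid[OF a lf(3)[OF m]] by blast
        have "\<theta> s < a" if s: "s \<in> {0<..<e}" "s < min \<eta> m" for s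
        proof -
          have "\<theta> s < \<theta> m" using strict_mono_onD[OF sm s(1) m] s(2) by simp
          moreover have "\<theta> s \<notin> {a..\<theta> m}" using \<eta>(2) s by auto
          ultimately show ?thesis by auto
        qed
        then show ?thesis using \<eta>(1) m by (intro exI[of _ "min \<eta> m"]) auto
      qed
      then show ?thesis using sJ c\<theta> sm lf by (intro disjI2) blast
    next
      assume anti: "strict_antimono_on {0<..<e} \<theta>"
      \<comment> \<open>With \<open>\<theta>\<close> decreasing, levels close to the core exceed
        \<open>\<theta> m\<close>; avoiding the band from \<open>min 0 (\<theta> m)\<close> to 0
        then forces them above 0.\<close>
      obtain \<eta> where \<eta>: "\<eta> > 0" "\<forall>s\<in>{0<..<e}. s < \<eta> \<longrightarrow> \<theta> s \<notin> {min 0 (\<theta> m)..0}"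
        using avoid[of "min 0 (\<theta> m)" 0] lf(2)[OF m] by auto
      have "\<gamma> ` (UNIV \<times> {\<sigma> * s}) \<inter> lower_half = {}" if s: "s \<in> {0<..<min (min \<eta> m) e}" for s
      proof -
        have se: "s \<in> {0<..<e}" using s by auto
        have "\<theta> m < \<theta> s" using monotone_onD[OF anti se m] s by simp
        moreover have "\<theta> s \<notin> {min 0 (\<theta> m)..0}" using \<eta>(2) s by auto
        ultimately have pos: "\<theta> s > 0" by auto
        show ?thesis
        proof (rule ccontr)
          assume "\<gamma> ` (UNIV \<times> {\<sigma> * s}) \<inter> lower_half \<noteq> {}"
          then obtain y where y: "y \<in> leaf (\<theta> s)" "y \<in> lower_half" using lf(1)[OF se] by blast
          then obtain x t where t: "t \<in> {-1<..0}" "y = \<phi> (x,t)" by (auto simp: lower_half_def)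
          then have "snd (inv_phi y) = t" using inv_phi_leaf[of t y] leaf_mem by auto
          moreover have "snd (inv_phi y) = \<theta> s" using inv_phi_leaf y lf[OF se] by blast
          ultimately show False using t pos by auto
        qed
      qed
      then show ?thesis using \<eta>(1) m e(1) by (intro disjI1 exI[of _ "min (min \<eta> m) e"]) auto
    qed
  qed
qed

end

lemma continuous_on_insert_endpoint:
  fixes f :: "real \<Rightarrow> real"
  assumes c: "continuous_on {a<..b} f" and lim: "\<And>y. y > f a \<Longrightarrow> \<exists>d>0. \<forall>x\<in>{a<..b}. x - a < d \<longrightarrow> f a \<le> f x \<and> f x < y"
  shows "continuous_on {a..b} f"
proof (cases "a < b")
  case False
  then have "{a..b} \<subseteq> {a}" by auto
  then show ?thesis using continuous_on_subset[OF continuous_on_sing] by blast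
next
  case True
  show ?thesis
    unfolding continuous_on_iff
  proof (intro ballI allI impI)
    fix x e :: real assume x: "x \<in> {a..b}" and e: "0 < e"
    show "\<exists>d>0. \<forall>y\<in>{a..b}. dist y x < d \<longrightarrow> dist (f y) (f x) < e"
    proof (cases "x = a")
      case True
      obtain d where d: "d > 0" "\<forall>y\<in>{a<..b}. y - a < d \<longrightarrow> f a \<le> f y \<and> f y < f a + e"
        using lim[of "f a + e"] e by auto
      have "dist (f y) (f x) < e" if "y \<in> {a..b}" "dist y x < d" for y
        using that d(2) e True by (cases "y = a") (auto simp: dist_real_def)
      then show ?thesis using d(1) by blast
    next
      case False
      then have "x \<in> {a<..b}" using x by auto
      then obtain d where d: "d > 0" "\<forall>y\<in>{a<..b}. dist y x < d \<longrightarrow> dist (f y) (f x) < e"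
        using c e unfolding continuous_on_iff by blast
      have "dist (f y) (f x) < e" if "y \<in> {a..b}" "dist y x < min d (x - a)" for y
      proof -
        have "y \<in> {a<..b}" using that by (auto simp: dist_real_def)
        then show ?thesis using d(2) that(2) by simp
      qed
      moreover have "min d (x - a) > 0" using d(1) \<open>x \<in> {a<..b}\<close> by auto
      ultimately show ?thesis by blast
    qed
  qed
qed

section \<open>One-sided charts at the end leaves\<close>

context strip_region begin

text \<open>A one-sided collar of \<open>L\<close> whose levels are those of the strip. Openness
  refers to \<open>XZ\<close>, because the other side of \<open>L\<close> is left out. The
  monotonicity clause fixes an orientation, so that on a common level the coordinates of different
  end charts are increasing functions of the coordinate of \<open>\<phi>\<close>.\<close>

definition end_chart :: "'a set \<Rightarrow> real \<Rightarrow> (real \<times> real \<Rightarrow> 'a) \<Rightarrow> bool" where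
  "end_chart L \<delta> \<psi> \<longleftrightarrow> -1 < \<delta> \<and> \<delta> < 0 \<and>
     continuous_map (top_of_set (UNIV \<times> {-1..<\<delta>})) X \<psi> \<and>
     inj_on \<psi> (UNIV \<times> {-1..<\<delta>}) \<and>
     open_map (top_of_set (UNIV \<times> {-1..<\<delta>})) XZ \<psi> \<and>
     \<psi> ` (UNIV \<times> {-1}) = L \<and>
     (\<forall>t. -1 < t \<and> t < \<delta> \<longrightarrow> \<psi> ` (UNIV \<times> {t}) = leaf t \<and> strict_mono (\<lambda>x. fst (inv_phi (\<psi> (x, t)))))"

text \<open>Only the orientation is missing; by \<open>inj_family_monotone\<close> it is the same on
  all levels, so one reflection of the line corrects it.\<close>

lemma end_chart_orient:
  fixes \<psi> :: "real \<times> real \<Rightarrow> 'a"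
  assumes d: "-1 < \<delta>" "\<delta> < 0"
    and ct: "continuous_map (top_of_set (UNIV \<times> {-1..<\<delta>})) X \<psi>"
    and inj: "inj_on \<psi> (UNIV \<times> {-1..<\<delta>})"
    and op: "open_map (top_of_set (UNIV \<times> {-1..<\<delta>})) XZ \<psi>"
    and L: "\<psi> ` (UNIV \<times> {-1}) = L"
    and lf: "\<And>t. -1 < t \<Longrightarrow> t < \<delta> \<Longrightarrow> \<psi> ` (UNIV \<times> {t}) = leaf t"
  shows "\<exists>\<psi>. end_chart L \<delta> \<psi>"
proof -
  let ?D = "UNIV \<times> {-1..<\<delta>} :: (real \<times> real) set" and ?E = "UNIV \<times> {-1<..<\<delta>} :: (real \<times> real) set"
  have subE: "?E \<subseteq> ?D" by auto
  have inQ: "\<psi> z \<in> Q" if zE: "z \<in> ?E" for z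
  proof -
    obtain x t where z: "z = (x,t)" "-1 < t" "t < \<delta>" using zE by auto
    then have "\<psi> z \<in> leaf t" using lf by blast
    then show ?thesis using leaf_in(3)[of t] z d by auto
  qed
  have "continuous_map (top_of_set ?E) XQ \<psi>"
    using continuous_map_from_subtopology_mono[OF ct subE] inQ
    by (auto simp: continuous_map_in_subtopology)
  from continuous_map_compose[OF this inv_phi_cont]
  have "continuous_on ?E (\<lambda>z. inv_phi (\<psi> z))" by (simp add: o_def continuous_map_in_subtopology)
  then have cf: "continuous_on ?E (\<lambda>z. fst (inv_phi (\<psi> z)))" by (rule continuous_on_fst)
  have "inj (\<lambda>x. fst (inv_phi (\<psi> (x,t))))" if t: "t \<in> {-1<..<\<delta>}" for t
  proof (rule injI)
    fix x y assume eq: "fst (inv_phi (\<psi> (x,t))) = fst (inv_phi (\<psi> (y,t)))"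
    have m: "\<psi> (x,t) \<in> leaf t" "\<psi> (y,t) \<in> leaf t" using lf t by auto
    then have "snd (inv_phi (\<psi> (x,t))) = snd (inv_phi (\<psi> (y,t)))" using inv_phi_leaf[of t] t d by auto
    then have "inv_phi (\<psi> (x,t)) = inv_phi (\<psi> (y,t))" using eq by (simp add: prod_eq_iff)
    then have "\<psi> (x,t) = \<psi> (y,t)" using inv_phi(2) inQ t by (metis mem_Sigma_iff UNIV_I)
    then have "(x,t) = (y,t)" by (rule inj_onD[OF inj]) (use t in auto)
    then show "x = y" by simp
  qed
  then obtain \<sigma> where \<sigma>: "\<sigma> = 1 \<or> \<sigma> = -1"
    "\<And>t. t \<in> {-1<..<\<delta>} \<Longrightarrow> strict_mono (\<lambda>x. fst (inv_phi (\<psi> (\<sigma> * x, t))))"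
    using inj_family_monotone[OF cf] d by (auto simp: is_interval_oo)
  define \<psi>' where "\<psi>' = \<psi> \<circ> (\<lambda>z. (\<sigma> * fst z, snd z))"
  have "homeomorphic_maps (top_of_set ?D) (top_of_set ?D) (\<lambda>z. (\<sigma> * fst z, snd z)) (\<lambda>z. (\<sigma> * fst z, snd z))"
    using \<sigma>(1) by (auto simp: homeomorphic_maps_def continuous_map_in_subtopology intro!: continuous_intros)
  then have fl: "homeomorphic_map (top_of_set ?D) (top_of_set ?D) (\<lambda>z. (\<sigma> * fst z, snd z))"
    using homeomorphic_maps_imp_map by blast
  have im: "\<psi>' ` (UNIV \<times> {t}) = \<psi> ` (UNIV \<times> {t})" for t
  proof -
    have "(\<lambda>z. (\<sigma> * fst z, snd z)) ` (UNIV \<times> {t}) = UNIV \<times> {t}"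
    proof
      show "UNIV \<times> {t} \<subseteq> (\<lambda>z. (\<sigma> * fst z, snd z)) ` (UNIV \<times> {t})"
      proof clarify
        fix x show "(x,t) \<in> (\<lambda>z. (\<sigma> * fst z, snd z)) ` (UNIV \<times> {t})"
          using \<sigma>(1) by (intro image_eqI[of _ _ "(\<sigma> * x, t)"]) auto
      qed
    qed auto
    then show ?thesis unfolding \<psi>'_def image_comp[symmetric] by simp
  qed
  have "end_chart L \<delta> \<psi>'"
    unfolding end_chart_def
  proof (intro conjI allI impI)
    show "continuous_map (top_of_set ?D) X \<psi>'"
      unfolding \<psi>'_def using homeomorphic_imp_continuous_map[OF fl] ct by (rule continuous_map_compose)
    show "open_map (top_of_set ?D) XZ \<psi>'"
      unfolding \<psi>'_def using homeomorphic_imp_open_map[OF fl] op by (rule open_map_compose)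
    show "inj_on \<psi>' ?D"
      unfolding \<psi>'_def
    proof (rule comp_inj_on)
      show "inj_on (\<lambda>z. (\<sigma> * fst z, snd z)) ?D" using homeomorphic_imp_injective_map[OF fl] by simp
      show "inj_on \<psi> ((\<lambda>z. (\<sigma> * fst z, snd z)) ` ?D)"
        using inj homeomorphic_imp_surjective_map[OF fl] by simp
    qed
    show "\<psi>' ` (UNIV \<times> {-1}) = L" using im L by simp
    fix t assume t: "-1 < t \<and> t < \<delta>"
    show "\<psi>' ` (UNIV \<times> {t}) = leaf t" using im lf t by simp
    show "strict_mono (\<lambda>x. fst (inv_phi (\<psi>' (x, t))))" using \<sigma>(2)[of t] t by (simp add: \<psi>'_def)
  qed (use d in auto)
  then show ?thesis by blast
qed

text \<open>Exactly one side of the collar runs into the lower end. If both sides were clear of the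
  lower half, \<open>L\<close> would have a neighbourhood missing it and could not meet
  \<open>Z\<close>. If both ran into it, the same leaf would occur on both sides of the collar,
  against injectivity. On the one side that remains, the level of the strip becomes the transverse
  coordinate.\<close>

lemma end_chart_exists:
  assumes L: "L \<in> end_leaves"
  shows "\<exists>\<delta> \<psi>. end_chart L \<delta> \<psi>"
proof -
  have LD: "L \<in> \<Delta>" and LZ: "L \<inter> Z \<noteq> {}" and LQ: "L \<inter> Q = {}" using L by (auto simp: end_leaves_def)
  define J where "J = (if L \<subseteq> mboundary X then {0..<1} else {-1<..<1::real})"
  have J: "J = {0..<1} \<or> J = {-1<..<1}" by (simp add: J_def)
  have J0: "0 \<in> J" using J by auto
  obtain U \<gamma> where c: "collar X \<Delta> L J U \<gamma>" using collar_exists[OF LD] unfolding J_def by blast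
  have L0: "\<gamma> ` (UNIV \<times> {0}) = L" using c by (simp add: collar_def)
  obtain e where e: "e > 0" "e \<le> 1" "\<And>t. \<lbrakk>t \<in> J; t \<noteq> 0; \<bar>t\<bar> < e\<rbrakk> \<Longrightarrow> \<gamma> ` (UNIV \<times> {t}) \<subseteq> ordinary"
    using collar_nearby_ordinary[OF locfin c J] by blast
  define clear where "clear \<sigma> \<longleftrightarrow> (\<exists>\<eta>>0. \<forall>s\<in>{0<..<\<eta>}. \<sigma> * s \<in> J \<longrightarrow> \<gamma> ` (UNIV \<times> {\<sigma> * s}) \<inter> lower_half = {})" for \<sigma>
  define tail where "tail \<sigma> \<theta> \<longleftrightarrow> continuous_on {0<..<e} \<theta> \<and> strict_mono_on {0<..<e} \<theta> \<and>
        (\<forall>a>-1. \<exists>\<eta>>0. \<forall>s\<in>{0<..<e}. s < \<eta> \<longrightarrow> \<theta> s < a) \<and>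
        (\<forall>s\<in>{0<..<e}. -1 < \<theta> s \<and> \<theta> s < 1 \<and> \<gamma> ` (UNIV \<times> {\<sigma> * s}) = leaf (\<theta> s))" for \<sigma> and \<theta> :: "real \<Rightarrow> real"
  have dich: "clear \<sigma> \<or> ((\<forall>s\<in>{0..<e}. \<sigma> * s \<in> J) \<and> (\<exists>\<theta>. tail \<sigma> \<theta>))" if "\<sigma> = 1 \<or> \<sigma> = -1" for \<sigma>
    using collar_side[OF c J LQ e that] unfolding clear_def tail_def .
  have not_both_clear: "\<not> (clear 1 \<and> clear (-1))"
  proof
    assume "clear 1 \<and> clear (-1)"
    then have "clear 1" "clear (-1)" by auto
    from this(1) obtain \<eta>1 where \<eta>1: "\<eta>1 > 0"
      "\<forall>s\<in>{0<..<\<eta>1}. 1 * s \<in> J \<longrightarrow> \<gamma> ` (UNIV \<times> {1 * s}) \<inter> lower_half = {}"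
      unfolding clear_def by (elim exE conjE)
    from \<open>clear (-1)\<close> obtain \<eta>2 where \<eta>2: "\<eta>2 > 0"
      "\<forall>s\<in>{0<..<\<eta>2}. -1 * s \<in> J \<longrightarrow> \<gamma> ` (UNIV \<times> {-1 * s}) \<inter> lower_half = {}"
      unfolding clear_def by (elim exE conjE)
    note \<eta> = \<eta>1(1) \<eta>2(1) bspec[OF \<eta>1(2)] bspec[OF \<eta>2(2)]
    define V where "V = \<gamma> ` (UNIV \<times> (J \<inter> {-\<eta>2<..<\<eta>1}))"
    have "openin X V" unfolding V_def by (rule collar_open_image[OF c]) auto
    moreover have "V \<inter> lower_half = {}"
    proof -
      have "\<gamma> (x,t) \<notin> lower_half" if t: "t \<in> J" "-\<eta>2 < t" "t < \<eta>1" for x t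
      proof -
        have mem: "\<gamma> (x,t) \<in> \<gamma> ` (UNIV \<times> {t})" by blast
        consider "t > 0" | "t = 0" | "t < 0" by linarith
        then show ?thesis
        proof cases
          case 1 then show ?thesis using \<eta>(3)[of t] t mem by auto
        next
          case 2 then show ?thesis using mem L0 LQ lower_half_subset by blast
        next
          case 3 then show ?thesis using \<eta>(4)[of "-t"] t mem by auto
        qed
      qed
      then show ?thesis by (auto simp: V_def)
    qed
    ultimately have "V \<inter> Z = {}" by (rule open_disjoint_Z)
    moreover have "L \<subseteq> V" unfolding V_def L0[symmetric] using J0 \<eta>(1,2) by (intro image_mono) auto
    ultimately show False using LZ by blast
  qed
  have not_both_tail: False if t1: "tail 1 \<theta>1" and t2: "tail (-1) \<theta>2" and nJ: "\<forall>s\<in>{0..<e}. -1 * s \<in> J" for \<theta>1 \<theta>2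
  proof -
    define m where "m = e / 2"
    have m: "m \<in> {0<..<e}" using e(1) by (auto simp: m_def)
    \<comment> \<open>Both families of levels start arbitrarily close to \<open>-1\<close>, so by
      the intermediate value theorem both sides contain the leaf of level \<open>v\<close>.\<close>
    define v where "v = min (\<theta>1 m) (\<theta>2 m)"
    have v: "-1 < v" "v \<le> \<theta>1 m" "v \<le> \<theta>2 m" using t1 t2 m by (auto simp: v_def tail_def)
    have hit: "\<exists>s\<in>{0<..<e}. \<theta> s = v" if tl: "tail \<sigma> \<theta>" and vm: "v \<le> \<theta> m" for \<sigma> \<theta>
    proof -
      have "\<exists>\<eta>>0. \<forall>s\<in>{0<..<e}. s < \<eta> \<longrightarrow> \<theta> s < v" using tl v(1) unfolding tail_def by blast
      then obtain \<eta> where \<eta>: "\<eta> > 0" "\<And>s. s \<in> {0<..<e} \<Longrightarrow> s < \<eta> \<Longrightarrow> \<theta> s < v" by blast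
      define s where "s = min (\<eta>/2) m"
      have s: "s \<in> {0<..<e}" "s < \<eta>" "s \<le> m" using \<eta>(1) m by (auto simp: s_def)
      have "continuous_on {s..m} \<theta>"
        by (rule continuous_on_subset[of "{0<..<e}"]) (use tl s m in \<open>auto simp: tail_def\<close>)
      then obtain r where "s \<le> r" "r \<le> m" "\<theta> r = v"
        using IVT'[of \<theta> s v m] \<eta>(2)[OF s(1,2)] vm s by auto
      then show ?thesis using s m by auto
    qed
    obtain s1 where s1: "s1 \<in> {0<..<e}" "\<theta>1 s1 = v" using hit[OF t1 v(2)] by blast
    obtain s2 where s2: "s2 \<in> {0<..<e}" "\<theta>2 s2 = v" using hit[OF t2 v(3)] by blast
    have "\<gamma> ` (UNIV \<times> {1 * s1}) = \<gamma> ` (UNIV \<times> {-1 * s2})"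
      using t1 t2 s1 s2 unfolding tail_def by metis
    then have "1 * s1 = -1 * s2"
      by (rule collar_leaf_inj[OF c, rotated 2]) (use nJ J s1 s2 e(2) in auto)
    then show False using s1 s2 by auto
  qed
  obtain \<sigma> :: real and \<theta> where \<sigma>: "\<sigma> = 1 \<or> \<sigma> = -1" and sJ: "\<forall>s\<in>{0..<e}. \<sigma> * s \<in> J"
    and tl: "tail \<sigma> \<theta>" and cl: "clear (- \<sigma>)"
  proof (cases "clear 1")
    case True
    then have "\<not> clear (-1)" using not_both_clear by blast
    then show thesis using dich[of "-1"] that[of "-1"] True by auto
  next
    case False
    then obtain \<theta> where \<theta>: "\<forall>s\<in>{0..<e}. 1 * s \<in> J" "tail 1 \<theta>" using dich[of 1] by auto
    then have "clear (-1)" using dich[of "-1"] not_both_tail by auto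
    then show thesis using that[of 1] \<theta> by auto
  qed
  from cl obtain \<eta> where \<eta>0: "\<eta> > 0" "\<forall>s\<in>{0<..<\<eta>}. - \<sigma> * s \<in> J \<longrightarrow> \<gamma> ` (UNIV \<times> {- \<sigma> * s}) \<inter> lower_half = {}"
    unfolding clear_def by (elim exE conjE)
  note \<eta> = \<eta>0(1) bspec[OF \<eta>0(2), THEN mp]
  have c\<theta>: "continuous_on {0<..<e} \<theta>" and sm: "strict_mono_on {0<..<e} \<theta>"
    and lim: "\<And>a. a > -1 \<Longrightarrow> \<exists>\<eta>>0. \<forall>s\<in>{0<..<e}. s < \<eta> \<longrightarrow> \<theta> s < a"
    and th: "\<And>s. s \<in> {0<..<e} \<Longrightarrow> -1 < \<theta> s \<and> \<theta> s < 1 \<and> \<gamma> ` (UNIV \<times> {\<sigma> * s}) = leaf (\<theta> s)"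
    using tl unfolding tail_def by simp_all
  obtain \<eta>0 where \<eta>0: "\<eta>0 > 0" "\<forall>s\<in>{0<..<e}. s < \<eta>0 \<longrightarrow> \<theta> s < 0" using lim[of 0] by auto
  \<comment> \<open>Halving the minimum makes all bounds strict: the leaves up to height
    \<open>\<epsilon>\<close> have negative level, and the other side is clear of the lower half
    beyond height \<open>\<epsilon>\<close>.\<close>
  define \<epsilon> where "\<epsilon> = min e (min \<eta>0 \<eta>) / 2"
  have \<epsilon>: "0 < \<epsilon>" "\<epsilon> < e" "\<epsilon> < \<eta>0" "\<epsilon> < \<eta>" using e(1) \<eta>0(1) \<eta>(1) by (auto simp: \<epsilon>_def)
  define \<delta> where "\<delta> = \<theta> \<epsilon>"
  have \<delta>: "-1 < \<delta>" "\<delta> < 0" using \<epsilon> \<eta>0(2) th[of \<epsilon>] by (auto simp: \<delta>_def)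
  \<comment> \<open>The level function, extended to the core by its limit \<open>-1\<close>; the
    inverse \<open>\<mu>\<close> turns levels of the strip into heights in the collar.\<close>
  define \<nu> where "\<nu> s = (if s = 0 then -1 else \<theta> s)" for s
  have \<nu>0: "\<nu> 0 = -1" and \<nu>s: "s \<noteq> 0 \<Longrightarrow> \<nu> s = \<theta> s" for s by (simp_all add: \<nu>_def)
  have c\<nu>: "continuous_on {0..\<epsilon>} \<nu>"
  proof (rule continuous_on_insert_endpoint)
    have "continuous_on {0<..\<epsilon>} \<theta>" by (rule continuous_on_subset[OF c\<theta>]) (use \<epsilon> in auto)
    then show "continuous_on {0<..\<epsilon>} \<nu>"
      by (rule continuous_on_eq) (auto simp: \<nu>_def)
    fix y assume "\<nu> 0 < y"
    then obtain d where d: "d > 0" "\<forall>s\<in>{0<..<e}. s < d \<longrightarrow> \<theta> s < y" using lim[of y] \<nu>0 by auto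
    have "\<nu> 0 \<le> \<nu> x \<and> \<nu> x < y" if "x \<in> {0<..\<epsilon>}" "x - 0 < d" for x
      using that d(2) th[of x] \<epsilon> by (auto simp: \<nu>_def)
    then show "\<exists>d>0. \<forall>x\<in>{0<..\<epsilon>}. x - 0 < d \<longrightarrow> \<nu> 0 \<le> \<nu> x \<and> \<nu> x < y" using d(1) by blast
  qed
  have sm\<nu>: "\<nu> s < \<nu> t" if st: "0 \<le> s" "s < t" "t \<le> \<epsilon>" for s t
  proof (cases "s = 0")
    case True then show ?thesis using th[of t] st \<epsilon> by (auto simp: \<nu>_def)
  next
    case False
    then have "\<theta> s < \<theta> t" using st \<epsilon> by (intro strict_mono_onD[OF sm]) auto
    then show ?thesis using False st by (simp add: \<nu>_def)
  qed
  have inj\<nu>: "inj_on \<nu> {0..\<epsilon>}"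
    by (rule linorder_inj_onI) (use sm\<nu> in force)+
  define \<mu> where "\<mu> = inv_into {0..\<epsilon>} \<nu>"
  have \<mu>\<nu>: "\<mu> (\<nu> s) = s" if "s \<in> {0..\<epsilon>}" for s unfolding \<mu>_def using inj\<nu> that by (rule inv_into_f_f)
  have im\<nu>: "\<nu> ` {0..\<epsilon>} = {-1..\<delta>}"
  proof
    show "\<nu> ` {0..\<epsilon>} \<subseteq> {-1..\<delta>}"
    proof clarify
      fix s assume s: "s \<in> {0..\<epsilon>}"
      have "-1 \<le> \<nu> s" using sm\<nu>[of 0 s] \<nu>0 s by (cases "s = 0") auto
      moreover have "\<nu> s \<le> \<nu> \<epsilon>" using sm\<nu>[of s \<epsilon>] s by (cases "s = \<epsilon>") auto
      ultimately show "\<nu> s \<in> {-1..\<delta>}" using \<epsilon>(1) by (simp add: \<nu>_def \<delta>_def split: if_splits)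
    qed
    show "{-1..\<delta>} \<subseteq> \<nu> ` {0..\<epsilon>}"
    proof
      fix y assume y: "y \<in> {-1..\<delta>}"
      have "\<nu> \<epsilon> = \<delta>" using \<epsilon>(1) by (simp add: \<nu>_def \<delta>_def)
      then show "y \<in> \<nu> ` {0..\<epsilon>}" using IVT'[of \<nu> 0 y \<epsilon>] y \<nu>0 \<epsilon>(1) c\<nu> by auto
    qed
  qed
  have c\<mu>: "continuous_on {-1..\<delta>} \<mu>"
    using continuous_on_inv[OF c\<nu> compact_Icc, of \<mu>] \<mu>\<nu> im\<nu> by simp
  have \<nu>\<mu>: "\<nu> (\<mu> t) = t" "0 \<le> \<mu> t" "\<mu> t < \<epsilon>" if t: "t \<in> {-1..<\<delta>}" for t
  proof -
    have tm: "t \<in> \<nu> ` {0..\<epsilon>}" using im\<nu> t by auto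
    then obtain s where s: "s \<in> {0..\<epsilon>}" "t = \<nu> s" by blast
    moreover have "\<nu> \<epsilon> = \<delta>" using \<epsilon>(1) by (simp add: \<nu>_def \<delta>_def)
    ultimately have "s \<noteq> \<epsilon>" using t by auto
    then show "\<nu> (\<mu> t) = t" "0 \<le> \<mu> t" "\<mu> t < \<epsilon>" using \<mu>\<nu>[OF s(1)] s by auto
  qed
  have \<mu>m1: "\<mu> (-1) = 0" using \<mu>\<nu>[of 0] \<nu>0 \<epsilon>(1) by simp
  have \<mu>J: "\<sigma> * \<mu> t \<in> J" if "t \<in> {-1..<\<delta>}" for t using sJ \<nu>\<mu>[OF that] \<epsilon>(2) by auto
  define \<psi> :: "real \<times> real \<Rightarrow> 'a" where "\<psi> = \<gamma> \<circ> (\<lambda>z. (fst z, \<sigma> * \<mu> (snd z)))"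
  let ?D = "UNIV \<times> {-1..<\<delta>} :: (real \<times> real) set"
  define N where "N = \<psi> ` ?D"
  have ct: "continuous_map (top_of_set ?D) X \<psi>"
    unfolding \<psi>_def
  proof (rule continuous_map_compose[OF _ collarD(1)[OF c]])
    show "continuous_map (top_of_set ?D) (top_of_set (UNIV \<times> J)) (\<lambda>z. (fst z, \<sigma> * \<mu> (snd z)))"
      using \<mu>J unfolding continuous_map_in_subtopology
      by (auto intro!: continuous_intros continuous_on_compose2[OF c\<mu>])
  qed
  have lf: "\<psi> ` (UNIV \<times> {t}) = leaf t" if t: "-1 < t" "t < \<delta>" for t
  proof -
    have t': "t \<in> {-1..<\<delta>}" using t by auto
    have "\<mu> t \<noteq> 0" using \<nu>\<mu>(1)[OF t'] \<nu>0 t by auto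
    then have "\<mu> t \<in> {0<..<e}" "\<theta> (\<mu> t) = t" using \<nu>\<mu>[OF t'] \<nu>s \<epsilon>(2) by auto
    then have "\<gamma> ` (UNIV \<times> {\<sigma> * \<mu> t}) = leaf t" using th by metis
    moreover have "\<psi> ` (UNIV \<times> {t}) = \<gamma> ` (UNIV \<times> {\<sigma> * \<mu> t})" unfolding \<psi>_def by force
    ultimately show ?thesis by simp
  qed
  have Lim: "\<psi> ` (UNIV \<times> {-1}) = L" unfolding \<psi>_def L0[symmetric] using \<mu>m1 by force
  have inj: "inj_on \<psi> ?D"
    unfolding \<psi>_def
  proof (rule comp_inj_on)
    show "inj_on (\<lambda>z. (fst z, \<sigma> * \<mu> (snd z))) ?D"
    proof (rule inj_onI, clarify)
      fix x t y s assume *: "t \<in> {-1..<\<delta>}" "s \<in> {-1..<\<delta>}"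
        "fst (x,t) = fst (y,s)" "\<sigma> * \<mu> (snd (x,t)) = \<sigma> * \<mu> (snd (y,s))"
      then have "\<mu> t = \<mu> s" using \<sigma> by auto
      then show "x = y \<and> t = s" using * \<nu>\<mu>(1) by (metis fst_conv)
    qed
    show "inj_on \<gamma> ((\<lambda>z. (fst z, \<sigma> * \<mu> (snd z))) ` ?D)"
      by (rule inj_on_subset[OF collarD(2)[OF c]]) (use \<mu>J in auto)
  qed
  have QmD: "leaf t \<subseteq> lower_half" if "-1 < t" "t < \<delta>" for t
    using that \<delta> unfolding leaf_def lower_half_def by (intro image_mono) auto
  have LsubZ: "L \<subseteq> Z"
  proof
    fix y assume "y \<in> L"
    then obtain x where y: "y = \<psi> (x, -1)" using Lim by blast
    show "y \<in> Z"
      unfolding Z_def in_closure_of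
    proof (intro conjI allI impI)
      show "y \<in> topspace X" using \<open>y \<in> L\<close> leaf_subset[OF LD] by blast
      fix V assume V: "y \<in> V \<and> openin X V"
      then have "openin (top_of_set ?D) {z \<in> ?D. \<psi> z \<in> V}"
        using openin_continuous_map_preimage[OF ct, of V] by simp
      then obtain G where G: "open G" "{z \<in> ?D. \<psi> z \<in> V} = ?D \<inter> G" unfolding openin_open by blast
      have "(x,-1) \<in> {z \<in> ?D. \<psi> z \<in> V}" using V y \<delta> by auto
      then have "(x,-1) \<in> G" using G(2) by blast
      then obtain A B where AB: "open A" "open B" "(x, -1) \<in> A \<times> B" "A \<times> B \<subseteq> G"
        using open_prod_elim[OF G(1)] by metis
      then obtain d where d: "d > 0" "\<And>t. \<bar>t - (-1)\<bar> < d \<Longrightarrow> t \<in> B" using open_nbhd_real by (metis mem_Sigma_iff)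
      define t where "t = -1 + min d (\<delta> + 1) / 2"
      have t: "-1 < t" "t < \<delta>" "t \<in> B" using d \<delta> by (auto simp: t_def min_def field_simps intro!: d(2))
      then have "(x,t) \<in> ?D \<inter> G" using AB by auto
      then have "\<psi> (x,t) \<in> V" using G(2) by blast
      moreover have "\<psi> (x,t) \<in> lower_half" using lf[OF t(1,2)] QmD[OF t(1,2)] by blast
      ultimately show "\<exists>y. y \<in> lower_half \<and> y \<in> V" by blast
    qed
  qed
  \<comment> \<open>Inside \<open>Z\<close> the clear side of the collar disappears, so the image of
    \<open>\<psi>\<close> is the trace on \<open>Z\<close> of a set that is open in
    \<open>X\<close>.\<close>
  have Neq: "N = Z \<inter> \<gamma> ` (UNIV \<times> (J \<inter> {-\<epsilon><..<\<epsilon>}))"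
  proof
    show "N \<subseteq> Z \<inter> \<gamma> ` (UNIV \<times> (J \<inter> {-\<epsilon><..<\<epsilon>}))"
    proof
      fix y assume "y \<in> N"
      then obtain x t where xt: "t \<in> {-1..<\<delta>}" "y = \<psi> (x,t)" by (auto simp: N_def)
      have "y \<in> Z"
      proof (cases "t = -1")
        case True then show ?thesis using xt Lim LsubZ by blast
      next
        case False
        then have t: "-1 < t" "t < \<delta>" using xt by auto
        then show ?thesis using lf[OF t] QmD[OF t] Z_subset(2) xt by blast
      qed
      moreover have "\<sigma> * \<mu> t \<in> J \<inter> {-\<epsilon><..<\<epsilon>}" using \<mu>J[OF xt(1)] \<nu>\<mu>[OF xt(1)] \<sigma> by auto
      ultimately show "y \<in> Z \<inter> \<gamma> ` (UNIV \<times> (J \<inter> {-\<epsilon><..<\<epsilon>}))" using xt(2) by (auto simp: \<psi>_def)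
    qed
    show "Z \<inter> \<gamma> ` (UNIV \<times> (J \<inter> {-\<epsilon><..<\<epsilon>})) \<subseteq> N"
    proof
      fix y assume y: "y \<in> Z \<inter> \<gamma> ` (UNIV \<times> (J \<inter> {-\<epsilon><..<\<epsilon>}))"
      then obtain x r where r: "r \<in> J" "-\<epsilon> < r" "r < \<epsilon>" "y = \<gamma> (x,r)" by auto
      have "0 \<le> \<sigma> * r"
      proof (rule ccontr)
        assume neg: "\<not> 0 \<le> \<sigma> * r"
        \<comment> \<open>The side opposite to \<open>\<sigma>\<close>: open in \<open>X\<close> and
          clear of the lower half, hence disjoint from the closure.\<close>
        define I where "I = (if \<sigma> = 1 then {-\<epsilon><..<0} else {0<..<\<epsilon>})"
        have "openin X (\<gamma> ` (UNIV \<times> (J \<inter> I)))" by (rule collar_open_image[OF c]) (simp add: I_def)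
        moreover have "\<gamma> ` (UNIV \<times> (J \<inter> I)) \<inter> lower_half = {}"
        proof -
          have "\<gamma> (x,t) \<notin> lower_half" if t: "t \<in> J" "t \<in> I" for x t
          proof -
            have "- \<sigma> * t \<in> {0<..<\<eta>}" "- \<sigma> * (- \<sigma> * t) = t"
              using t(2) \<sigma> \<epsilon>(4) by (auto simp: I_def split: if_splits)
            then have "\<gamma> ` (UNIV \<times> {t}) \<inter> lower_half = {}" using \<eta>(2)[of "- \<sigma> * t"] t(1) by metis
            then show ?thesis by blast
          qed
          then show ?thesis by auto
        qed
        ultimately have "\<gamma> ` (UNIV \<times> (J \<inter> I)) \<inter> Z = {}" by (rule open_disjoint_Z)
        moreover have "r \<in> I" using neg \<sigma> r by (auto simp: I_def)
        ultimately show False using y r by blast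
      qed
      then have s: "\<sigma> * r \<in> {0..<\<epsilon>}" using \<sigma> r by auto
      define t where "t = \<nu> (\<sigma> * r)"
      have "\<mu> t = \<sigma> * r" unfolding t_def using s by (intro \<mu>\<nu>) auto
      moreover have "t \<in> {-1..<\<delta>}"
      proof -
        have "t < \<nu> \<epsilon>" unfolding t_def using s by (intro sm\<nu>) auto
        moreover have "\<nu> \<epsilon> = \<delta>" using \<epsilon>(1) by (simp add: \<nu>_def \<delta>_def)
        moreover have "t \<in> {-1..\<delta>}" unfolding t_def im\<nu>[symmetric] using s by auto
        ultimately show ?thesis by auto
      qed
      moreover have "\<sigma> * (\<sigma> * r) = r" using \<sigma> by auto
      ultimately have "y = \<psi> (x,t)" using r(4) by (simp only: \<psi>_def o_def fst_conv snd_conv)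
      then show "y \<in> N" using \<open>t \<in> {-1..<\<delta>}\<close> by (auto simp: N_def)
    qed
  qed
  have No: "openin XZ N"
    unfolding Neq by (intro openin_subtopology_Int2 collar_open_image[OF c]) simp
  have op: "open_map (top_of_set ?D) XZ \<psi>"
  proof -
    have "homeomorphic_map (top_of_set (UNIV \<times> J)) (subtopology X U) \<gamma>"
      using c by (simp add: collar_def)
    then obtain k where k: "homeomorphic_maps (top_of_set (UNIV \<times> J)) (subtopology X U) \<gamma> k"
      using homeomorphic_map_maps by metis
    have kc: "k (\<gamma> z) = z" if "z \<in> UNIV \<times> J" for z using k that by (cases z) (simp add: homeomorphic_maps_def)
    have kcont: "continuous_map (subtopology X U) euclidean k"
      using k by (simp add: homeomorphic_maps_def continuous_map_in_subtopology)
    have NU: "N \<subseteq> U" using Neq collarD(3)[OF c] by blast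
    define \<kappa> where "\<kappa> y = (fst (k y), \<nu> (\<sigma> * snd (k y)))" for y
    have k\<psi>: "k (\<psi> (x,t)) = (x, \<sigma> * \<mu> t)" if "t \<in> {-1..<\<delta>}" for x t
      unfolding \<psi>_def using kc \<mu>J[OF that] by simp
    have \<kappa>\<psi>: "\<kappa> (\<psi> z) = z" if z: "z \<in> ?D" for z
    proof -
      obtain x t where xt: "z = (x,t)" "t \<in> {-1..<\<delta>}" using z by auto
      have "\<sigma> * (\<sigma> * \<mu> t) = \<mu> t" using \<sigma> by auto
      then show ?thesis by (simp only: \<kappa>_def xt(1) k\<psi>[OF xt(2)] \<nu>\<mu>(1)[OF xt(2)] fst_conv snd_conv)
    qed
    have c1: "continuous_map (subtopology X N) euclidean k"
      using kcont NU by (rule continuous_map_from_subtopology_mono)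
    have c2: "continuous_map (subtopology X N) (top_of_set {0..\<epsilon>}) (\<lambda>y. \<sigma> * snd (k y))"
    proof -
      have "\<sigma> * snd (k y) \<in> {0..\<epsilon>}" if "y \<in> N" for y
      proof -
        obtain x t where xt: "y = \<psi> (x,t)" "t \<in> {-1..<\<delta>}" using \<open>y \<in> N\<close> by (auto simp: N_def)
        then have "\<sigma> * snd (k y) = \<mu> t" using k\<psi> \<sigma> by auto
        then show ?thesis using \<nu>\<mu>[OF xt(2)] by auto
      qed
      moreover have "continuous_map (subtopology X N) euclideanreal (\<lambda>y. \<sigma> * snd (k y))"
        using continuous_map_snd_of[of _ euclideanreal euclideanreal] c1
        by (intro continuous_map_real_mult) (auto simp: o_def)
      ultimately show ?thesis by (auto simp: continuous_map_in_subtopology)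
    qed
    have "continuous_map (subtopology X N) euclideanreal (\<nu> \<circ> (\<lambda>y. \<sigma> * snd (k y)))"
      by (rule continuous_map_compose[OF c2]) (use c\<nu> in simp)
    moreover have "continuous_map (subtopology X N) euclideanreal (fst \<circ> k)"
      using continuous_map_fst_of[of _ euclideanreal euclideanreal k] c1 by simp
    ultimately have "continuous_map (subtopology X N) (prod_topology euclideanreal euclideanreal) \<kappa>"
      unfolding \<kappa>_def continuous_map_pairwise by (simp add: o_def)
    moreover have "\<kappa> y \<in> ?D" if "y \<in> N" for y using that \<kappa>\<psi> unfolding N_def by auto
    ultimately have c\<kappa>: "continuous_map (subtopology X N) (top_of_set ?D) \<kappa>"
      by (auto simp: continuous_map_in_subtopology)
    have "homeomorphic_maps (top_of_set ?D) (subtopology X N) \<psi> \<kappa>"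
      unfolding homeomorphic_maps_def
    proof (intro conjI)
      show "continuous_map (top_of_set ?D) (subtopology X N) \<psi>"
        using ct by (auto simp: continuous_map_in_subtopology N_def)
      show "\<forall>x\<in>topspace (top_of_set ?D). \<kappa> (\<psi> x) = x" using \<kappa>\<psi> by simp
      show "\<forall>y\<in>topspace (subtopology X N). \<psi> (\<kappa> y) = y" using \<kappa>\<psi> by (auto simp: N_def)
    qed (rule c\<kappa>)
    then have "open_map (top_of_set ?D) (subtopology X N) \<psi>"
      using homeomorphic_maps_imp_map homeomorphic_imp_open_map by blast
    moreover have "subtopology X N = subtopology XZ N"
      using Neq by (simp add: subtopology_subtopology Int_absorb1)
    ultimately show ?thesis using open_map_from_open_subtopology[OF No] by simp
  qed
  show ?thesis using end_chart_orient[OF \<delta> ct inj op Lim lf] by blast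
qed

end

section \<open>Decomposition of the closure and assembly of a model strip\<close>

context strip_region begin

definition "end_level L = (SOME \<delta>. \<exists>\<psi>. end_chart L \<delta> \<psi>)"
definition "end_param L = (SOME \<psi>. end_chart L (end_level L) \<psi>)"

lemma end_chart_end_param: "L \<in> end_leaves \<Longrightarrow> end_chart L (end_level L) (end_param L)"
  unfolding end_param_def end_level_def by (metis (mono_tags, lifting) end_chart_exists someI_ex)

lemma
  assumes "L \<in> end_leaves"
  shows end_level_bounds: "-1 < end_level L" "end_level L < 0"
    and end_param_cont: "continuous_map (top_of_set (UNIV \<times> {-1..<end_level L})) X (end_param L)"
    and end_param_inj: "inj_on (end_param L) (UNIV \<times> {-1..<end_level L})"
    and end_param_open: "open_map (top_of_set (UNIV \<times> {-1..<end_level L})) XZ (end_param L)"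
    and end_param_end: "end_param L ` (UNIV \<times> {-1}) = L"
    and end_param_leaf: "\<And>t. -1 < t \<Longrightarrow> t < end_level L \<Longrightarrow> end_param L ` (UNIV \<times> {t}) = leaf t"
    and end_param_mono: "\<And>t. -1 < t \<Longrightarrow> t < end_level L \<Longrightarrow> strict_mono (\<lambda>x. fst (inv_phi (end_param L (x, t))))"
  using end_chart_end_param[OF assms] unfolding end_chart_def by blast+

lemma leaf_subset_lower_half: "-1 < t \<Longrightarrow> t \<le> 0 \<Longrightarrow> leaf t \<subseteq> lower_half"
  unfolding leaf_def lower_half_def by (intro image_mono) auto

lemma end_param_mem:
  assumes "L \<in> end_leaves" "-1 < t" "t < end_level L"
  shows "end_param L (x, t) \<in> leaf t" "end_param L (x, t) \<in> lower_half" "end_param L (x,t) \<in> Q" "snd (inv_phi (end_param L (x, t))) = t"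
    "\<phi> (fst (inv_phi (end_param L (x, t))), t) = end_param L (x, t)"
proof -
  have t: "t < 1" "t \<le> 0" using assms end_level_bounds(2)[OF assms(1)] by auto
  show m: "end_param L (x, t) \<in> leaf t" using end_param_leaf[OF assms] by blast
  then show "end_param L (x, t) \<in> lower_half" using leaf_subset_lower_half[OF assms(2) t(2)] by blast
  then show q: "end_param L (x, t) \<in> Q" using lower_half_subset by blast
  show s: "snd (inv_phi (end_param L (x, t))) = t" using inv_phi_leaf[OF assms(2) t(1) m] .
  show "\<phi> (fst (inv_phi (end_param L (x, t))), t) = end_param L (x, t)" using inv_phi(2)[OF q] s by (metis prod.collapse)
qed

lemma end_param_end_mem: "L \<in> end_leaves \<Longrightarrow> end_param L (x, -1) \<in> L"
  using end_param_end by blast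

lemma end_leaves_not_Q: "L \<in> end_leaves \<Longrightarrow> y \<in> L \<Longrightarrow> y \<notin> Q"
  by (auto simp: end_leaves_def)

lemma end_leaves_subset_Z:
  assumes "L \<in> end_leaves" shows "L \<subseteq> Z"
proof -
  have "end_param L ` (UNIV \<times> {-1..<end_level L}) \<subseteq> Z"
    using open_map_imp_subset_topspace[OF end_param_open[OF assms]] Z_subset(3) by auto
  moreover have "end_param L ` (UNIV \<times> {-1}) \<subseteq> end_param L ` (UNIV \<times> {-1..<end_level L})"
    using end_level_bounds(1)[OF assms] by (intro image_mono) auto
  ultimately show ?thesis using end_param_end[OF assms] by simp
qed

lemma Z_decomp: "Z = lower_half \<union> \<Union>end_leaves"
proof
  show "Z \<subseteq> lower_half \<union> \<Union>end_leaves"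
  proof
    fix y assume y: "y \<in> Z"
    show "y \<in> lower_half \<union> \<Union>end_leaves"
    proof (cases "y \<in> Q")
      case True then show ?thesis using y Z_Int_Q by blast
    next
      case False
      have "y \<in> topspace X" using y Z_subset(1) by blast
      then have l: "leaf_of \<Delta> y \<in> \<Delta>" "y \<in> leaf_of \<Delta> y" using leaf_of_in by auto
      then have "leaf_of \<Delta> y \<inter> Q = {}" using leaf_in_Q False by blast
      then have "leaf_of \<Delta> y \<in> end_leaves" using l y by (auto simp: end_leaves_def)
      then show ?thesis using l by blast
    qed
  qed
  show "lower_half \<union> \<Union>end_leaves \<subseteq> Z" using Z_subset(2) end_leaves_subset_Z by blast
qed

lemma leaves_in_Z: "restr_fol \<Delta> Z = leaf ` {-1<..0} \<union> end_leaves"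
proof
  show "restr_fol \<Delta> Z \<subseteq> leaf ` {-1<..0} \<union> end_leaves"
  proof
    fix L assume "L \<in> restr_fol \<Delta> Z"
    then have L: "L \<in> \<Delta>" "L \<subseteq> Z" by (auto simp: restr_fol_def)
    obtain y where y: "y \<in> L" using leaf_nonempty[OF L(1)] by blast
    show "L \<in> leaf ` {-1<..0} \<union> end_leaves"
    proof (cases "L \<inter> Q = {}")
      case True then show ?thesis using L y by (auto simp: end_leaves_def)
    next
      case False
      then have LQ: "L \<subseteq> Q" using leaf_in_Q L by blast
      have "y \<in> lower_half" using y LQ L(2) Z_Int_Q by blast
      then obtain x t where xt: "y = \<phi> (x,t)" "-1 < t" "t \<le> 0" by (auto simp: lower_half_def)
      then have "snd (inv_phi y) = t" using inv_phi(1)[of "(x,t)"] strip_iff by simp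
      then have "L = leaf t" using leaf_of_snd(1)[OF L(1) LQ y] by simp
      then show ?thesis using xt by auto
    qed
  qed
  show "leaf ` {-1<..0} \<union> end_leaves \<subseteq> restr_fol \<Delta> Z"
  proof
    fix L assume "L \<in> leaf ` {-1<..0} \<union> end_leaves"
    then show "L \<in> restr_fol \<Delta> Z"
    proof
      assume "L \<in> leaf ` {-1<..0}"
      then obtain t where t: "-1 < t" "t \<le> 0" "L = leaf t" by auto
      then show ?thesis using leaf_in(2)[of t] leaf_subset_lower_half[of t] Z_subset(2) by (auto simp: restr_fol_def)
    next
      assume "L \<in> end_leaves" then show ?thesis using end_leaves_subset_Z by (auto simp: restr_fol_def end_leaves_def)
    qed
  qed
qed

text \<open>\<open>\<phi>\<close> is open into \<open>X\<close> on the whole strip, and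
  \<open>Z\<close> cuts out of the strip exactly the part up to level 0. So sets containing points
  of level 0 need only be open relative to that part.\<close>

lemma phi_open_Z:
  assumes "openin (top_of_set (UNIV \<times> {-1<..0})) W" shows "openin XZ (\<phi> ` W)"
proof -
  obtain G where G: "open G" "W = (UNIV \<times> {-1<..0}) \<inter> G" using assms unfolding openin_open by blast
  have os: "open open_strip" by (simp add: open_strip_def open_Times)
  have "openin X (\<phi> ` (open_strip \<inter> G))" using G os by (intro phi_open) auto
  moreover have "\<phi> ` W = Z \<inter> \<phi> ` (open_strip \<inter> G)"
  proof
    show "\<phi> ` W \<subseteq> Z \<inter> \<phi> ` (open_strip \<inter> G)"
      using G(2) Z_subset(2) unfolding lower_half_def by (force simp: open_strip_def)
    show "Z \<inter> \<phi> ` (open_strip \<inter> G) \<subseteq> \<phi> ` W"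
    proof
      fix y assume y: "y \<in> Z \<inter> \<phi> ` (open_strip \<inter> G)"
      then obtain z where z: "z \<in> open_strip" "z \<in> G" "y = \<phi> z" by blast
      then have "y \<in> lower_half" using y Z_Int_Q phi_image by blast
      then obtain w where w: "w \<in> UNIV \<times> {-1<..0}" "y = \<phi> w" by (auto simp: lower_half_def)
      then have "w \<in> open_strip" by (auto simp: open_strip_def)
      then have "w = z" using inj_onD[OF phi_inj] z w by blast
      then show "y \<in> \<phi> ` W" using w z G(2) by blast
    qed
  qed
  ultimately show ?thesis using openin_subtopology_Int2 by metis
qed

text \<open>Reduces the straightening to a single function \<open>U\<close>, which together with the
  level gives the map \<open>\<Phi>\<close>. The lower half and the end charts form an open cover of
  \<open>Z\<close>, so continuity and openness may be checked in these coordinates, where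
  \<open>\<Phi>\<close> is a shear. The bound \<open>d\<close> leaves room for functions that are
  under control only close to the end leaves.\<close>

lemma assemble:
  fixes U :: "'a \<Rightarrow> real"
  assumes d: "\<And>L. L \<in> end_leaves \<Longrightarrow> -1 < d L \<and> d L \<le> end_level L"
    and U1: "continuous_on (UNIV \<times> {-1<..0}) (\<lambda>z. U (\<phi> z))"
      "\<And>t. t \<in> {-1<..0} \<Longrightarrow> strict_mono (\<lambda>x. U (\<phi> (x, t)))"
      "\<And>t. t \<in> {-1<..0} \<Longrightarrow> surj (\<lambda>x. U (\<phi> (x, t)))"
    and U2: "\<And>L. L \<in> end_leaves \<Longrightarrow> continuous_on (UNIV \<times> {-1..<d L}) (\<lambda>z. U (end_param L z))"
      "\<And>L t. L \<in> end_leaves \<Longrightarrow> t \<in> {-1..<d L} \<Longrightarrow> strict_mono (\<lambda>x. U (end_param L (x, t)))"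
    and U3: "inj_on U (\<Union>end_leaves)"
  shows "\<exists>S a b F. model_strip S a b F \<and>
    foliated_homeomorphic XZ (restr_fol \<Delta> Z) (top_of_set S) (canonical_fol a b F)"
proof -
  \<comment> \<open>Points of \<open>Z\<close> outside \<open>Q\<close> lie on end leaves and get
    the level \<open>-1\<close>.\<close>
  define T where "T z = (if z \<in> Q then snd (inv_phi z) else -1)" for z
  define \<Phi> where "\<Phi> z = (U z, T z)" for z
  let ?A = "(UNIV :: real set) \<times> {-1<..0::real}" and ?B = "(UNIV :: real set) \<times> {-1..0::real}"
  let ?D = "\<lambda>L. (UNIV :: real set) \<times> {-1..<d L}"
  have \<Phi>\<phi>: "\<Phi> (\<phi> z) = (U (\<phi> z), snd z)" if "z \<in> ?A" for z
  proof -
    have "z \<in> open_strip" using that by (auto simp: open_strip_def)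
    then have "\<phi> z \<in> Q" "inv_phi (\<phi> z) = z" using inv_phi(1) phi_image by auto
    then show ?thesis by (simp add: \<Phi>_def T_def)
  qed
  have \<Phi>end_param: "\<Phi> (end_param L z) = (U (end_param L z), snd z)" if L: "L \<in> end_leaves" and z: "z \<in> ?D L" for L z
  proof -
    obtain x t where xt: "z = (x,t)" "-1 \<le> t" "t < end_level L" using z d[OF L] by force
    show ?thesis
    proof (cases "t = -1")
      case True
      then have "end_param L z \<notin> Q" using end_leaves_not_Q[OF L] end_param_end_mem[OF L] xt by auto
      then show ?thesis using xt True by (simp add: \<Phi>_def T_def)
    next
      case False
      then show ?thesis using end_param_mem(3,4)[OF L, of t x] xt by (simp add: \<Phi>_def T_def)
    qed
  qed
  have \<Phi>B: "\<Phi> z \<in> ?B" if z: "z \<in> Z" for z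
  proof (cases "z \<in> Q")
    case True
    then have "z \<in> lower_half" using z Z_Int_Q by blast
    then obtain w where "w \<in> ?A" "z = \<phi> w" by (auto simp: lower_half_def)
    then show ?thesis using \<Phi>\<phi>[of w] by auto
  qed (simp add: \<Phi>_def T_def)
  \<comment> \<open>A subset of \<open>Z\<close> is put together from its traces in the two kinds of
    coordinates; this localises both continuity and openness.\<close>
  have cover: "V = \<phi> ` {w \<in> ?A. \<phi> w \<in> V} \<union> (\<Union>L\<in>end_leaves. end_param L ` {w \<in> ?D L. end_param L w \<in> V})" if V: "V \<subseteq> Z" for V
  proof
    show "V \<subseteq> \<phi> ` {w \<in> ?A. \<phi> w \<in> V} \<union> (\<Union>L\<in>end_leaves. end_param L ` {w \<in> ?D L. end_param L w \<in> V})"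
    proof
      fix y assume y: "y \<in> V"
      then have "y \<in> lower_half \<union> \<Union>end_leaves" using V Z_decomp by blast
      then show "y \<in> \<phi> ` {w \<in> ?A. \<phi> w \<in> V} \<union> (\<Union>L\<in>end_leaves. end_param L ` {w \<in> ?D L. end_param L w \<in> V})"
      proof
        assume "y \<in> lower_half"
        then obtain w where "w \<in> ?A" "y = \<phi> w" by (auto simp: lower_half_def)
        then show ?thesis using y by blast
      next
        assume "y \<in> \<Union>end_leaves"
        then obtain L where L: "L \<in> end_leaves" "y \<in> L" by blast
        then obtain x where x: "y = end_param L (x, -1)" using end_param_end[OF L(1)] by blast
        have "(x,-1) \<in> ?D L" using d[OF L(1)] by auto
        then show ?thesis using L x y by blast
      qed
    qed
  qed auto
  have Dsub: "?D L \<subseteq> UNIV \<times> {-1..<end_level L}" if "L \<in> end_leaves" for L using d[OF that] by auto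
  have end_param_open_D: "openin XZ (end_param L ` W)" if L: "L \<in> end_leaves" and W: "openin (top_of_set (?D L)) W" for L W
  proof -
    have "?D L = (UNIV \<times> {-1..<end_level L}) \<inter> (UNIV \<times> {..<d L})" using d[OF L] by auto
    then have "openin (top_of_set (UNIV \<times> {-1..<end_level L})) (?D L)"
      by (metis open_Times open_UNIV open_lessThan openin_open_Int)
    with W have "openin (top_of_set (UNIV \<times> {-1..<end_level L})) W" by (rule openin_trans)
    then show ?thesis using end_param_open[OF L] by (simp add: open_map_def)
  qed
  have c1: "continuous_on ?A (\<lambda>w. \<Phi> (\<phi> w))"
  proof -
    have "continuous_on ?A (\<lambda>w. (U (\<phi> w), snd w))" using U1(1) by (intro continuous_intros)
    then show ?thesis by (rule continuous_on_eq) (use \<Phi>\<phi> in simp)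
  qed
  have c2: "continuous_on (?D L) (\<lambda>w. \<Phi> (end_param L w))" if L: "L \<in> end_leaves" for L
  proof -
    have "continuous_on (?D L) (\<lambda>w. (U (end_param L w), snd w))" using U2(1)[OF L] by (intro continuous_intros)
    then show ?thesis by (rule continuous_on_eq) (use \<Phi>end_param[OF L] in simp)
  qed
  have "continuous_map XZ euclidean \<Phi>"
    unfolding continuous_map_def
  proof (intro conjI allI impI)
    fix O' :: "(real \<times> real) set" assume "openin euclidean O'"
    then have O': "open O'" by simp
    let ?V = "{z \<in> topspace XZ. \<Phi> z \<in> O'}"
    have VZ: "?V \<subseteq> Z" using Z_subset(3) by blast
    have mem: "\<phi> w \<in> ?V \<longleftrightarrow> \<Phi> (\<phi> w) \<in> O'" if "w \<in> ?A" for w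
      using that Z_subset(2,3) by (auto simp: lower_half_def)
    have mem2: "end_param L w \<in> ?V \<longleftrightarrow> \<Phi> (end_param L w) \<in> O'" if "L \<in> end_leaves" "w \<in> ?D L" for L w
      using open_map_imp_subset_topspace[OF end_param_open[OF that(1)]] that(2) Dsub[OF that(1)] by fastforce
    have "openin XZ (\<phi> ` {w \<in> ?A. \<phi> w \<in> ?V})"
    proof (rule phi_open_Z)
      have "{w \<in> ?A. \<phi> w \<in> ?V} = ?A \<inter> (\<lambda>w. \<Phi> (\<phi> w)) -` O'" using mem by blast
      then show "openin (top_of_set ?A) {w \<in> ?A. \<phi> w \<in> ?V}"
        using continuous_openin_preimage_gen[OF c1 O'] by simp
    qed
    moreover have "openin XZ (end_param L ` {w \<in> ?D L. end_param L w \<in> ?V})" if L: "L \<in> end_leaves" for L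
    proof (rule end_param_open_D[OF L])
      have "{w \<in> ?D L. end_param L w \<in> ?V} = ?D L \<inter> (\<lambda>w. \<Phi> (end_param L w)) -` O'" using mem2[OF L] by blast
      then show "openin (top_of_set (?D L)) {w \<in> ?D L. end_param L w \<in> ?V}"
        using continuous_openin_preimage_gen[OF c2[OF L] O'] by simp
    qed
    ultimately have "openin XZ (\<phi> ` {w \<in> ?A. \<phi> w \<in> ?V} \<union> (\<Union>L\<in>end_leaves. end_param L ` {w \<in> ?D L. end_param L w \<in> ?V}))"
      by blast
    then show "openin XZ ?V" by (simp only: cover[OF VZ, symmetric])
  qed simp
  then have cont: "continuous_map XZ (top_of_set ?B) \<Phi>"
    using \<Phi>B Z_subset(3) by (auto simp: continuous_map_in_subtopology)
  have AB: "openin (top_of_set ?B) ?A"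
  proof -
    have "?A = ?B \<inter> (UNIV \<times> {-1<..})" by auto
    then show ?thesis by (metis open_Times open_UNIV open_greaterThan openin_open_Int)
  qed
  have DB: "openin (top_of_set ?B) (?D L)" if L: "L \<in> end_leaves" for L
  proof -
    have "?D L = ?B \<inter> (UNIV \<times> {..<d L})" using d[OF L] end_level_bounds(2)[OF L] by auto
    then show ?thesis by (metis open_Times open_UNIV open_lessThan openin_open_Int)
  qed
  have opn: "open_map XZ (top_of_set ?B) \<Phi>"
    unfolding open_map_def
  proof (intro allI impI)
    fix V assume V: "openin XZ V"
    then obtain V0 where V0: "openin X V0" "V = V0 \<inter> Z" by (auto simp: openin_subtopology)
    have VZ: "V \<subseteq> Z" using V0 by blast
    let ?W = "{w \<in> ?A. \<phi> w \<in> V}" and ?W' = "\<lambda>L. {w \<in> ?D L. end_param L w \<in> V}"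
    have "openin (top_of_set ?A) ?W"
    proof -
      have "continuous_map (top_of_set ?A) X \<phi>"
        using phi_cont by (rule continuous_map_from_subtopology_mono) (auto simp: open_strip_def)
      from openin_continuous_map_preimage[OF this V0(1)]
      have "openin (top_of_set ?A) {w \<in> ?A. \<phi> w \<in> V0}" by simp
      moreover have "{w \<in> ?A. \<phi> w \<in> V0} = ?W" using V0(2) Z_subset(2) by (auto simp: lower_half_def)
      ultimately show ?thesis by simp
    qed
    from shear_open_image[OF U1(1,2) this]
    have "openin (top_of_set ?A) ((\<lambda>z. (U (\<phi> z), snd z)) ` ?W)" by blast
    moreover have "(\<lambda>z. (U (\<phi> z), snd z)) ` ?W = \<Phi> ` \<phi> ` ?W"
      unfolding image_image using \<Phi>\<phi> by (intro image_cong) auto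
    ultimately have "openin (top_of_set ?A) (\<Phi> ` \<phi> ` ?W)" by (simp only:)
    then have o1: "openin (top_of_set ?B) (\<Phi> ` \<phi> ` ?W)" using AB by (rule openin_trans)
    have o2: "openin (top_of_set ?B) (\<Phi> ` end_param L ` ?W' L)" if L: "L \<in> end_leaves" for L
    proof -
      have "continuous_map (top_of_set (?D L)) X (end_param L)"
        using end_param_cont[OF L] Dsub[OF L] by (rule continuous_map_from_subtopology_mono)
      from openin_continuous_map_preimage[OF this V0(1)]
      have "openin (top_of_set (?D L)) {w \<in> ?D L. end_param L w \<in> V0}" by simp
      moreover have "{w \<in> ?D L. end_param L w \<in> V0} = ?W' L"
        using V0(2) Z_subset(3) open_map_imp_subset_topspace[OF end_param_open[OF L]] Dsub[OF L] by fastforce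
      ultimately have "openin (top_of_set (?D L)) (?W' L)" by simp
      from shear_open_image[OF U2(1)[OF L] U2(2)[OF L] this]
      have "openin (top_of_set (?D L)) ((\<lambda>z. (U (end_param L z), snd z)) ` ?W' L)" by blast
      moreover have "(\<lambda>z. (U (end_param L z), snd z)) ` ?W' L = \<Phi> ` end_param L ` ?W' L"
        unfolding image_image using \<Phi>end_param[OF L] by (intro image_cong) auto
      ultimately have "openin (top_of_set (?D L)) (\<Phi> ` end_param L ` ?W' L)" by (simp only:)
      then show ?thesis using DB[OF L] by (rule openin_trans)
    qed
    have "\<Phi> ` V = \<Phi> ` \<phi> ` ?W \<union> (\<Union>L\<in>end_leaves. \<Phi> ` end_param L ` ?W' L)"
      by (subst cover[OF VZ]) (simp only: image_Un image_UN)
    moreover have "openin (top_of_set ?B) (\<Union>L\<in>end_leaves. \<Phi> ` end_param L ` ?W' L)"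
      by (rule openin_Union) (use o2 in blast)
    ultimately show "openin (top_of_set ?B) (\<Phi> ` V)" using openin_Un[OF o1] by (simp only:)
  qed
  have inj: "inj_on \<Phi> Z"
  proof (rule inj_onI)
    fix y z assume yz: "y \<in> Z" "z \<in> Z" "\<Phi> y = \<Phi> z"
    have T1: "T w > -1 \<longleftrightarrow> w \<in> Q" for w
      using inv_phi(3)[of w] by (cases "inv_phi w") (auto simp: T_def strip_iff)
    show "y = z"
    proof (cases "y \<in> Q")
      case True
      then have "z \<in> Q" using yz(3) T1[of y] T1[of z] by (simp add: \<Phi>_def)
      then have "y \<in> lower_half" "z \<in> lower_half" using True yz Z_Int_Q by blast+
      then obtain x t x' t' where w: "y = \<phi> (x,t)" "z = \<phi> (x',t')" "t \<in> {-1<..0}" "t' \<in> {-1<..0}"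
        by (auto simp: lower_half_def)
      then have "t = t'" "U (\<phi> (x,t)) = U (\<phi> (x',t))" using yz(3) \<Phi>\<phi>[of "(x,t)"] \<Phi>\<phi>[of "(x',t')"] by auto
      then show ?thesis using strict_mono_eq[OF U1(2)[OF w(3)]] w by auto
    next
      case False
      then have "z \<notin> Q" using yz(3) T1[of y] T1[of z] by (simp add: \<Phi>_def)
      then have "y \<in> \<Union>end_leaves" "z \<in> \<Union>end_leaves" using False yz Z_decomp lower_half_subset by blast+
      then show ?thesis using inj_onD[OF U3] yz(3) by (auto simp: \<Phi>_def)
    qed
  qed
  define S where "S = \<Phi> ` Z"
  have hom: "homeomorphic_map XZ (top_of_set S) \<Phi>"
  proof (rule bijective_open_imp_homeomorphic_map)
    show "continuous_map XZ (top_of_set S) \<Phi>"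
      using cont Z_subset(3) by (auto simp: continuous_map_in_subtopology S_def)
    have "S \<subseteq> ?B" unfolding S_def using \<Phi>B by (rule image_subsetI)
    then have "top_of_set S = subtopology (top_of_set ?B) S"
      by (simp add: subtopology_subtopology Int_absorb1)
    moreover have "open_map XZ (subtopology (top_of_set ?B) S) \<Phi>"
      by (rule open_map_into_subtopology[OF opn]) (unfold S_def Z_subset(3), blast)
    ultimately show "open_map XZ (top_of_set S) \<Phi>" by simp
    show "\<Phi> ` topspace XZ = topspace (top_of_set S)" using Z_subset(3) by (simp add: S_def)
    show "inj_on \<Phi> (topspace XZ)" using inj Z_subset(3) by simp
  qed
  have im_leaf: "\<Phi> ` leaf t = UNIV \<times> {t}" if t: "t \<in> {-1<..0}" for t
  proof
    show "\<Phi> ` leaf t \<subseteq> UNIV \<times> {t}"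
      unfolding leaf_def image_image
    proof (rule image_subsetI)
      fix z :: "real \<times> real" assume "z \<in> UNIV \<times> {t}"
      then show "\<Phi> (\<phi> z) \<in> UNIV \<times> {t}" using \<Phi>\<phi>[of z] t by auto
    qed
    show "UNIV \<times> {t} \<subseteq> \<Phi> ` leaf t"
    proof clarify
      fix y :: real
      obtain x where x: "y = U (\<phi> (x,t))" using surjD[OF U1(3)[OF t], of y] by blast
      have "(x,t) \<in> ?A" using t by simp
      then have "(y,t) = \<Phi> (\<phi> (x,t))" using \<Phi>\<phi>[of "(x,t)"] x by simp
      then show "(y,t) \<in> \<Phi> ` leaf t" using leaf_mem by blast
    qed
  qed
  define I where "I L = range (\<lambda>x. U (end_param L (x, -1)))" for L
  have im_end_leaves: "\<Phi> ` L = I L \<times> {-1}" if L: "L \<in> end_leaves" for L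
  proof -
    have "(x,-1) \<in> ?D L" for x using d[OF L] by auto
    then have "\<Phi> (end_param L (x,-1)) = (U (end_param L (x,-1)), -1)" for x using \<Phi>end_param[OF L] by fastforce
    then have "\<Phi> ` end_param L ` (UNIV \<times> {-1}) = I L \<times> {-1}" by (force simp: I_def image_iff)
    then show ?thesis by (simp add: end_param_end[OF L])
  qed
  have I_int: "open_interval_real (I L)" if L: "L \<in> end_leaves" for L
  proof -
    have m1: "-1 \<in> {-1..<d L}" using d[OF L] by auto
    have cL: "continuous_on UNIV (\<lambda>x. U (end_param L (x,-1)))"
      by (rule continuous_on_compose2[OF U2(1)[OF L]]) (use d[OF L] in \<open>auto intro!: continuous_intros\<close>)
    have "inj (\<lambda>x. U (end_param L (x,-1)))" using strict_mono_imp_inj_on[OF U2(2)[OF L m1]] .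
    then have "open (I L)" unfolding I_def by (intro invariance_of_domain cL) auto
    moreover have "connected (I L)" unfolding I_def by (intro connected_continuous_image cL) auto
    ultimately show ?thesis by (auto simp: open_interval_real_def is_interval_connected_1 I_def)
  qed
  \<comment> \<open>The leaf of level 0 belongs to the half and becomes the full upper edge of the
    model strip.\<close>
  define F where "F = (\<lambda>L. \<Phi> ` L) ` end_leaves \<union> {UNIV \<times> {0}}"
  have SU: "S = (\<Union>t\<in>{-1<..0}. UNIV \<times> {t}) \<union> (\<Union>L\<in>end_leaves. I L \<times> {-1})"
  proof -
    have "lower_half = (\<Union>t\<in>{-1<..0}. leaf t)" by (auto simp: lower_half_def leaf_def)
    then have "S = (\<Union>t\<in>{-1<..0}. \<Phi> ` leaf t) \<union> (\<Union>L\<in>end_leaves. \<Phi> ` L)"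
      unfolding S_def Z_decomp image_Un by (simp add: image_UN image_Union)
    then show ?thesis using im_leaf im_end_leaves by simp
  qed
  have "model_strip S (-1) 0 F"
    unfolding model_strip_def
  proof (intro conjI)
    show "UNIV \<times> {-1<..<0} \<subseteq> S" unfolding SU by auto
    show "S \<subseteq> UNIV \<times> {-1..0}" unfolding SU by auto
    show "\<forall>E\<in>F. \<exists>I c. open_interval_real I \<and> c \<in> {-1, 0} \<and> E = I \<times> {c}"
    proof
      fix E assume "E \<in> F"
      then consider L where "L \<in> end_leaves" "E = \<Phi> ` L" | "E = UNIV \<times> {0}" by (auto simp: F_def)
      then show "\<exists>I c. open_interval_real I \<and> c \<in> {-1, 0} \<and> E = I \<times> {c}"
      proof cases
        case 1
        then show ?thesis using im_end_leaves I_int by (intro exI[of _ "I L"] exI[of _ "-1"]) simp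
      next
        case 2
        have "open_interval_real UNIV" by (auto simp: open_interval_real_def is_interval_1)
        then show ?thesis using 2 by blast
      qed
    qed
    show "pairwise disjnt F"
      unfolding pairwise_def
    proof (intro ballI impI)
      fix E E' assume E: "E \<in> F" "E' \<in> F" "E \<noteq> E'"
      have z: "disjnt (\<Phi> ` L) (UNIV \<times> {0})" if "L \<in> end_leaves" for L using im_end_leaves[OF that] by (auto simp: disjnt_def)
      have o: "disjnt (\<Phi> ` L) (\<Phi> ` L')" if "L \<in> end_leaves" "L' \<in> end_leaves" "\<Phi> ` L \<noteq> \<Phi> ` L'" for L L'
      proof -
        have "L \<noteq> L'" using that by blast
        then have "L \<inter> L' = {}" using that leaves_disjoint[of L L'] unfolding end_leaves_def by blast
        then have "\<Phi> ` L \<inter> \<Phi> ` L' = {}"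
          using inj_on_image_Int[OF inj end_leaves_subset_Z[OF that(1)] end_leaves_subset_Z[OF that(2)]] by simp
        then show ?thesis by (simp add: disjnt_def)
      qed
      have cs: "(\<exists>L\<in>end_leaves. M = \<Phi> ` L) \<or> M = UNIV \<times> {0}" if "M \<in> F" for M
        using that by (auto simp: F_def)
      show "disjnt E E'"
        using cs[OF E(1)] cs[OF E(2)]
      proof (elim disjE bexE)
        fix L L' assume "L \<in> end_leaves" "E = \<Phi> ` L" "L' \<in> end_leaves" "E' = \<Phi> ` L'"
        then show ?thesis using o[of L L'] E(3) by simp
      next
        fix L assume "L \<in> end_leaves" "E = \<Phi> ` L" "E' = UNIV \<times> {0}"
        then show ?thesis using z by simp
      next
        fix L assume "E = UNIV \<times> {0}" "L \<in> end_leaves" "E' = \<Phi> ` L"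
        then show ?thesis using disjnt_sym[OF z] by simp
      next
        assume "E = UNIV \<times> {0}" "E' = UNIV \<times> {0}"
        then show ?thesis using E(3) by simp
      qed
    qed
    show "\<Union>F = S \<inter> (UNIV \<times> {-1, 0})"
      unfolding SU F_def using im_end_leaves by auto
  qed simp
  moreover have "(\<lambda>L. \<Phi> ` L) ` restr_fol \<Delta> Z = canonical_fol (-1) 0 F"
  proof -
    have "(\<lambda>L. \<Phi> ` L) ` restr_fol \<Delta> Z = (\<lambda>t. \<Phi> ` leaf t) ` {-1<..0} \<union> (\<lambda>L. \<Phi> ` L) ` end_leaves"
      unfolding leaves_in_Z image_Un image_image ..
    also have "(\<lambda>t. \<Phi> ` leaf t) ` {-1<..0} = (\<lambda>t. UNIV \<times> {t}) ` {-1<..0}"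
      using im_leaf by (intro image_cong) auto
    also have "(\<lambda>t::real. (UNIV::real set) \<times> {t}) ` {-1<..0} = {UNIV \<times> {t} | t. -1 < t \<and> t < 0} \<union> {UNIV \<times> {0}}"
    proof -
      have "{-1<..0::real} = {-1<..<0} \<union> {0}" by auto
      then have "(\<lambda>t::real. (UNIV::real set) \<times> {t}) ` {-1<..0} = (\<lambda>t. UNIV \<times> {t}) ` {-1<..<0} \<union> {UNIV \<times> {0}}"
        by (simp only: image_Un image_insert image_empty)
      then show ?thesis by auto
    qed
    finally show ?thesis unfolding canonical_fol_def F_def by auto
  qed
  ultimately show ?thesis using hom unfolding foliated_homeomorphic_def by blast
qed

end

section \<open>Transverse coordinates at the end leaves\<close>

lemma continuous_on_add_edge:
  fixes f :: "real \<times> real \<Rightarrow> real"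
  assumes c: "continuous_on (UNIV \<times> {a<..<b}) f"
    and edge: "\<And>x e. e > 0 \<Longrightarrow> \<exists>r>0. \<forall>x' t. \<bar>x' - x\<bar> < r \<and> a \<le> t \<and> t < a + r \<and> t < b \<longrightarrow> \<bar>f (x', t) - f (x, a)\<bar> < e"
  shows "continuous_on (UNIV \<times> {a..<b}) f"
  unfolding continuous_on_iff
proof (intro ballI allI impI)
  fix z :: "real \<times> real" and e :: real assume z: "z \<in> UNIV \<times> {a..<b}" and e: "0 < e"
  obtain x t where xt: "z = (x,t)" "a \<le> t" "t < b" using z by auto
  show "\<exists>d>0. \<forall>w\<in>UNIV \<times> {a..<b}. dist w z < d \<longrightarrow> dist (f w) (f z) < e"
  proof (cases "t = a")
    case True
    obtain r where r: "r > 0" "\<And>x' t. \<bar>x' - x\<bar> < r \<and> a \<le> t \<and> t < a + r \<and> t < b \<Longrightarrow> \<bar>f (x', t) - f (x, a)\<bar> < e"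
      using edge[OF e, of x] by blast
    have "dist (f w) (f z) < e" if w: "w \<in> UNIV \<times> {a..<b}" "dist w z < r" for w
    proof -
      obtain x' t' where w': "w = (x',t')" "a \<le> t'" "t' < b" using w by auto
      have "dist x' x \<le> dist w z" "dist t' t \<le> dist w z"
        using dist_fst_le[of w z] dist_snd_le[of w z] w'(1) xt(1) by simp_all
      then have "\<bar>x' - x\<bar> < r" "t' < a + r" using w(2) w' True by (auto simp: dist_real_def)
      then show ?thesis using r(2)[of x' t'] w' xt True by (simp add: dist_real_def)
    qed
    then show ?thesis using r(1) by blast
  next
    case False
    then have t: "z \<in> UNIV \<times> {a<..<b}" using xt by auto
    obtain d where d: "d > 0" "\<forall>w\<in>UNIV \<times> {a<..<b}. dist w z < d \<longrightarrow> dist (f w) (f z) < e"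
      using c e t unfolding continuous_on_iff by blast
    have "dist (f w) (f z) < e" if w: "w \<in> UNIV \<times> {a..<b}" "dist w z < min d (t - a)" for w
    proof -
      obtain x' t' where w': "w = (x',t')" "a \<le> t'" "t' < b" using w by auto
      have "dist t' t \<le> dist w z" using dist_snd_le[of w z] w'(1) xt(1) by simp
      then have "a < t'" using w(2) by (auto simp: dist_real_def)
      then have "w \<in> UNIV \<times> {a<..<b}" using w' by auto
      then show ?thesis using d(2)[rule_format, of w] w(2) by simp
    qed
    moreover have "min d (t - a) > 0" using d(1) xt False by auto
    ultimately show ?thesis by blast
  qed
qed

context strip_region begin

text \<open>Halfway between the end and the level up to which the end chart of \<open>L\<close> is
  defined. Freezing the coordinate of \<open>L\<close> there extends it continuously to all higher
  levels.\<close>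

definition "mid L = (end_level L - 1) / 2"
definition "end_coord L z = fst (inv_into (UNIV \<times> {-1..<end_level L}) (end_param L) (\<phi> z))"

lemma mid_bounds:
  assumes "L \<in> end_leaves" shows "-1 < mid L" "mid L < end_level L"
  using end_level_bounds[OF assms] by (simp_all add: mid_def)

text \<open>At a fixed level the coordinate is inverse to the increasing function
  \<open>x \<mapsto> fst (inv_phi (end_param L (x, t)))\<close>, which gives its monotonicity and
  surjectivity.\<close>

lemma end_coord:
  assumes L: "L \<in> end_leaves" and t: "-1 < t" "t < end_level L"
  shows "end_param L (end_coord L (x, t), t) = \<phi> (x, t)" "end_coord L (fst (inv_phi (end_param L (x, t))), t) = x"
    "strict_mono (\<lambda>x. end_coord L (x, t))" "surj (\<lambda>x. end_coord L (x, t))"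
proof -
  let ?D = "UNIV \<times> {-1..<end_level L}"
  have inv: "inv_into ?D (end_param L) (end_param L (y, t)) = (y, t)" for y
    using t by (intro inv_into_f_f[OF end_param_inj[OF L]]) auto
  have 1: "end_param L (end_coord L (x, t), t) = \<phi> (x, t)" for x
  proof -
    have "\<phi> (x, t) \<in> end_param L ` (UNIV \<times> {t})" using end_param_leaf[OF L t] leaf_mem by simp
    then obtain y where "\<phi> (x,t) = end_param L (y,t)" by auto
    then show ?thesis using inv by (simp add: end_coord_def)
  qed
  then show "end_param L (end_coord L (x, t), t) = \<phi> (x, t)" .
  have 2: "end_coord L (fst (inv_phi (end_param L (x, t))), t) = x" for x
    using end_param_mem(5)[OF L t] inv by (simp add: end_coord_def)
  then show "end_coord L (fst (inv_phi (end_param L (x, t))), t) = x" .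
  have so: "(x, t) \<in> open_strip" for x using t end_level_bounds(2)[OF L] by (simp add: strip_iff)
  have 3: "fst (inv_phi (end_param L (end_coord L (x, t), t))) = x" for x
    unfolding 1 using inv_phi(1)[OF so] by simp
  show "strict_mono (\<lambda>x. end_coord L (x, t))"
  proof (rule strict_monoI)
    fix x y :: real assume "x < y"
    then have "fst (inv_phi (end_param L (end_coord L (x, t), t))) < fst (inv_phi (end_param L (end_coord L (y, t), t)))" by (simp add: 3)
    then show "end_coord L (x, t) < end_coord L (y, t)" using strict_mono_less[OF end_param_mono[OF L t]] by simp
  qed
  show "surj (\<lambda>x. end_coord L (x, t))" by (rule surjI[where f = "\<lambda>x. fst (inv_phi (end_param L (x, t)))"]) (rule 2)
qed

text \<open>Continuity of the inverse chart is openness of \<open>end_param L\<close> into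
  \<open>Z\<close>.\<close>

lemma end_coord_cont:
  assumes L: "L \<in> end_leaves" shows "continuous_on (UNIV \<times> {-1<..<end_level L}) (end_coord L)"
proof -
  let ?D = "UNIV \<times> {-1..<end_level L} :: (real \<times> real) set" and ?E = "UNIV \<times> {-1<..<end_level L} :: (real \<times> real) set"
  have "openin (top_of_set ?E) (?E \<inter> end_coord L -` O')" if O': "open O'" for O'
  proof -
    let ?W = "?D \<inter> (O' \<times> {-1<..})"
    have "openin (top_of_set ?D) ?W" using O' by (intro openin_open_Int open_Times) auto
    then have "openin XZ (end_param L ` ?W)" using end_param_open[OF L] by (simp add: open_map_def)
    then obtain V where V: "openin X V" "end_param L ` ?W = V \<inter> Z" by (auto simp: openin_subtopology)
    have "continuous_map (top_of_set ?E) X \<phi>"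
      using phi_cont by (rule continuous_map_from_subtopology_mono) (use end_level_bounds(2)[OF L] in \<open>auto simp: open_strip_def\<close>)
    from openin_continuous_map_preimage[OF this V(1)]
    have "openin (top_of_set ?E) {z \<in> ?E. \<phi> z \<in> V}" by simp
    moreover have "{z \<in> ?E. \<phi> z \<in> V} = ?E \<inter> end_coord L -` O'"
    proof (intro equalityI subsetI)
      fix z assume "z \<in> {z \<in> ?E. \<phi> z \<in> V}"
      then obtain x t where z: "z = (x,t)" "-1 < t" "t < end_level L" "\<phi> z \<in> V" by auto
      have "\<phi> z \<in> Z" using z leaf_mem leaf_subset_lower_half[of t] end_level_bounds(2)[OF L] Z_subset(2) by force
      then have "\<phi> z \<in> end_param L ` ?W" using V z by blast
      then obtain w where w: "\<phi> z = end_param L w" "w \<in> ?W" by (rule imageE)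
      have "end_param L (end_coord L z, t) = \<phi> z" using end_coord(1)[OF L z(2,3)] z(1) by simp
      then have "(end_coord L z, t) = w"
        using w by (intro inj_onD[OF end_param_inj[OF L]]) (use z in auto)
      then show "z \<in> ?E \<inter> end_coord L -` O'" using w z by auto
    next
      fix z assume "z \<in> ?E \<inter> end_coord L -` O'"
      then obtain x t where z: "z = (x,t)" "-1 < t" "t < end_level L" "end_coord L z \<in> O'" by auto
      then have "(end_coord L z, t) \<in> ?W" by auto
      then have "end_param L (end_coord L z, t) \<in> V" using V(2) by blast
      then show "z \<in> {z \<in> ?E. \<phi> z \<in> V}" using end_coord(1)[OF L z(2,3)] z by auto
    qed
    ultimately show ?thesis by simp
  qed
  then show ?thesis unfolding continuous_openin_preimage_eq by blast
qed

lemma end_param_inv_cont: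
  assumes L: "L \<in> end_leaves" shows "continuous_on (UNIV \<times> {-1<..<end_level L}) (\<lambda>z. inv_phi (end_param L z))"
proof -
  let ?E = "UNIV \<times> {-1<..<end_level L} :: (real \<times> real) set"
  have s: "?E \<subseteq> UNIV \<times> {-1..<end_level L}" by auto
  have "continuous_map (top_of_set ?E) XQ (end_param L)"
    using continuous_map_from_subtopology_mono[OF end_param_cont[OF L] s] end_param_mem(3)[OF L]
    by (auto simp: continuous_map_in_subtopology)
  from continuous_map_compose[OF this inv_phi_cont]
  show ?thesis by (simp add: o_def continuous_map_in_subtopology)
qed

lemma end_param_inv_image:
  assumes L: "L \<in> end_leaves" shows "(\<lambda>z. inv_phi (end_param L z)) ` (UNIV \<times> {-1<..<end_level L}) \<subseteq> UNIV \<times> {-1<..}"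
proof (rule image_subsetI)
  fix z :: "real \<times> real" assume "z \<in> UNIV \<times> {-1<..<end_level L}"
  then obtain x t where "z = (x,t)" "-1 < t" "t < end_level L" by auto
  then show "inv_phi (end_param L z) \<in> UNIV \<times> {-1<..}" using end_param_mem(4)[OF L, of t x] by (simp add: mem_Times_iff)
qed

text \<open>The coordinate along \<open>L\<close>, squashed by \<open>arctan\<close> and frozen above the level \<open>mid L\<close>.
  On the other end leaves it is extended by its limit, which is \<open>pi / 2\<close> or \<open>- pi / 2\<close>.\<close>

definition "squashed L z = arctan (end_coord L (fst z, min (snd z) (mid L)))"

definition "end_sign L L' = (SOME s::real. (s = 1 \<or> s = -1) \<and>
  (\<forall>x. \<exists>r>0. \<forall>x' t. \<bar>x' - x\<bar> < r \<and> -1 < t \<and> t < -1 + r \<longrightarrow> 0 < s * squashed L (inv_phi (end_param L' (x', t)))))"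

definition "end_fun L y = (if y \<in> Q then squashed L (inv_phi y)
   else if y \<in> L then arctan (fst (inv_into (UNIV \<times> {-1..<end_level L}) (end_param L) y))
   else end_sign L (leaf_of \<Delta> y) * (pi / 2))"

lemma min_mid: "L \<in> end_leaves \<Longrightarrow> -1 < t \<Longrightarrow> -1 < min t (mid L) \<and> min t (mid L) < end_level L"
  using mid_bounds[of L] by (auto simp: min_def)

lemma squashed_cont:
  assumes L: "L \<in> end_leaves" shows "continuous_on (UNIV \<times> {-1<..}) (squashed L)"
  unfolding squashed_def
proof (rule continuous_on_arctan, rule continuous_on_compose2[OF end_coord_cont[OF L]])
  show "continuous_on (UNIV \<times> {-1<..}) (\<lambda>z::real \<times> real. (fst z, min (snd z) (mid L)))"
    by (intro continuous_intros)
  show "(\<lambda>z. (fst z, min (snd z) (mid L))) ` (UNIV \<times> {-1<..}) \<subseteq> UNIV \<times> {-1<..<end_level L}"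
    using mid_bounds[OF L] by auto
qed

lemma squashed_mono:
  assumes L: "L \<in> end_leaves" and t: "-1 < t" shows "strict_mono (\<lambda>x. squashed L (x, t))"
proof (rule strict_monoI)
  fix x y :: real assume xy: "x < y"
  have m: "-1 < min t (mid L)" "min t (mid L) < end_level L" using min_mid[OF assms] by blast+
  show "squashed L (x, t) < squashed L (y, t)"
    using strict_monoD[OF end_coord(3)[OF L m] xy] by (simp add: squashed_def arctan_less_iff)
qed

lemma squashed_bound: "\<bar>squashed L z\<bar> < pi / 2"
  using arctan_bounded[of "end_coord L (fst z, min (snd z) (mid L))"] by (auto simp: squashed_def abs_less_iff)

lemma squashed_lim:
  assumes "L \<in> end_leaves" "-1 < t"
  shows "((\<lambda>x. squashed L (x, t)) \<longlongrightarrow> pi / 2) at_top" "((\<lambda>x. squashed L (x, t)) \<longlongrightarrow> - (pi / 2)) at_bot"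
proof -
  let ?g = "\<lambda>x. end_coord L (x, min t (mid L))"
  have m: "-1 < min t (mid L)" "min t (mid L) < end_level L" using min_mid[OF assms] by blast+
  have sm: "strict_mono ?g" and su: "surj ?g" by (rule end_coord(3,4)[OF assms(1) m])+
  have "filterlim ?g at_top at_top"
    unfolding filterlim_at_top
  proof
    fix M obtain x where x: "M = ?g x" using surjD[OF su, of M] by blast
    show "\<forall>\<^sub>F x in at_top. M \<le> ?g x"
      using eventually_ge_at_top[of x] by eventually_elim (use x strict_mono_less_eq[OF sm] in blast)
  qed
  from filterlim_compose[OF tendsto_arctan_at_top this]
  show "((\<lambda>x. squashed L (x, t)) \<longlongrightarrow> pi / 2) at_top" by (simp add: squashed_def)
  have "filterlim ?g at_bot at_bot"
    unfolding filterlim_at_bot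
  proof
    fix M obtain x where x: "M = ?g x" using surjD[OF su, of M] by blast
    show "\<forall>\<^sub>F x in at_bot. ?g x \<le> M"
      using eventually_le_at_bot[of x] by eventually_elim (use x strict_mono_less_eq[OF sm] in blast)
  qed
  from filterlim_compose[OF tendsto_arctan_at_bot this]
  show "((\<lambda>x. squashed L (x, t)) \<longlongrightarrow> - (pi / 2)) at_bot" by (simp add: squashed_def)
qed

lemma end_fun_phi: "z \<in> open_strip \<Longrightarrow> end_fun L (\<phi> z) = squashed L z"
  using inv_phi(1) phi_image by (auto simp: end_fun_def)

lemma end_fun_end_param: "L' \<in> end_leaves \<Longrightarrow> -1 < t \<Longrightarrow> t < end_level L' \<Longrightarrow> end_fun L (end_param L' (x, t)) = squashed L (inv_phi (end_param L' (x, t)))"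
  using end_param_mem(3) by (simp add: end_fun_def)

lemma end_fun_own:
  assumes L: "L \<in> end_leaves" and t: "-1 \<le> t" "t \<le> mid L"
  shows "end_fun L (end_param L (x, t)) = arctan x"
proof (cases "t = -1")
  case True
  have "end_param L (x, -1) \<in> L" "end_param L (x, -1) \<notin> Q" using end_param_end_mem[OF L] end_leaves_not_Q[OF L] by blast+
  moreover have "inv_into (UNIV \<times> {-1..<end_level L}) (end_param L) (end_param L (x, -1)) = (x, -1)"
    using end_level_bounds(1)[OF L] by (intro inv_into_f_f[OF end_param_inj[OF L]]) auto
  ultimately show ?thesis using True by (simp add: end_fun_def)
next
  case False
  then have t': "-1 < t" "t < end_level L" using t mid_bounds[OF L] by auto
  then have "end_fun L (end_param L (x, t)) = arctan (end_coord L (fst (inv_phi (end_param L (x, t))), min t (mid L)))"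
    using end_fun_end_param[OF L t'] end_param_mem(4)[OF L t'] by (simp add: squashed_def)
  then show ?thesis using end_coord(2)[OF L t'] t by (simp add: min_def)
qed

text \<open>The part of the end chart of \<open>L\<close> with coordinate in \<open>{-M..M}\<close>
  and level up to \<open>mid L\<close> has a compact image, which is closed in \<open>X\<close>. It
  misses \<open>L'\<close>, so close to a point of \<open>L'\<close> the coordinate of
  \<open>L\<close> exceeds \<open>M\<close> in absolute value.\<close>

lemma end_fun_far:
  assumes L: "L \<in> end_leaves" and L': "L' \<in> end_leaves" "L' \<noteq> L"
  shows "\<exists>r>0. -1 + r < end_level L' \<and> (\<forall>x' t. \<bar>x' - x\<bar> < r \<and> -1 < t \<and> t < -1 + r \<longrightarrow>
     arctan M < \<bar>squashed L (inv_phi (end_param L' (x', t)))\<bar>)"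
proof -
  define K where "K = end_param L ` ({-M..M} \<times> {-1..mid L})"
  have s: "{-M..M} \<times> {-1..mid L} \<subseteq> UNIV \<times> {-1..<end_level L}" using mid_bounds(2)[OF L] by auto
  have "compact ({-M..M} \<times> {-1..mid L})" by (intro compact_Times) auto
  then have "compactin (top_of_set (UNIV \<times> {-1..<end_level L})) ({-M..M} \<times> {-1..mid L})"
    using s by (simp add: compactin_subtopology)
  then have "compactin X K" unfolding K_def using end_param_cont[OF L] by (rule image_compactin)
  then have "closedin X K" using Hausdorff_X compactin_imp_closedin by blast
  then have "openin X (topspace X - K)" by blast
  from openin_continuous_map_preimage[OF end_param_cont[OF L'(1)] this]
  obtain G where G: "open G" "{z \<in> UNIV \<times> {-1..<end_level L'}. end_param L' z \<in> topspace X - K} = (UNIV \<times> {-1..<end_level L'}) \<inter> G"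
    unfolding openin_open by auto
  have "end_param L' (x,-1) \<notin> K"
  proof
    assume "end_param L' (x,-1) \<in> K"
    then obtain y t where yt: "-1 \<le> t" "t \<le> mid L" "end_param L' (x,-1) = end_param L (y,t)" by (auto simp: K_def)
    show False
    proof (cases "t = -1")
      case True
      then have "end_param L' (x,-1) \<in> L" using end_param_end_mem[OF L] yt by simp
      then have "L' = L" using leaves_disjoint[of L' L] end_param_end_mem[OF L'(1)] L L' by (auto simp: end_leaves_def)
      then show False using L' by simp
    next
      case False
      then have "end_param L' (x,-1) \<in> Q" using end_param_mem(3)[OF L, of t y] yt mid_bounds(2)[OF L] by simp
      then show False using end_leaves_not_Q[OF L'(1) end_param_end_mem[OF L'(1)]] by blast
    qed
  qed
  moreover have "end_param L' (x,-1) \<in> topspace X"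
    using end_param_end_mem[OF L'(1)] leaf_subset[of L'] L'(1) unfolding end_leaves_def by blast
  moreover have "(x,-1) \<in> UNIV \<times> {-1..<end_level L'}" using end_level_bounds(1)[OF L'(1)] by simp
  ultimately have "(x,-1) \<in> {z \<in> UNIV \<times> {-1..<end_level L'}. end_param L' z \<in> topspace X - K}" by blast
  then have "(x,-1) \<in> G" unfolding G(2) by blast
  then obtain A B where AB: "open A" "open B" "(x, -1) \<in> A \<times> B" "A \<times> B \<subseteq> G"
    using open_prod_elim[OF G(1)] by metis
  obtain r1 where r1: "r1 > 0" "\<And>y. \<bar>y - x\<bar> < r1 \<Longrightarrow> y \<in> A" using AB open_nbhd_real by (metis mem_Sigma_iff)
  obtain r2 where r2: "r2 > 0" "\<And>y. \<bar>y - (-1)\<bar> < r2 \<Longrightarrow> y \<in> B" using AB open_nbhd_real by (metis mem_Sigma_iff)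
  define r where "r = min (min r1 r2) (min ((end_level L' + 1) / 2) (mid L + 1))"
  have r: "0 < r" "r \<le> r1" "r \<le> r2" "-1 + r < end_level L'" "-1 + r \<le> mid L"
    using r1 r2 end_level_bounds(1)[OF L'(1)] mid_bounds(1)[OF L] by (auto simp: r_def min_def field_simps)
  have "arctan M < \<bar>squashed L (inv_phi (end_param L' (x', t)))\<bar>" if xt: "\<bar>x' - x\<bar> < r" "-1 < t" "t < -1 + r" for x' t
  proof -
    have tL': "t < end_level L'" using xt r by simp
    have tL: "t \<le> mid L" "t < end_level L" using xt r mid_bounds(2)[OF L] by auto
    have "x' \<in> A" "t \<in> B" using xt r by (auto intro!: r1(2) r2(2))
    then have "(x',t) \<in> (UNIV \<times> {-1..<end_level L'}) \<inter> G" using AB xt tL' by auto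
    then have nK: "end_param L' (x',t) \<notin> K" using G(2) by blast
    define a where "a = fst (inv_phi (end_param L' (x', t)))"
    have a: "inv_phi (end_param L' (x', t)) = (a, t)" using end_param_mem(4)[OF L'(1) xt(2) tL'] a_def by (metis prod.collapse)
    have "end_param L (end_coord L (a,t), t) = end_param L' (x',t)"
      using end_coord(1)[OF L xt(2) tL(2)] end_param_mem(5)[OF L'(1) xt(2) tL'] a_def by simp
    moreover have "end_param L (end_coord L (a,t), t) \<in> K" if "end_coord L (a,t) \<in> {-M..M}"
      unfolding K_def using that xt(2) tL(1) by (intro imageI) auto
    ultimately have "end_coord L (a,t) \<notin> {-M..M}" using nK by auto
    then have "M < end_coord L (a,t) \<or> end_coord L (a,t) < - M" by auto
    then have "arctan M < arctan (end_coord L (a,t)) \<or> arctan (end_coord L (a,t)) < - arctan M"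
      by (metis arctan_less_iff arctan_minus)
    moreover have "squashed L (inv_phi (end_param L' (x', t))) = arctan (end_coord L (a,t))"
      using a tL(1) by (simp add: squashed_def min_def)
    ultimately show ?thesis by auto
  qed
  then show ?thesis using r(1,4) by blast
qed

text \<open>By \<open>end_fun_far\<close> with \<open>M = 0\<close> the coordinate of
  \<open>L\<close> does not vanish close to a given point of \<open>L'\<close>, so it has a sign
  there. The points of \<open>L'\<close> with positive sign form an open set and so do those with
  negative sign; as \<open>L'\<close> is a line, one sign holds along all of it.\<close>

lemma end_sign:
  assumes L: "L \<in> end_leaves" and L': "L' \<in> end_leaves" "L' \<noteq> L"
  shows "end_sign L L' = 1 \<or> end_sign L L' = -1"
    "\<exists>r>0. \<forall>x' t. \<bar>x' - x\<bar> < r \<and> -1 < t \<and> t < -1 + r \<longrightarrow> 0 < end_sign L L' * squashed L (inv_phi (end_param L' (x', t)))"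
proof -
  define B where "B z = squashed L (inv_phi (end_param L' z))" for z
  define P where "P s x \<longleftrightarrow> (\<exists>r>0. \<forall>x' t. \<bar>x' - x\<bar> < r \<and> -1 < t \<and> t < -1 + r \<longrightarrow> 0 < s * B (x', t))" for s :: real and x
  have cB: "continuous_on (UNIV \<times> {-1<..<end_level L'}) B"
    unfolding B_def
    by (rule continuous_on_compose2[OF squashed_cont[OF L] end_param_inv_cont[OF L'(1)] end_param_inv_image[OF L'(1)]])
  have one: "P 1 x \<or> P (-1) x" for x
  proof -
    obtain r where r: "r > 0" "-1 + r < end_level L'"
      "\<And>x' t. \<bar>x' - x\<bar> < r \<and> -1 < t \<and> t < -1 + r \<Longrightarrow> arctan 0 < \<bar>B (x', t)\<bar>"
      using end_fun_far[OF L L', of x 0] unfolding B_def by blast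
    let ?S = "{x-r<..<x+r} \<times> {-1<..<-1+r}"
    have ne: "B z \<noteq> 0" if "z \<in> ?S" for z
    proof -
      obtain x' t where "z = (x',t)" "\<bar>x' - x\<bar> < r" "-1 < t" "t < -1 + r" using \<open>z \<in> ?S\<close> by (auto simp: abs_less_iff)
      then show ?thesis using r(3)[of x' t] by auto
    qed
    have "continuous_on ?S B" by (rule continuous_on_subset[OF cB]) (use r in auto)
    moreover have "connected ?S" by (intro connected_Times) auto
    ultimately have cn: "connected (B ` ?S)" by (rule connected_continuous_image)
    have "(\<forall>z\<in>?S. 0 < B z) \<or> (\<forall>z\<in>?S. B z < 0)"
    proof (rule ccontr)
      assume "\<not> ?thesis"
      then obtain z w where zw: "z \<in> ?S" "w \<in> ?S" "B z \<le> 0" "0 \<le> B w" by (meson linorder_not_less)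
      then have "0 \<in> B ` ?S" using connectedD_interval[OF cn, of "B z" "B w" 0] by blast
      then show False using ne by auto
    qed
    then show ?thesis
    proof
      assume "\<forall>z\<in>?S. 0 < B z"
      then have "P 1 x" unfolding P_def using r(1) by (intro exI[of _ r]) (auto simp: abs_less_iff)
      then show ?thesis ..
    next
      assume "\<forall>z\<in>?S. B z < 0"
      then have "P (-1) x" unfolding P_def using r(1) by (intro exI[of _ r]) (auto simp: abs_less_iff)
      then show ?thesis ..
    qed
  qed
  have excl: "\<not> (P 1 x \<and> P (-1) x)" for x
  proof
    assume "P 1 x \<and> P (-1) x"
    then obtain r r' where r: "r > 0" "\<And>x' t. \<bar>x' - x\<bar> < r \<and> -1 < t \<and> t < -1 + r \<Longrightarrow> 0 < 1 * B (x', t)"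
      "r' > 0" "\<And>x' t. \<bar>x' - x\<bar> < r' \<and> -1 < t \<and> t < -1 + r' \<Longrightarrow> 0 < -1 * B (x', t)"
      unfolding P_def by blast
    define t where "t = -1 + min r r' / 2"
    have "\<bar>x - x\<bar> < r \<and> -1 < t \<and> t < -1 + r" "\<bar>x - x\<bar> < r' \<and> -1 < t \<and> t < -1 + r'"
      using r(1,3) by (auto simp: t_def min_def)
    then have "0 < 1 * B (x,t)" "0 < -1 * B (x,t)" by (blast intro: r(2) r(4))+
    then show False by simp
  qed
  have oP: "open {x. P s x}" for s
  proof (rule open_realI)
    fix x assume "x \<in> {x. P s x}"
    then obtain r where r: "r > 0" "\<And>x' t. \<bar>x' - x\<bar> < r \<and> -1 < t \<and> t < -1 + r \<Longrightarrow> 0 < s * B (x', t)"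
      unfolding P_def by blast
    have "P s y" if "\<bar>y - x\<bar> < r / 2" for y
      unfolding P_def
    proof (intro exI[of _ "r/2"] conjI allI impI)
      fix x' t assume xt: "\<bar>x' - y\<bar> < r / 2 \<and> -1 < t \<and> t < -1 + r / 2"
      have "\<bar>x' - x\<bar> \<le> \<bar>x' - y\<bar> + \<bar>y - x\<bar>" by simp
      then have "\<bar>x' - x\<bar> < r \<and> -1 < t \<and> t < -1 + r" using xt that by linarith
      then show "0 < s * B (x', t)" by (rule r(2))
    qed (use r in simp)
    then show "\<exists>e>0. \<forall>y. \<bar>y - x\<bar> < e \<longrightarrow> y \<in> {x. P s x}" using r(1) by (intro exI[of _ "r/2"]) auto
  qed
  have "{x. P 1 x} = - {x. P (-1) x}" using one excl by blast
  then have "closed {x. P 1 x}" using oP[of "-1"] by (simp add: closed_def)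
  then have "{x. P 1 x} = {} \<or> {x. P 1 x} = UNIV"
    using oP[of 1] by (intro clopen[THEN iffD1] conjI)
  then have "\<exists>s. (s = 1 \<or> s = -1) \<and> (\<forall>x. P s x)"
    using one by (metis UNIV_I empty_iff mem_Collect_eq)
  then have "(end_sign L L' = 1 \<or> end_sign L L' = -1) \<and> (\<forall>x. P (end_sign L L') x)"
    unfolding end_sign_def P_def B_def by (rule someI_ex)
  then show "end_sign L L' = 1 \<or> end_sign L L' = -1"
    "\<exists>r>0. \<forall>x' t. \<bar>x' - x\<bar> < r \<and> -1 < t \<and> t < -1 + r \<longrightarrow> 0 < end_sign L L' * squashed L (inv_phi (end_param L' (x', t)))"
    unfolding P_def B_def by blast+
qed

lemma end_fun_other:
  assumes L: "L \<in> end_leaves" and L': "L' \<in> end_leaves" "L' \<noteq> L"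
  shows "end_fun L (end_param L' (x, -1)) = end_sign L L' * (pi / 2)"
proof -
  have m: "end_param L' (x,-1) \<in> L'" by (rule end_param_end_mem[OF L'(1)])
  have D: "L \<in> \<Delta>" "L' \<in> \<Delta>" using L L' by (auto simp: end_leaves_def)
  have "leaf_of \<Delta> (end_param L' (x,-1)) = L'" by (rule leaf_of_eq[OF D(2) m])
  moreover have "end_param L' (x,-1) \<notin> L" using leaves_disjoint[OF D(2,1) m] L'(2) by blast
  ultimately show ?thesis using end_leaves_not_Q[OF L'(1) m] by (simp add: end_fun_def)
qed

text \<open>At an end leaf other than \<open>L\<close>, \<open>end_fun_far\<close> bounds the
  modulus from below by values close to \<open>pi / 2\<close> and \<open>end_sign\<close> fixes the
  sign; together they give the limit. In the chart of \<open>L\<close> itself the function is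
  \<open>arctan\<close> of the coordinate.\<close>

lemma end_fun_end_param_cont:
  assumes L: "L \<in> end_leaves" and L': "L' \<in> end_leaves"
  shows "continuous_on (UNIV \<times> {-1..<mid L'}) (\<lambda>z. end_fun L (end_param L' z))"
proof (cases "L' = L")
  case True
  have "continuous_on (UNIV \<times> {-1..<mid L'}) (\<lambda>z. arctan (fst z))" by (intro continuous_intros)
  then show ?thesis by (rule continuous_on_eq) (use end_fun_own[OF L] True in auto)
next
  case False
  show ?thesis
  proof (rule continuous_on_add_edge)
    have "continuous_on (UNIV \<times> {-1<..<mid L'}) (\<lambda>z. squashed L (inv_phi (end_param L' z)))"
      by (rule continuous_on_subset[OF continuous_on_compose2[OF squashed_cont[OF L] end_param_inv_cont[OF L'] end_param_inv_image[OF L']]])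
         (use mid_bounds(2)[OF L'] in auto)
    then show "continuous_on (UNIV \<times> {-1<..<mid L'}) (\<lambda>z. end_fun L (end_param L' z))"
      by (rule continuous_on_eq) (use mid_bounds(2)[OF L'] end_fun_end_param[OF L'] in auto)
    fix x e :: real assume e: "e > 0"
    let ?s = "end_sign L L'"
    have s: "?s = 1 \<or> ?s = -1" by (rule end_sign(1)[OF L L' False])
    have "\<forall>\<^sub>F M in at_top. pi / 2 - e < arctan M"
      using order_tendstoD(1)[OF tendsto_arctan_at_top, of "pi/2 - e"] e by simp
    then obtain M where M: "pi / 2 - e < arctan M" by (metis eventually_at_top_linorder order_refl)
    obtain r1 where r1: "r1 > 0" "-1 + r1 < end_level L'"
      "\<And>x' t. \<bar>x' - x\<bar> < r1 \<and> -1 < t \<and> t < -1 + r1 \<Longrightarrow> arctan M < \<bar>squashed L (inv_phi (end_param L' (x', t)))\<bar>"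
      using end_fun_far[OF L L' False, of x M] by blast
    obtain r2 where r2: "r2 > 0"
      "\<And>x' t. \<bar>x' - x\<bar> < r2 \<and> -1 < t \<and> t < -1 + r2 \<Longrightarrow> 0 < ?s * squashed L (inv_phi (end_param L' (x', t)))"
      using end_sign(2)[OF L L' False, of x] by blast
    have "\<bar>end_fun L (end_param L' (x', t)) - end_fun L (end_param L' (x, -1))\<bar> < e"
      if xt: "\<bar>x' - x\<bar> < min r1 r2" "-1 \<le> t" "t < -1 + min r1 r2" for x' t
    proof (cases "t = -1")
      case True
      then show ?thesis unfolding True end_fun_other[OF L L' False] using e by simp
    next
      case F: False
      then have t: "-1 < t" "t < end_level L'" using xt r1(2) by auto
      define c where "c = squashed L (inv_phi (end_param L' (x', t)))"
      have "arctan M < \<bar>c\<bar>" "0 < ?s * c" unfolding c_def using xt t by (auto intro!: r1(3) r2(2))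
      moreover have "\<bar>c\<bar> < pi / 2" unfolding c_def by (rule squashed_bound)
      ultimately have "\<bar>c - ?s * (pi / 2)\<bar> < e" using s M by (elim disjE) auto
      then show ?thesis unfolding end_fun_end_param[OF L' t] end_fun_other[OF L L' False] c_def .
    qed
    then show "\<exists>r>0. \<forall>x' t. \<bar>x' - x\<bar> < r \<and> -1 \<le> t \<and> t < -1 + r \<and> t < mid L' \<longrightarrow>
         \<bar>end_fun L (end_param L' (x', t)) - end_fun L (end_param L' (x, -1))\<bar> < e"
      using r1(1) r2(1) by (intro exI[of _ "min r1 r2"]) auto
  qed
qed

end

section \<open>Series with geometric weights\<close>

lemma half_series_summable:
  fixes f :: "nat \<Rightarrow> real"
  assumes "\<And>n. \<bar>f n\<bar> \<le> c" shows "summable (\<lambda>n. (1/2) ^ Suc n * f n)"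
proof (rule summable_comparison_test')
  show "summable (\<lambda>n. (1/2::real) ^ Suc n * c)" using power_half_series by (intro summable_mult2) (auto simp: sums_iff)
  show "norm ((1/2) ^ Suc n * f n) \<le> (1/2) ^ Suc n * c" if "0 \<le> n" for n
    using assms by (simp add: abs_mult mult_left_mono)
qed

lemma half_series_less:
  fixes f g :: "nat \<Rightarrow> real"
  assumes f: "\<And>n. \<bar>f n\<bar> \<le> c" and g: "\<And>n. \<bar>g n\<bar> \<le> c" and le: "\<And>n. f n \<le> g n" and less: "f m < g m"
  shows "(\<Sum>n. (1/2) ^ Suc n * f n) < (\<Sum>n. (1/2) ^ Suc n * g n)"
proof -
  have sf: "summable (\<lambda>n. (1/2) ^ Suc n * f n)" and sg: "summable (\<lambda>n. (1/2) ^ Suc n * g n)"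
    using half_series_summable[of f c] half_series_summable[of g c] f g by auto
  have "0 < (\<Sum>n. (1/2) ^ Suc n * g n - (1/2) ^ Suc n * f n)"
  proof (rule suminf_pos2)
    show "summable (\<lambda>n. (1/2) ^ Suc n * g n - (1/2) ^ Suc n * f n)" by (rule summable_diff[OF sg sf])
    show "0 \<le> (1/2) ^ Suc n * g n - (1/2) ^ Suc n * f n" for n using mult_left_mono[OF le, of "(1/2) ^ Suc n" n] by simp
    show "0 < (1/2) ^ Suc m * g m - (1/2) ^ Suc m * f m" using mult_strict_left_mono[OF less, of "(1/2) ^ Suc m"] by simp
  qed
  then show ?thesis using suminf_diff[OF sg sf] by simp
qed

text \<open>The weights add up to 1, so common bounds and limits of the terms carry over to the sum
  unchanged.\<close>

lemma half_series_const: "(\<Sum>n. (1/2) ^ Suc n * l) = (l::real)"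
  using sums_mult2[OF power_half_series, of l] by (simp add: sums_iff)

lemma half_series_continuous:
  fixes f :: "nat \<Rightarrow> 'b::topological_space \<Rightarrow> real"
  assumes "\<And>n. continuous_on S (f n)" and b: "\<And>n z. z \<in> S \<Longrightarrow> \<bar>f n z\<bar> \<le> c"
  shows "continuous_on S (\<lambda>z. \<Sum>n. (1/2) ^ Suc n * f n z)"
proof (rule uniform_limit_theorem)
  show "uniform_limit S (\<lambda>n z. \<Sum>i<n. (1/2) ^ Suc i * f i z) (\<lambda>z. \<Sum>n. (1/2) ^ Suc n * f n z) sequentially"
  proof (rule Weierstrass_m_test)
    show "norm ((1/2) ^ Suc n * f n z) \<le> (1/2) ^ Suc n * c" if "z \<in> S" for n z
      using b[OF that] by (simp add: abs_mult mult_left_mono)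
    show "summable (\<lambda>n. (1/2::real) ^ Suc n * c)" using power_half_series by (intro summable_mult2) (auto simp: sums_iff)
  qed
  show "\<forall>\<^sub>F n in sequentially. continuous_on S (\<lambda>z. \<Sum>i<n. (1/2) ^ Suc i * f i z)"
    using assms(1) by (intro always_eventually allI continuous_intros) auto
qed simp

lemma half_series_tendsto:
  fixes f :: "nat \<Rightarrow> 'b \<Rightarrow> real"
  assumes "\<And>n. (f n \<longlongrightarrow> l) F" and b: "\<And>n z. \<bar>f n z\<bar> \<le> c" and "F \<noteq> bot"
  shows "((\<lambda>z. \<Sum>n. (1/2) ^ Suc n * f n z) \<longlongrightarrow> l) F"
proof -
  have "((\<lambda>z. \<Sum>n. (1/2) ^ Suc n * f n z) \<longlongrightarrow> (\<Sum>n. (1/2) ^ Suc n * l)) F"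
  proof (rule tannerys_theorem[THEN conjunct2, THEN conjunct2])
    show "((\<lambda>z. (1/2) ^ Suc n * f n z) \<longlongrightarrow> (1/2) ^ Suc n * l) F" for n
      by (intro tendsto_mult_left assms(1))
    have "norm ((1/2) ^ Suc n * f n z) \<le> (1/2) ^ Suc n * c" for n z
      using b by (simp add: abs_mult mult_left_mono)
    then show "\<forall>\<^sub>F (n, z) in sequentially \<times>\<^sub>F F. norm ((1/2) ^ Suc n * f n z) \<le> (1/2) ^ Suc n * c"
      by (intro always_eventually) auto
    show "summable (\<lambda>n. (1/2::real) ^ Suc n * c)" using power_half_series by (intro summable_mult2) (auto simp: sums_iff)
  qed (rule assms(3))
  then show ?thesis unfolding half_series_const .
qed

section \<open>The straightening function on the closure\<close>

context strip_region begin

text \<open>Each end chart is open in \<open>Z\<close> and meets no end leaf except its own, so the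
  end leaves inject into a countable base of \<open>X\<close>.\<close>

lemma countable_end_leaves: "countable end_leaves"
proof -
  obtain \<B> where B: "countable \<B>" "\<And>V x. openin X V \<Longrightarrow> x \<in> V \<Longrightarrow> \<exists>W\<in>\<B>. x \<in> W \<and> W \<subseteq> V"
    using second_countable_X unfolding second_countable_def by metis
  have ex: "\<exists>W\<in>\<B>. end_param L (0,-1) \<in> W \<and> W \<inter> Z \<subseteq> end_param L ` (UNIV \<times> {-1..<end_level L})" if L: "L \<in> end_leaves" for L
  proof -
    have "openin XZ (end_param L ` (UNIV \<times> {-1..<end_level L}))" using end_param_open[OF L] by (auto simp: open_map_def)
    then obtain V where V: "openin X V" "end_param L ` (UNIV \<times> {-1..<end_level L}) = V \<inter> Z" by (auto simp: openin_subtopology)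
    have "end_param L (0,-1) \<in> end_param L ` (UNIV \<times> {-1..<end_level L})" using end_level_bounds(1)[OF L] by auto
    then have "end_param L (0,-1) \<in> V" using V by blast
    from B(2)[OF V(1) this] obtain W where "W \<in> \<B>" "end_param L (0,-1) \<in> W" "W \<subseteq> V" by blast
    then show ?thesis unfolding V(2) by blast
  qed
  then obtain W where W: "\<And>L. L \<in> end_leaves \<Longrightarrow> W L \<in> \<B> \<and> end_param L (0,-1) \<in> W L \<and> W L \<inter> Z \<subseteq> end_param L ` (UNIV \<times> {-1..<end_level L})"
    by metis
  have "inj_on W end_leaves"
  proof (rule inj_onI)
    fix L L' assume L: "L \<in> end_leaves" "L' \<in> end_leaves" "W L = W L'"
    have m: "end_param L' (0,-1) \<in> L'" by (rule end_param_end_mem[OF L(2)])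
    have "end_param L' (0,-1) \<in> W L \<inter> Z" using W[OF L(2)] L(3) m end_leaves_subset_Z[OF L(2)] by auto
    then have "end_param L' (0,-1) \<in> end_param L ` (UNIV \<times> {-1..<end_level L})" using W[OF L(1)] by blast
    then obtain x t where xt: "-1 \<le> t" "t < end_level L" "end_param L' (0,-1) = end_param L (x,t)" by auto
    have "t = -1"
    proof (rule ccontr)
      assume "t \<noteq> -1"
      then have "end_param L (x,t) \<in> Q" using end_param_mem(3)[OF L(1)] xt by simp
      then show False using end_leaves_not_Q[OF L(2) m] xt by simp
    qed
    then have "end_param L' (0,-1) \<in> L" using xt end_param_end_mem[OF L(1)] by simp
    then show "L = L'" using leaves_disjoint[of L L'] m L by (auto simp: end_leaves_def)
  qed
  moreover have "countable (W ` end_leaves)" using W B(1) by (meson countable_subset image_subsetI)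
  ultimately show ?thesis by (rule countable_image_inj_on[rotated])
qed

lemma end_leaves_point:
  assumes "y \<in> \<Union>end_leaves" obtains L x where "L \<in> end_leaves" "y = end_param L (x,-1)"
proof -
  obtain L where L: "L \<in> end_leaves" "y \<in> L" using assms by blast
  then have "y \<in> end_param L ` (UNIV \<times> {-1})" using end_param_end by simp
  then show ?thesis using that[OF L(1)] by auto
qed

lemma Z_cases:
  assumes "y \<in> Z"
  obtains x t where "y = \<phi> (x,t)" "-1 < t" "t \<le> 0" | L x where "L \<in> end_leaves" "y = end_param L (x,-1)"
proof -
  have "y \<in> lower_half \<or> y \<in> \<Union>end_leaves" using assms Z_decomp by blast
  then show ?thesis
  proof
    assume "y \<in> lower_half" then show ?thesis using that(1) by (auto simp: lower_half_def)
  next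
    assume "y \<in> \<Union>end_leaves" then show ?thesis using end_leaves_point that(2) by metis
  qed
qed

lemma end_fun_bound:
  assumes "y \<in> Z" "K \<in> end_leaves" shows "\<bar>end_fun K y\<bar> \<le> pi / 2"
  using assms(1)
proof (cases rule: Z_cases)
  case (1 x t)
  then have "end_fun K y = squashed K (x,t)" using end_fun_phi[of "(x,t)"] by (simp add: strip_iff)
  then show ?thesis using squashed_bound[of K "(x,t)"] by simp
next
  case (2 L x)
  show ?thesis
  proof (cases "L = K")
    case True
    then have "end_fun K y = arctan x" using end_fun_own[OF assms(2), of "-1" x] mid_bounds(1)[OF assms(2)] 2 by simp
    then show ?thesis using arctan_bounded[of x] by auto
  next
    case False
    then show ?thesis
      unfolding 2(2) end_fun_other[OF assms(2) 2(1) False] using end_sign(1)[OF assms(2) 2(1) False] by auto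
  qed
qed

text \<open>One strict summand keeps the weighted sum strictly between \<open>- pi / 2\<close> and
  \<open>pi / 2\<close>, so that \<open>tan\<close> can be applied to it. At a point of an end leaf
  it is the function of this very leaf.\<close>

lemma end_fun_strict:
  assumes y: "y \<in> Z" and "end_leaves \<noteq> {}" shows "\<exists>K\<in>end_leaves. \<bar>end_fun K y\<bar> < pi / 2"
  using y
proof (cases rule: Z_cases)
  case (1 x t)
  obtain K where "K \<in> end_leaves" using assms(2) by blast
  moreover have "end_fun K y = squashed K (x,t)" using 1 end_fun_phi[of "(x,t)"] by (simp add: strip_iff)
  ultimately show ?thesis using squashed_bound[of K "(x,t)"] by metis
next
  case (2 L x)
  then have "end_fun L y = arctan x" using end_fun_own[of L "-1" x] mid_bounds(1)[of L] by simp
  then show ?thesis using arctan_bounded[of x] 2(1) by (intro bexI[of _ L]) auto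
qed

text \<open>\<open>squashed K\<close> increases along every level, so its values are ordered like
  the horizontal coordinates. Since they have limits as the level tends to \<open>-1\<close>, it
  suffices that the order holds at levels arbitrarily close to \<open>-1\<close>.\<close>

lemma end_fun_le_of_frequently:
  assumes L: "L \<in> end_leaves" and L': "L' \<in> end_leaves" and K: "K \<in> end_leaves"
    and fr: "\<exists>\<^sub>F t in at_right (-1). fst (inv_phi (end_param L (a, t))) \<le> fst (inv_phi (end_param L' (b, t)))"
  shows "end_fun K (end_param L (a, -1)) \<le> end_fun K (end_param L' (b, -1))"
proof (rule ccontr)
  assume "\<not> ?thesis"
  then obtain c where c: "end_fun K (end_param L' (b, -1)) < c" "c < end_fun K (end_param L (a, -1))" using dense by (meson not_le)
  have lim: "((\<lambda>t. end_fun K (end_param M (x, t))) \<longlongrightarrow> end_fun K (end_param M (x, -1))) (at_right (-1))" if M: "M \<in> end_leaves" for M x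
  proof -
    define c where "c = (mid M - 1) / 2"
    have c: "-1 < c" "c < mid M" using mid_bounds(1)[OF M] by (simp_all add: c_def)
    have "continuous_on {-1..c} (\<lambda>t. end_fun K (end_param M (x, t)))"
      by (rule continuous_on_compose2[OF end_fun_end_param_cont[OF K M]]) (use c in \<open>auto intro!: continuous_intros\<close>)
    then have "((\<lambda>t. end_fun K (end_param M (x, t))) \<longlongrightarrow> end_fun K (end_param M (x, -1))) (at (-1) within {-1..c})"
      using c(1) unfolding continuous_on_def by simp
    then show ?thesis unfolding at_within_Icc_at_right[OF c(1)] .
  qed
  have "\<forall>\<^sub>F t in at_right (-1). end_fun K (end_param L' (b, t)) < c" using order_tendstoD(2)[OF lim[OF L'] c(1)] .
  moreover have "\<forall>\<^sub>F t in at_right (-1). c < end_fun K (end_param L (a, t))" using order_tendstoD(1)[OF lim[OF L] c(2)] .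
  moreover have "\<forall>\<^sub>F t in at_right (-1). -1 < t \<and> t < min (end_level L) (end_level L')"
    using eventually_at_right_real[of "-1" "min (end_level L) (end_level L')"] end_level_bounds(1)[OF L] end_level_bounds(1)[OF L']
    by simp
  ultimately have "\<forall>\<^sub>F t in at_right (-1). \<not> fst (inv_phi (end_param L (a, t))) \<le> fst (inv_phi (end_param L' (b, t)))"
  proof eventually_elim
    case (elim t)
    then have t: "-1 < t" "t < end_level L" "t < end_level L'" by auto
    have "inv_phi (end_param L (a,t)) = (fst (inv_phi (end_param L (a,t))), t)" "inv_phi (end_param L' (b,t)) = (fst (inv_phi (end_param L' (b,t))), t)"
      using end_param_mem(4)[OF L t(1,2)] end_param_mem(4)[OF L' t(1,3)] by (metis prod.collapse)+
    then have "squashed K (fst (inv_phi (end_param L' (b,t))), t) < squashed K (fst (inv_phi (end_param L (a,t))), t)"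
      using elim end_fun_end_param[OF L t(1,2)] end_fun_end_param[OF L' t(1,3)] by (metis order_less_trans)
    then show ?case using strict_mono_less[OF squashed_mono[OF K t(1)]] by auto
  qed
  then show False using fr by (simp add: frequently_def)
qed

text \<open>On a leaf of the half strip every summand increases from \<open>- pi / 2\<close> to
  \<open>pi / 2\<close>. On an end leaf only its own summand varies and the others are constant,
  which still gives strict monotonicity. Different points at the end are kept apart by
  \<open>sep\<close>.\<close>

lemma closure_half_with_ends:
  assumes ne: "end_leaves \<noteq> {}"
  shows "\<exists>S a b F. model_strip S a b F \<and>
    foliated_homeomorphic XZ (restr_fol \<Delta> Z) (top_of_set S) (canonical_fol a b F)"
proof -
  \<comment> \<open>A finite set of end leaves is enumerated with repetitions, which merely changes
    the weights.\<close>
  define E where "E = from_nat_into end_leaves"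
  have E: "E n \<in> end_leaves" for n unfolding E_def by (rule from_nat_into[OF ne])
  have Esurj: "\<exists>n. E n = L" if "L \<in> end_leaves" for L
    unfolding E_def using from_nat_into_surj[OF countable_end_leaves that] .
  define H where "H y = (\<Sum>n. (1/2) ^ Suc n * end_fun (E n) y)" for y
  define U where "U y = tan (H y)" for y
  have Hless: "H y < H z" if "y \<in> Z" "z \<in> Z" "\<And>K. K \<in> end_leaves \<Longrightarrow> end_fun K y \<le> end_fun K z" "L \<in> end_leaves" "end_fun L y < end_fun L z" for y z L
  proof -
    obtain m where m: "E m = L" using Esurj \<open>L \<in> end_leaves\<close> by blast
    show ?thesis
      unfolding H_def
    proof (rule half_series_less[where c = "pi/2" and m = m])
      show "\<bar>end_fun (E n) y\<bar> \<le> pi/2" "\<bar>end_fun (E n) z\<bar> \<le> pi/2" for n by (rule end_fun_bound[OF that(1) E] end_fun_bound[OF that(2) E])+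
      show "end_fun (E n) y \<le> end_fun (E n) z" for n by (rule that(3)[OF E])
      show "end_fun (E m) y < end_fun (E m) z" unfolding m by (rule that(5))
    qed
  qed
  have Hb: "- (pi/2) < H y \<and> H y < pi/2" if y: "y \<in> Z" for y
  proof -
    obtain K where K: "K \<in> end_leaves" "\<bar>end_fun K y\<bar> < pi / 2" using end_fun_strict[OF y ne] by blast
    obtain m where m: "E m = K" using Esurj K(1) by blast
    have ab: "\<bar>end_fun (E n) y\<bar> \<le> pi/2" for n by (rule end_fun_bound[OF y E])
    have lu: "- (pi/2) \<le> end_fun (E n) y" "end_fun (E n) y \<le> pi/2" for n using ab[of n] unfolding abs_le_iff by linarith+
    have lus: "- (pi/2) < end_fun (E m) y" "end_fun (E m) y < pi/2" using K(2) unfolding m abs_less_iff by linarith+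
    have p: "\<bar>pi/2\<bar> \<le> pi/2" "\<bar>- (pi/2)\<bar> \<le> pi/2" by simp_all
    have "(\<Sum>n. (1/2) ^ Suc n * (- (pi/2))) < H y"
      unfolding H_def by (rule half_series_less[where f = "\<lambda>n. - (pi/2)" and g = "\<lambda>n. end_fun (E n) y" and c = "pi/2" and m = m, OF p(2) ab lu(1) lus(1)])
    moreover have "H y < (\<Sum>n. (1/2) ^ Suc n * (pi/2))"
      unfolding H_def by (rule half_series_less[where f = "\<lambda>n. end_fun (E n) y" and g = "\<lambda>n. pi/2" and c = "pi/2" and m = m, OF ab p(1) lu(2) lus(2)])
    ultimately show ?thesis unfolding half_series_const by blast
  qed
  have Uless: "U y < U z \<longleftrightarrow> H y < H z" if "y \<in> Z" "z \<in> Z" for y z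
    unfolding U_def using Hb[OF that(1)] Hb[OF that(2)] by (intro tan_mono_lt_eq) auto
  have contU: "continuous_on S (\<lambda>z. U (f z))"
    if "\<And>K. K \<in> end_leaves \<Longrightarrow> continuous_on S (\<lambda>z. end_fun K (f z))" "\<And>z. z \<in> S \<Longrightarrow> f z \<in> Z"
    for S :: "(real \<times> real) set" and f
  proof -
    have cH: "continuous_on S (\<lambda>z. H (f z))"
      unfolding H_def using that E by (intro half_series_continuous[where c = "pi/2"] end_fun_bound) auto
    have c0: "cos (H (f z)) \<noteq> 0" if "z \<in> S" for z
      using cos_gt_zero_pi[of "H (f z)"] Hb \<open>\<And>z. z \<in> S \<Longrightarrow> f z \<in> Z\<close>[OF that] by fastforce
    have "continuous_on {x::real. cos x \<noteq> 0} tan" by (rule continuous_on_tan) simp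
    from continuous_on_compose2[OF this cH] show ?thesis unfolding U_def using c0 by blast
  qed
  have \<phi>Z: "\<phi> (x,t) \<in> Z" if "t \<in> {-1<..0}" for x t using that Z_subset(2) by (auto simp: lower_half_def)
  have plZ: "end_param L z \<in> Z" if "L \<in> end_leaves" "z \<in> UNIV \<times> {-1..<mid L}" for L z
  proof -
    have "z \<in> UNIV \<times> {-1..<end_level L}" using that mid_bounds(2)[of L] by auto
    then show ?thesis using open_map_imp_subset_topspace[OF end_param_open[OF that(1)]] Z_subset(3) by auto
  qed
  have end_fun\<phi>: "end_fun K (\<phi> (x,t)) = squashed K (x,t)" if "t \<in> {-1<..0}" for K x t
    using that end_fun_phi[of "(x,t)"] by (simp add: strip_iff)
  have c1: "continuous_on (UNIV \<times> {-1<..0}) (\<lambda>z. U (\<phi> z))"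
  proof (rule contU)
    fix K assume K: "K \<in> end_leaves"
    have "continuous_on (UNIV \<times> {-1<..0}) (squashed K)" by (rule continuous_on_subset[OF squashed_cont[OF K]]) auto
    then show "continuous_on (UNIV \<times> {-1<..0}) (\<lambda>z. end_fun K (\<phi> z))" by (rule continuous_on_eq) (use end_fun\<phi> in auto)
  qed (use \<phi>Z in auto)
  have m1: "strict_mono (\<lambda>x. U (\<phi> (x, t)))" if t: "t \<in> {-1<..0}" for t
  proof (rule strict_monoI)
    fix x y :: real assume xy: "x < y"
    have "squashed K (x,t) < squashed K (y,t)" if "K \<in> end_leaves" for K using strict_monoD[OF squashed_mono[OF that] xy] t by simp
    moreover obtain K where "K \<in> end_leaves" using ne by blast
    ultimately have "H (\<phi> (x,t)) < H (\<phi> (y,t))"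
      by (intro Hless[where L = K] \<phi>Z t) (auto simp: end_fun\<phi>[OF t] less_imp_le)
    then show "U (\<phi> (x,t)) < U (\<phi> (y,t))" using Uless \<phi>Z[OF t] by blast
  qed
  have s1: "surj (\<lambda>x. U (\<phi> (x, t)))" if t: "t \<in> {-1<..0}" for t
  proof -
    have b: "\<bar>end_fun (E n) (\<phi> (x,t))\<bar> \<le> pi/2" for n x by (rule end_fun_bound[OF \<phi>Z[OF t] E])
    have l1: "((\<lambda>x. H (\<phi> (x,t))) \<longlongrightarrow> pi/2) at_top"
      unfolding H_def by (rule half_series_tendsto[OF _ b]) (use squashed_lim(1)[OF E] t in \<open>auto simp: end_fun\<phi>[OF t]\<close>)
    have l2: "((\<lambda>x. H (\<phi> (x,t))) \<longlongrightarrow> -(pi/2)) at_bot"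
      unfolding H_def by (rule half_series_tendsto[OF _ b]) (use squashed_lim(2)[OF E] t in \<open>auto simp: end_fun\<phi>[OF t]\<close>)
    have "\<exists>x. U (\<phi> (x,t)) = v" for v
    proof -
      have "\<forall>\<^sub>F x in at_top. arctan v < H (\<phi> (x,t))" using order_tendstoD(1)[OF l1] arctan_ubound by blast
      then obtain x2 where x2: "\<And>x. x2 \<le> x \<Longrightarrow> arctan v < H (\<phi> (x,t))" by (auto simp: eventually_at_top_linorder)
      have "\<forall>\<^sub>F x in at_bot. H (\<phi> (x,t)) < arctan v" using order_tendstoD(2)[OF l2] arctan_lbound by auto
      then obtain x1 where x1: "\<And>x. x \<le> x1 \<Longrightarrow> H (\<phi> (x,t)) < arctan v" by (auto simp: eventually_at_bot_linorder)
      let ?a = "min x1 x2"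
      have va: "tan (arctan v) = v" by (rule tan_arctan)
      have fa: "U (\<phi> (?a,t)) < v"
      proof -
        have "tan (H (\<phi> (?a,t))) < tan (arctan v)"
          using Hb[OF \<phi>Z[OF t], of ?a] x1[of ?a] arctan_lbound[of v] arctan_ubound[of v]
          by (subst tan_mono_lt_eq) auto
        then show ?thesis by (simp add: U_def tan_arctan)
      qed
      have fb: "v < U (\<phi> (x2,t))"
      proof -
        have "tan (arctan v) < tan (H (\<phi> (x2,t)))"
          using Hb[OF \<phi>Z[OF t], of x2] x2[of x2] arctan_lbound[of v] arctan_ubound[of v]
          by (subst tan_mono_lt_eq) auto
        then show ?thesis by (simp add: U_def tan_arctan)
      qed
      have fc: "continuous_on {?a..x2} (\<lambda>x. U (\<phi> (x,t)))"
        by (rule continuous_on_compose2[OF c1]) (use t in \<open>auto intro!: continuous_intros\<close>)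
      show ?thesis
        using IVT'[where f = "\<lambda>x. U (\<phi> (x,t))", OF less_imp_le[OF fa] less_imp_le[OF fb] min.cobounded2 fc]
        by blast
    qed
    then show ?thesis unfolding surj_def by metis
  qed
  have c2: "continuous_on (UNIV \<times> {-1..<mid L}) (\<lambda>z. U (end_param L z))" if L: "L \<in> end_leaves" for L
    by (rule contU[OF end_fun_end_param_cont[OF _ L] plZ[OF L]])
  have own: "end_fun L (end_param L (x,-1)) = arctan x" if "L \<in> end_leaves" for L x
    using end_fun_own[OF that, of "-1" x] mid_bounds(1)[OF that] by simp
  have endZ: "end_param L (x,-1) \<in> Z" if "L \<in> end_leaves" for L x using plZ[OF that, of "(x,-1)"] mid_bounds(1)[OF that] by simp
  have m2: "strict_mono (\<lambda>x. U (end_param L (x, t)))" if L: "L \<in> end_leaves" and t: "t \<in> {-1..<mid L}" for L t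
  proof (rule strict_monoI)
    fix x y :: real assume xy: "x < y"
    show "U (end_param L (x,t)) < U (end_param L (y,t))"
    proof (cases "t = -1")
      case True
      have "end_fun K (end_param L (x,-1)) \<le> end_fun K (end_param L (y,-1))" if K: "K \<in> end_leaves" for K
      proof (cases "L = K")
        case True then show ?thesis using own[OF K] xy by (simp add: arctan_le_iff)
      next
        case False then show ?thesis unfolding end_fun_other[OF K L False] by simp
      qed
      moreover have "end_fun L (end_param L (x,-1)) < end_fun L (end_param L (y,-1))" using own[OF L] xy by (simp add: arctan_less_iff)
      ultimately have "H (end_param L (x,-1)) < H (end_param L (y,-1))" using Hless endZ L by blast
      then show ?thesis using Uless endZ[OF L] True by simp
    next
      case False
      then have t': "-1 < t" "t < end_level L" "t \<in> {-1<..0}" using t mid_bounds(2)[OF L] end_level_bounds(2)[OF L] by auto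
      have "fst (inv_phi (end_param L (x, t))) < fst (inv_phi (end_param L (y, t)))"
        using strict_monoD[OF end_param_mono[OF L t'(1,2)] xy] .
      from strict_monoD[OF m1[OF t'(3)] this] show ?thesis using end_param_mem(5)[OF L t'(1,2)] by simp
    qed
  qed
  have sep: "H (end_param L (a,-1)) < H (end_param L' (b,-1))"
    if L: "L \<in> end_leaves" and L': "L' \<in> end_leaves" and neq: "end_param L (a,-1) \<noteq> end_param L' (b,-1)"
      and fr: "\<exists>\<^sub>F t in at_right (-1). fst (inv_phi (end_param L (a, t))) \<le> fst (inv_phi (end_param L' (b, t)))" for L L' a b
  proof -
    have le: "end_fun K (end_param L (a, -1)) \<le> end_fun K (end_param L' (b, -1))" if "K \<in> end_leaves" for K
      by (rule end_fun_le_of_frequently[OF L L' that fr])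
    \<comment> \<open>The function of the leaf through the first point separates: it is a value of
      \<open>arctan\<close> there, a different one at any other point of the same leaf, and plus or
      minus \<open>pi / 2\<close> on every other end leaf.\<close>
    have "end_fun L (end_param L (a,-1)) \<noteq> end_fun L (end_param L' (b,-1))"
    proof (cases "L' = L")
      case True then show ?thesis using own[OF L] neq by (auto simp: arctan_eq_iff)
    next
      case False
      then show ?thesis
        unfolding own[OF L] end_fun_other[OF L L' False] using end_sign(1)[OF L L' False] arctan_bounded[of a] by auto
    qed
    then have "end_fun L (end_param L (a,-1)) < end_fun L (end_param L' (b,-1))" using le[OF L] by simp
    then show ?thesis using Hless endZ le L L' by blast
  qed
  have iU: "inj_on U (\<Union>end_leaves)"
  proof (rule inj_onI, rule ccontr)
    fix y z assume yz: "y \<in> \<Union>end_leaves" "z \<in> \<Union>end_leaves" "U y = U z" "y \<noteq> z"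
    obtain L a where L: "L \<in> end_leaves" "y = end_param L (a,-1)" by (rule end_leaves_point[OF yz(1)])
    obtain L' b where L': "L' \<in> end_leaves" "z = end_param L' (b,-1)" by (rule end_leaves_point[OF yz(2)])
    let ?P = "\<lambda>t. fst (inv_phi (end_param L (a, t))) \<le> fst (inv_phi (end_param L' (b, t)))"
    \<comment> \<open>The order of the two transversals may change from level to level, but one of
      the two orders holds at levels arbitrarily close to \<open>-1\<close>.\<close>
    have "(\<exists>\<^sub>F t in at_right (-1). ?P t) \<or> (\<exists>\<^sub>F t in at_right (-1). fst (inv_phi (end_param L' (b, t))) \<le> fst (inv_phi (end_param L (a, t))))"
    proof (rule disjCI)
      assume "\<not> (\<exists>\<^sub>F t in at_right (-1). fst (inv_phi (end_param L' (b, t))) \<le> fst (inv_phi (end_param L (a, t))))"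
      then have "\<forall>\<^sub>F t in at_right (-1). ?P t"
        unfolding not_frequently by (rule eventually_mono) auto
      then show "\<exists>\<^sub>F t in at_right (-1). ?P t" by (rule eventually_frequently[OF trivial_limit_at_right_real])
    qed
    then have "H y < H z \<or> H z < H y"
    proof
      assume "\<exists>\<^sub>F t in at_right (-1). ?P t"
      from sep[OF L(1) L'(1) _ this] show ?thesis using yz(4) L(2) L'(2) by simp
    next
      assume "\<exists>\<^sub>F t in at_right (-1). fst (inv_phi (end_param L' (b, t))) \<le> fst (inv_phi (end_param L (a, t)))"
      from sep[OF L'(1) L(1) _ this] show ?thesis using yz(4) L(2) L'(2) by simp
    qed
    moreover have "y \<in> Z" "z \<in> Z" using endZ L L' by simp_all
    ultimately have "U y < U z \<or> U z < U y" by (simp add: Uless)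
    then show False using yz(3) by simp
  qed
  have "-1 < mid L \<and> mid L \<le> end_level L" if "L \<in> end_leaves" for L using mid_bounds[OF that] by simp
  from assemble[OF this c1 m1 s1 c2 m2 iU] show ?thesis .
qed

theorem closure_half_model_strip:
  "\<exists>S a b F. model_strip S a b F \<and>
    foliated_homeomorphic XZ (restr_fol \<Delta> Z) (top_of_set S) (canonical_fol a b F)"
proof (cases "end_leaves = {}")
  case False
  then show ?thesis by (rule closure_half_with_ends)
next
  case True
  \<comment> \<open>Without end leaves there is nothing to sum, and the horizontal coordinate of the
    strip already straightens the closure.\<close>
  define U where "U y = fst (inv_phi y)" for y
  have U\<phi>: "U (\<phi> (x,t)) = x" if "t \<in> {-1<..0}" for x t
    using that inv_phi(1)[of "(x,t)"] by (simp add: U_def strip_iff)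
  show ?thesis
  proof (rule assemble[where d = mid and U = U])
    have "continuous_on (UNIV \<times> {-1<..0::real}) (fst :: real \<times> real \<Rightarrow> real)" by (intro continuous_intros)
    then show "continuous_on (UNIV \<times> {-1<..0}) (\<lambda>z. U (\<phi> z))" by (rule continuous_on_eq) (use U\<phi> in auto)
    show "strict_mono (\<lambda>x. U (\<phi> (x, t)))" "surj (\<lambda>x. U (\<phi> (x, t)))" if "t \<in> {-1<..0}" for t
      using U\<phi>[OF that] by (auto simp: strict_mono_def)
  qed (use True in auto)
qed

end

section \<open>Reflection of the strip and conclusion\<close>

lemma foliated_homeo_map_reflect:
  assumes "foliated_homeo_map (top_of_set open_strip) open_strip_fol Y \<Gamma> \<phi>"
  shows "foliated_homeo_map (top_of_set open_strip) open_strip_fol Y \<Gamma> (\<lambda>z. \<phi> (fst z, - snd z))"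
proof -
  let ?r = "\<lambda>z::real\<times>real. (fst z, - snd z)"
  have "homeomorphic_maps (top_of_set open_strip) (top_of_set open_strip) ?r ?r"
    by (auto simp: homeomorphic_maps_def continuous_map_in_subtopology open_strip_def intro!: continuous_intros)
  then have "homeomorphic_map (top_of_set open_strip) Y (\<phi> \<circ> ?r)"
    using homeomorphic_maps_imp_map homeomorphic_map_compose assms unfolding foliated_homeo_map_def by blast
  moreover have "(\<lambda>L. (\<phi> \<circ> ?r) ` L) ` open_strip_fol = \<Gamma>"
  proof -
    have o: "open_strip_fol = (\<lambda>t. UNIV \<times> {t}) ` {-1<..<1}" by (auto simp: open_strip_fol_def)
    have r: "?r ` (UNIV \<times> {t}) = UNIV \<times> {-t}" for t by force
    have n: "uminus ` {-1<..<1::real} = {-1<..<1}" by simp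
    have "(\<lambda>L. ?r ` L) ` open_strip_fol = (\<lambda>t. UNIV \<times> {t}) ` uminus ` {-1<..<1}"
      unfolding o image_image r ..
    then have "(\<lambda>L. ?r ` L) ` open_strip_fol = open_strip_fol" by (simp only: n o)
    then have "(\<lambda>L. \<phi> ` L) ` (\<lambda>L. ?r ` L) ` open_strip_fol = \<Gamma>"
      using assms by (simp add: foliated_homeo_map_def)
    then show ?thesis by (simp add: image_image image_comp o_def)
  qed
  ultimately show ?thesis by (simp add: foliated_homeo_map_def o_def)
qed

theorem theorem1p8:
  fixes X :: "'a topology" and \<Delta> :: "'a set set" and Q :: "'a set" and q :: 'a
  assumes manifold: "two_manifold X"
    and conn: "connected_space X"
    and folF: "class_F X \<Delta>"
    and locfin: "loc_finite_family X (special_leaves X \<Delta>)"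
    and q: "q \<in> topspace X - (\<Union>(special_leaves X \<Delta>) \<union> mboundary X)"
    and Q: "Q = connected_component_of_set
                 (subtopology X (topspace X - (\<Union>(special_leaves X \<Delta>) \<union> mboundary X))) q"
  shows "((foliated_homeomorphic (subtopology X Q) (restr_fol \<Delta> Q) std_cylinder std_cylinder_fol
            \<and> Q = topspace X)
       \<or> (foliated_homeomorphic (subtopology X Q) (restr_fol \<Delta> Q) std_moebius std_moebius_fol
            \<and> Q = topspace X)
       \<or> foliated_homeomorphic (subtopology X Q) (restr_fol \<Delta> Q) (top_of_set open_strip) open_strip_fol)
       \<and> (\<forall>\<phi>. foliated_homeo_map (top_of_set open_strip) open_strip_fol
                 (subtopology X Q) (restr_fol \<Delta> Q) \<phi> \<longrightarrow>
           (\<exists>S a b F. model_strip S a b F \<and>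
              foliated_homeomorphic
                (subtopology X (X closure_of (\<phi> ` ((UNIV::real set) \<times> {-1<..0}))))
                (restr_fol \<Delta> (X closure_of (\<phi> ` ((UNIV::real set) \<times> {-1<..0}))))
                (top_of_set S) (canonical_fol a b F)) \<and>
           (\<exists>S a b F. model_strip S a b F \<and>
              foliated_homeomorphic
                (subtopology X (X closure_of (\<phi> ` ((UNIV::real set) \<times> {0..<1}))))
                (restr_fol \<Delta> (X closure_of (\<phi> ` ((UNIV::real set) \<times> {0..<1}))))
                (top_of_set S) (canonical_fol a b F)))"
proof -
  have "foliated_space X \<Delta>"
    using manifold folF by (simp add: foliated_space_def two_manifold_def)
  then interpret region X \<Delta> Q q
    using locfin q Q by (intro region.intro region_axioms.intro)
  have half: "\<exists>S a b F. model_strip S a b F \<and>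
      foliated_homeomorphic
        (subtopology X (X closure_of (\<phi> ` ((UNIV::real set) \<times> {-1<..0}))))
        (restr_fol \<Delta> (X closure_of (\<phi> ` ((UNIV::real set) \<times> {-1<..0}))))
        (top_of_set S) (canonical_fol a b F)"
    if "foliated_homeo_map (top_of_set open_strip) open_strip_fol (subtopology X Q) (restr_fol \<Delta> Q) \<phi>" for \<phi>
  proof -
    interpret strip_region X \<Delta> Q q \<phi> by unfold_locales (rule that)
    show ?thesis using closure_half_model_strip unfolding Z_def lower_half_def .
  qed
  have flip: "(\<lambda>z. \<phi> (fst z, - snd z)) ` (UNIV \<times> {-1<..0}) = \<phi> ` (UNIV \<times> {0..<1})" for \<phi> :: "real \<times> real \<Rightarrow> 'a"
  proof -
    have "(\<lambda>z::real\<times>real. (fst z, - snd z)) ` (UNIV \<times> {-1<..0}) = UNIV \<times> {0..<1}"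
    proof
      show "UNIV \<times> {0..<1} \<subseteq> (\<lambda>z::real\<times>real. (fst z, - snd z)) ` (UNIV \<times> {-1<..0})"
      proof clarify
        fix x t :: real assume "t \<in> {0..<1}"
        then show "(x,t) \<in> (\<lambda>z. (fst z, - snd z)) ` (UNIV \<times> {-1<..0})"
          by (intro image_eqI[of _ _ "(x,-t)"]) auto
      qed
    qed auto
    then show ?thesis by (metis image_image)
  qed
  have part1: "(foliated_homeomorphic (subtopology X Q) (restr_fol \<Delta> Q) std_cylinder std_cylinder_fol \<and> Q = topspace X)
       \<or> (foliated_homeomorphic (subtopology X Q) (restr_fol \<Delta> Q) std_moebius std_moebius_fol \<and> Q = topspace X)
       \<or> foliated_homeomorphic (subtopology X Q) (restr_fol \<Delta> Q) (top_of_set open_strip) open_strip_fol"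
    using TQ_cases circle_case[OF conn] line_case by blast
  \<comment> \<open>Reversing the transverse direction turns the upper half of the strip into a
    lower half.\<close>
  show ?thesis
    using part1 half half[OF foliated_homeo_map_reflect, unfolded flip] by blast
qed

end
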